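(* Let $G$ be a finitely generated group which is hyperbolic relative to a (nonempty, finite) family of subgroups $\mathcal{P}=\{H_1,\dots,H_k\}$, each of infinite index in $G$. Then $G$ (as a discrete group) does not have strong Property $(T)$ (with respect to Hilbert spaces).
   Context: A length function on a topological group $G$ is a continuous function $l:G\to\mathbb{R}_+$ with $l(g)=l(g^{-1})$ and $l(g_1g_2)\le l(g_1)+l(g_2)$. A locally compact group $G$ has strong Property $(T)$ (with respect to Hilbert spaces) if for every length function $l$ on $G$ there is a sequence of compactly supported symmetric Borel measures $m_n$ on $G$ such that, for every Hilbert space $H$, there is a constant $t>0$ such that: for every strongly continuous representation $\pi$ of $G$ on $H$ satisfying $\|\pi(g)\|_{B(H)}\le L e^{t\,l(g)}$ for all $g \in G$, for some $L\in\mathbb{R}_+$, the operators $\pi(m_n)$ converge in the norm topology of $B(H)$ to a projection on the space of $\pi(G)$-invariant vectors of $H$. Coned-off graph: let $G$ be finitely generated, $H_1,\dots,H_k$ subgroups, and $Cay(G)$ a Cayley graph with respect to a finite generating set. The coned-off graph $\widehat{Cay}(G)$ is obtained from $Cay(G)$ by adding, for each $i$ and each left coset $gH_i$, a vertex $\widehat{gH_i}$, and for each $h\in H_i$ an edge from $\widehat{gH_i}$ to $gh$. $G$ is hyperbolic relative to $H_1,\dots,H_k$ if one (equivalently every) such coned-off graph is hyperbolic and uniformly fine. A connected graph is $\delta$-hyperbolic, $\delta>0$, if in every geodesic triangle each side is contained in the $\delta$-neighbourhood of the union of the other two; hyperbolic means $\delta$-hyperbolic for some $\delta$. A graph is uniformly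 fine if for every edge $e$ and $L\ge0$ the number of simple simplicial loops of length at most $L$ containing $e$ is finite and bounded by a function of $L$ only. *)

theory Defs
  imports "HOL-Analysis.Analysis" "HOL-Algebra.Left_Coset" "HOL-Algebra.Generated_Groups"
    "HOL-Algebra.Module"
begin

section \<open>Complex Hilbert spaces with an explicit carrier\<close>

text \<open>
  Strong Property (T) quantifies over all Hilbert spaces, including finite-dimensional ones, so
  Hilbert spaces have to be values rather than types: a vector space is a module over the field of
  complex numbers, whose carrier is a subset of a type \<open>'h\<close>.
\<close>

definition complex_ring :: "complex ring" where
  "complex_ring = \<lparr>carrier = UNIV, mult = (*), one = 1, zero = 0, add = (+)\<rparr>"

record 'h ip_space = "(complex, 'h) module" +
  ip :: "'h \<Rightarrow> 'h \<Rightarrow> complex"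

definition vnorm :: "'h ip_space \<Rightarrow> 'h \<Rightarrow> real" where
  "vnorm H x = sqrt (Re (ip H x x))"

text \<open>The value 0 outside the carrier is needed for \<^term>\<open>Metric_space\<close>, which asks for
  symmetry on the whole type.\<close>
definition vdist :: "'h ip_space \<Rightarrow> 'h \<Rightarrow> 'h \<Rightarrow> real" where
  "vdist H x y = (if x \<in> carrier H \<and> y \<in> carrier H then vnorm H (x \<ominus>\<^bsub>H\<^esub> y) else 0)"

definition hilbert_space :: "'h ip_space \<Rightarrow> bool" where
  "hilbert_space H \<longleftrightarrow>
     Module.module complex_ring H \<and>
     (\<forall>x\<in>carrier H. \<forall>y\<in>carrier H. \<forall>z\<in>carrier H. ip H (x \<oplus>\<^bsub>H\<^esub> y) z = ip H x z + ip H y z) \<and>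
     (\<forall>a. \<forall>x\<in>carrier H. \<forall>y\<in>carrier H. ip H (a \<odot>\<^bsub>H\<^esub> x) y = a * ip H x y) \<and>
     (\<forall>x\<in>carrier H. \<forall>y\<in>carrier H. ip H y x = cnj (ip H x y)) \<and>
     (\<forall>x\<in>carrier H. x \<noteq> \<zero>\<^bsub>H\<^esub> \<longrightarrow> 0 < Re (ip H x x)) \<and>
     Metric_space.mcomplete (carrier H) (vdist H)"

definition bounded_ops :: "'h ip_space \<Rightarrow> ('h \<Rightarrow> 'h) set" where
  "bounded_ops H = {A. A \<in> carrier H \<rightarrow> carrier H \<and>
     (\<forall>x\<in>carrier H. \<forall>y\<in>carrier H. A (x \<oplus>\<^bsub>H\<^esub> y) = A x \<oplus>\<^bsub>H\<^esub> A y) \<and>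
     (\<forall>a. \<forall>x\<in>carrier H. A (a \<odot>\<^bsub>H\<^esub> x) = a \<odot>\<^bsub>H\<^esub> A x) \<and>
     (\<exists>C. \<forall>x\<in>carrier H. vnorm H (A x) \<le> C * vnorm H x)}"

definition op_norm :: "'h ip_space \<Rightarrow> ('h \<Rightarrow> 'h) \<Rightarrow> real" where
  "op_norm H A = Inf {C. 0 \<le> C \<and> (\<forall>x\<in>carrier H. vnorm H (A x) \<le> C * vnorm H x)}"


section \<open>Strong Property (T)\<close>

text \<open>A group \<open>G\<close> in the sense of HOL-Algebra is given a topology \<open>T\<close> with
  \<^prop>\<open>topspace T = carrier G\<close>; the definitions are meant for locally compact topological groups.\<close>

definition length_function :: "('a, 'b) monoid_scheme \<Rightarrow> 'a topology \<Rightarrow> ('a \<Rightarrow> real) \<Rightarrow> bool" where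
  "length_function G T l \<longleftrightarrow>
     continuous_map T euclideanreal l \<and>
     (\<forall>g\<in>carrier G. 0 \<le> l g \<and> l (inv\<^bsub>G\<^esub> g) = l g) \<and>
     (\<forall>g\<in>carrier G. \<forall>h\<in>carrier G. l (g \<otimes>\<^bsub>G\<^esub> h) \<le> l g + l h)"

text \<open>Finiteness is the usual requirement that a Borel measure be finite on compact sets; without
  it, integrals of a representation against the measure would not be defined.\<close>
definition symmetric_compactly_supported_measure ::
    "('a, 'b) monoid_scheme \<Rightarrow> 'a topology \<Rightarrow> 'a measure \<Rightarrow> bool" where
  "symmetric_compactly_supported_measure G T m \<longleftrightarrow>
     space m = topspace T \<and>
     sets m = sigma_sets (topspace T) {U. openin T U} \<and>
     finite_measure m \<and>
     (\<exists>K. compactin T K \<and> closedin T K \<and> emeasure m (topspace T - K) = 0) \<and>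
     (\<forall>A\<in>sets m. emeasure m ((\<lambda>g. inv\<^bsub>G\<^esub> g) ` A) = emeasure m A)"

definition representation ::
    "('a, 'b) monoid_scheme \<Rightarrow> 'a topology \<Rightarrow> 'h ip_space \<Rightarrow> ('a \<Rightarrow> 'h \<Rightarrow> 'h) \<Rightarrow> bool" where
  "representation G T H \<pi> \<longleftrightarrow>
     (\<forall>g\<in>carrier G. \<pi> g \<in> bounded_ops H) \<and>
     (\<forall>x\<in>carrier H. \<pi> \<one>\<^bsub>G\<^esub> x = x) \<and>
     (\<forall>g\<in>carrier G. \<forall>h\<in>carrier G. \<forall>x\<in>carrier H. \<pi> (g \<otimes>\<^bsub>G\<^esub> h) x = \<pi> g (\<pi> h x)) \<and>
     (\<forall>x\<in>carrier H. continuous_map T (Metric_space.mtopology (carrier H) (vdist H)) (\<lambda>g. \<pi> g x))"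

definition invariants ::
    "('a, 'b) monoid_scheme \<Rightarrow> 'h ip_space \<Rightarrow> ('a \<Rightarrow> 'h \<Rightarrow> 'h) \<Rightarrow> 'h set" where
  "invariants G H \<pi> = {x \<in> carrier H. \<forall>g\<in>carrier G. \<pi> g x = x}"

text \<open>The operator \<open>\<pi>(m) = \<integral> \<pi>(g) dm(g)\<close>, as a weak integral.\<close>
definition rep_measure ::
    "'h ip_space \<Rightarrow> ('a \<Rightarrow> 'h \<Rightarrow> 'h) \<Rightarrow> 'a measure \<Rightarrow> 'h \<Rightarrow> 'h" where
  "rep_measure H \<pi> m x =
     (THE v. v \<in> carrier H \<and> (\<forall>y\<in>carrier H. ip H v y = (\<integral>g. ip H (\<pi> g x) y \<partial>m)))"

definition converges_to_projection_on ::
    "'h ip_space \<Rightarrow> (nat \<Rightarrow> 'h \<Rightarrow> 'h) \<Rightarrow> 'h set \<Rightarrow> bool" where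
  "converges_to_projection_on H A W \<longleftrightarrow>
     (\<forall>n. A n \<in> bounded_ops H) \<and>
     (\<exists>P\<in>bounded_ops H.
        P ` carrier H = W \<and> (\<forall>x\<in>carrier H. P (P x) = P x) \<and>
        (\<lambda>n. op_norm H (\<lambda>x. A n x \<ominus>\<^bsub>H\<^esub> P x)) \<longlonglongrightarrow> 0)"

text \<open>
  The measures \<open>m\<^sub>n\<close> may be signed: they are written \<open>p n - q n\<close> with positive measures \<open>p n\<close> and
  \<open>q n\<close> (by uniqueness of the Jordan decomposition, these can be taken symmetric and compactly
  supported when \<open>m\<^sub>n\<close> is). Positive measures are the case \<open>q n = 0\<close>, so the failure of the property
  below implies its failure when only positive measures are allowed.

  HOL cannot quantify over types inside a formula, so the Hilbert spaces are those whose carrier lies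
  in the type \<open>'h\<close>. The property can only get stronger when \<open>'h\<close> grows, so its failure for one \<open>'h\<close>
  implies its failure for the class of all Hilbert spaces.
\<close>
definition strong_property_T ::
    "'h itself \<Rightarrow> ('a, 'b) monoid_scheme \<Rightarrow> 'a topology \<Rightarrow> bool" where
  "strong_property_T (_ :: 'h itself) G T \<longleftrightarrow>
     (\<forall>l. length_function G T l \<longrightarrow>
       (\<exists>p q :: nat \<Rightarrow> 'a measure.
         (\<forall>n. symmetric_compactly_supported_measure G T (p n) \<and>
              symmetric_compactly_supported_measure G T (q n)) \<and>
         (\<forall>H :: 'h ip_space. hilbert_space H \<longrightarrow>
           (\<exists>t>0. \<forall>\<pi>. representation G T H \<pi> \<longrightarrow>
             (\<exists>L\<ge>0. \<forall>g\<in>carrier G. op_norm H (\<pi> g) \<le> L * exp (t * l g)) \<longrightarrow>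
             converges_to_projection_on H
               (\<lambda>n x. rep_measure H \<pi> (p n) x \<ominus>\<^bsub>H\<^esub> rep_measure H \<pi> (q n) x)
               (invariants G H \<pi>)))))"


section \<open>Hyperbolic and uniformly fine graphs\<close>

text \<open>A simple graph is given by its vertex set \<open>V\<close> and its set \<open>E\<close> of two-element edges; paths,
  distances and geodesics are combinatorial.\<close>

definition walk :: "'v set \<Rightarrow> 'v set set \<Rightarrow> 'v list \<Rightarrow> bool" where
  "walk V E p \<longleftrightarrow> p \<noteq> [] \<and> set p \<subseteq> V \<and> (\<forall>i. Suc i < length p \<longrightarrow> {p ! i, p ! Suc i} \<in> E)"

definition graph_connected :: "'v set \<Rightarrow> 'v set set \<Rightarrow> bool" where
  "graph_connected V E \<longleftrightarrow> (\<forall>u\<in>V. \<forall>v\<in>V. \<exists>p. walk V E p \<and> hd p = u \<and> last p = v)"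

definition graph_dist :: "'v set \<Rightarrow> 'v set set \<Rightarrow> 'v \<Rightarrow> 'v \<Rightarrow> nat" where
  "graph_dist V E u v = (LEAST n. \<exists>p. walk V E p \<and> hd p = u \<and> last p = v \<and> length p = Suc n)"

definition geodesic :: "'v set \<Rightarrow> 'v set set \<Rightarrow> 'v list \<Rightarrow> bool" where
  "geodesic V E p \<longleftrightarrow> walk V E p \<and> length p = Suc (graph_dist V E (hd p) (last p))"

text \<open>Only the side \<open>p\<close> is mentioned; the other two sides are covered by rotating the triangle.\<close>
definition delta_hyperbolic :: "'v set \<Rightarrow> 'v set set \<Rightarrow> real \<Rightarrow> bool" where
  "delta_hyperbolic V E \<delta> \<longleftrightarrow>
     (\<forall>p q r. geodesic V E p \<and> geodesic V E q \<and> geodesic V E r \<and>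
              last p = hd q \<and> last q = hd r \<and> last r = hd p \<longrightarrow>
        (\<forall>x\<in>set p. \<exists>y\<in>set q \<union> set r. real (graph_dist V E x y) \<le> \<delta>))"

definition hyperbolic_graph :: "'v set \<Rightarrow> 'v set set \<Rightarrow> bool" where
  "hyperbolic_graph V E \<longleftrightarrow> graph_connected V E \<and> (\<exists>\<delta>>0. delta_hyperbolic V E \<delta>)"

text \<open>A simple loop is identified with its set of edges, so its length is the cardinality.\<close>
definition simple_loops :: "'v set \<Rightarrow> 'v set set \<Rightarrow> 'v set set set" where
  "simple_loops V E =
     {C. \<exists>p. walk V E p \<and> distinct p \<and> 3 \<le> length p \<and> {last p, hd p} \<in> E \<and>
          C = insert {last p, hd p} {{p ! i, p ! Suc i} | i. Suc i < length p}}"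

definition uniformly_fine :: "'v set \<Rightarrow> 'v set set \<Rightarrow> bool" where
  "uniformly_fine V E \<longleftrightarrow>
     (\<exists>f :: nat \<Rightarrow> nat. \<forall>e\<in>E. \<forall>L.
        finite {C \<in> simple_loops V E. e \<in> C \<and> card C \<le> L} \<and>
        card {C \<in> simple_loops V E. e \<in> C \<and> card C \<le> L} \<le> f L)"


section \<open>Relatively hyperbolic groups\<close>

definition finite_generating_set :: "('a, 'b) monoid_scheme \<Rightarrow> 'a set \<Rightarrow> bool" where
  "finite_generating_set G S \<longleftrightarrow> finite S \<and> S \<subseteq> carrier G \<and> generate G S = carrier G"

definition finitely_generated :: "('a, 'b) monoid_scheme \<Rightarrow> bool" where
  "finitely_generated G \<longleftrightarrow> (\<exists>S. finite_generating_set G S)"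

text \<open>\<open>Cone i C\<close> is the vertex added for the coset \<open>C\<close> of the \<open>i\<close>-th subgroup.\<close>
datatype 'a cone_vertex = Elt 'a | Cone nat "'a set"

definition coned_off_vertices ::
    "('a, 'b) monoid_scheme \<Rightarrow> nat \<Rightarrow> (nat \<Rightarrow> 'a set) \<Rightarrow> 'a cone_vertex set" where
  "coned_off_vertices G k P =
     Elt ` carrier G \<union> {Cone i C | i C. i \<in> {1..k} \<and> C \<in> lcosets\<^bsub>G\<^esub> (P i)}"

definition cayley_edges :: "('a, 'b) monoid_scheme \<Rightarrow> 'a set \<Rightarrow> 'a set set" where
  "cayley_edges G S = {{g, g \<otimes>\<^bsub>G\<^esub> s} | g s. g \<in> carrier G \<and> s \<in> S - {\<one>\<^bsub>G\<^esub>}}"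

definition coned_off_edges ::
    "('a, 'b) monoid_scheme \<Rightarrow> 'a set \<Rightarrow> nat \<Rightarrow> (nat \<Rightarrow> 'a set) \<Rightarrow> 'a cone_vertex set set" where
  "coned_off_edges G S k P =
     image Elt ` cayley_edges G S \<union>
     {{Cone i (g <#\<^bsub>G\<^esub> P i), Elt (g \<otimes>\<^bsub>G\<^esub> h)} | i g h. i \<in> {1..k} \<and> g \<in> carrier G \<and> h \<in> P i}"

definition relatively_hyperbolic ::
    "('a, 'b) monoid_scheme \<Rightarrow> nat \<Rightarrow> (nat \<Rightarrow> 'a set) \<Rightarrow> bool" where
  "relatively_hyperbolic G k P \<longleftrightarrow>
     (\<exists>S. finite_generating_set G S \<and>
          hyperbolic_graph (coned_off_vertices G k P) (coned_off_edges G S k P) \<and>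
          uniformly_fine (coned_off_vertices G k P) (coned_off_edges G S k P))"

end

theory Submission
  imports Defs
begin

text \<open>
  Fix a base vertex \<open>c\<close> of the coned-off graph. Two vertices lie in the same atom of level \<open>m\<close> if their
  distance functions differ by a constant on the ball of radius \<open>m\<close> around \<open>c\<close>; the atoms form a rooted
  tree of partitions of the vertex set. The Hilbert space consists of the finitely additive measures \<open>F\<close>
  on the sets generated by all atoms for which the sum of \<open>(m + 1)^8 |F(D)|^2\<close> over the atoms \<open>D\<close> of
  level \<open>m\<close> converges, and the group acts by translation.

  By thinness of triangles and fineness, an atom seen from another base vertex at distance \<open>l\<close> is a signed
  sum of \<open>O(l)\<close> atoms seen from \<open>c\<close>, of levels comparable up to \<open>O(l)\<close>. Hence the norm of the action of
  \<open>g\<close> is polynomial in the length \<open>d(c, g c)\<close>, so it is dominated by \<open>L exp (t d(c, g c))\<close> for every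
  \<open>t > 0\<close>. Fineness enters only through angles: two edges are near if they lie on a short simple loop, and
  each edge has boundedly many near edges.

  The total mass is an invariant functional. It vanishes on invariant vectors: cutting midway between two
  distant base vertices of one orbit expresses the total mass by polynomially many atoms of high level as seen
  from one or the other, and for an invariant vector the values on both kinds are small. In a group with strong
  Property (T), the limit projection would preserve the total mass, as one sees from the trivial representation.

  Orbits are unbounded because in a fine graph of bounded diameter the set of central vertices is finite; its
  invariance would make a peripheral subgroup, or the trivial group, have finite index.
\<close>

section \<open>Distances and geodesics in a connected graph\<close>

text \<open>Cone vertices may have infinite valency, so balls may be infinite and a level may
  contain infinitely many atoms. Every count below therefore runs over edges reached from a finite
  set of edges by boundedly many small angles. Signs are unavoidable: already in a tree of infinite
  valency, an atom of positive level seen from \<open>c'\<close> that contains \<open>c\<close> is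
  the whole vertex set minus a branch. Hence a guess that may change in both directions
  (\<open>status\<close>), instead of a partition. The exponents come from a count. Changing the
  base point by \<open>l\<close> costs O(l) by Cauchy-Schwarz over the jumps, O(l) for the
  multiplicity with which an atom occurs and O(l^8) for the weights: the squared norm grows like
  l^10, the norm like l^5. The total mass is cut into O(l^3) terms, since the overlap of two linear
  families has O(l^2) pairs with O(l) jumps each. An atom of level about l/2 has value O(l^-4),
  which wins because 8 > 6. Functionals rather than functions are used because the total mass is
  then a coordinate, the value on the only atom of level 0, hence bounded for the norm.\<close>

locale conn_graph =
  fixes V :: "'v set" and E :: "'v set set"
  assumes edge_ends: "e \<in> E \<Longrightarrow> \<exists>u v. e = {u, v} \<and> u \<noteq> v \<and> u \<in> V \<and> v \<in> V"
    and connected: "graph_connected V E"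
begin

abbreviation d :: "'v \<Rightarrow> 'v \<Rightarrow> nat" where "d \<equiv> graph_dist V E"

lemma edge_verts: assumes "{u, v} \<in> E" shows "u \<in> V" "v \<in> V" "u \<noteq> v"
  using edge_ends[OF assms] by (auto simp: doubleton_eq_iff)

text \<open>Without the list, existence of a walk of given length obeys the recursion
  \<open>wlk_Suc\<close>, and facts about distances become inductions on the length.\<close>

definition wlk :: "nat \<Rightarrow> 'v \<Rightarrow> 'v \<Rightarrow> bool" where
  "wlk n u v \<longleftrightarrow> (\<exists>p. walk V E p \<and> hd p = u \<and> last p = v \<and> length p = Suc n)"

lemma wlk_0: "wlk 0 u v \<longleftrightarrow> u \<in> V \<and> u = v"
proof
  assume "wlk 0 u v"
  then show "u \<in> V \<and> u = v" by (auto simp: wlk_def walk_def length_Suc_conv)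
next
  assume "u \<in> V \<and> u = v"
  then show "wlk 0 u v" unfolding wlk_def walk_def by (intro exI[of _ "[u]"]) auto
qed

lemma wlk_Suc: "wlk (Suc n) u v \<longleftrightarrow> (\<exists>w. {u, w} \<in> E \<and> wlk n w v)"
proof
  assume "wlk (Suc n) u v"
  then obtain p where p: "walk V E p" "hd p = u" "last p = v" "length p = Suc (Suc n)"
    by (auto simp: wlk_def)
  then obtain q where q: "p = u # q" "length q = Suc n"
    by (metis length_Suc_conv list.sel(1))
  have "q \<noteq> []" using q by auto
  have "{p ! 0, p ! Suc 0} \<in> E" using p q unfolding walk_def by auto
  then have 1: "{u, hd q} \<in> E" using q \<open>q \<noteq> []\<close> by (simp add: hd_conv_nth)
  have "walk V E q" unfolding walk_def
  proof (intro conjI allI impI)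
    fix i assume "Suc i < length q"
    then have "{p ! Suc i, p ! Suc (Suc i)} \<in> E" using p q unfolding walk_def by auto
    then show "{q ! i, q ! Suc i} \<in> E" using q by simp
  qed (use p q \<open>q \<noteq> []\<close> in \<open>auto simp: walk_def\<close>)
  then have "wlk n (hd q) v" unfolding wlk_def using p q \<open>q \<noteq> []\<close> by auto
  then show "\<exists>w. {u, w} \<in> E \<and> wlk n w v" using 1 by blast
next
  assume "\<exists>w. {u, w} \<in> E \<and> wlk n w v"
  then obtain w q where q: "{u, w} \<in> E" "walk V E q" "hd q = w" "last q = v" "length q = Suc n"
    by (auto simp: wlk_def)
  have "q \<noteq> []" using q by auto
  have "walk V E (u # q)" unfolding walk_def
  proof (intro conjI allI impI)
    fix i assume "Suc i < length (u # q)"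
    then show "{(u # q) ! i, (u # q) ! Suc i} \<in> E"
      using q \<open>q \<noteq> []\<close> by (cases i) (auto simp: walk_def hd_conv_nth)
  qed (use q edge_verts[OF q(1)] in \<open>auto simp: walk_def\<close>)
  then show "wlk (Suc n) u v" unfolding wlk_def using q \<open>q \<noteq> []\<close>
    by (intro exI[of _ "u # q"]) auto
qed

lemma wlk_trans: "wlk n u v \<Longrightarrow> wlk m v w \<Longrightarrow> wlk (n + m) u w"
  by (induction n arbitrary: u) (auto simp: wlk_0 wlk_Suc)

lemma wlk_1: "{u, v} \<in> E \<Longrightarrow> wlk 1 u v"
  unfolding One_nat_def wlk_Suc wlk_0 using edge_verts by blast

lemma wlk_sym: "wlk n u v \<Longrightarrow> wlk n v u"
proof (induction n arbitrary: u)
  case (Suc n)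
  then obtain w where "{u, w} \<in> E" "wlk n w v" by (auto simp: wlk_Suc)
  then have "wlk n v w" "wlk 1 w u" using Suc.IH wlk_1[of w u] by (auto simp: insert_commute)
  then show ?case using wlk_trans by fastforce
qed (auto simp: wlk_0)

lemma d_eq: "d u v = (LEAST n. wlk n u v)"
  unfolding graph_dist_def wlk_def ..

lemma wlk_d: assumes "u \<in> V" "v \<in> V" shows "wlk (d u v) u v"
proof -
  obtain p where p: "walk V E p" "hd p = u" "last p = v"
    using connected assms unfolding graph_connected_def by blast
  then have "length p = Suc (length p - 1)" unfolding walk_def by (cases p) auto
  then have "wlk (length p - 1) u v" unfolding wlk_def using p by blast
  then show ?thesis unfolding d_eq by (rule LeastI)
qed

lemma d_le: "wlk n u v \<Longrightarrow> d u v \<le> n"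
  unfolding d_eq by (rule Least_le)

lemma d_refl [simp]: "u \<in> V \<Longrightarrow> d u u = 0"
  using d_le[of 0 u u] by (simp add: wlk_0)

lemma d_0: "u \<in> V \<Longrightarrow> v \<in> V \<Longrightarrow> d u v = 0 \<longleftrightarrow> u = v"
  using wlk_d[of u v] by (auto simp: wlk_0)

lemma d_sym: "u \<in> V \<Longrightarrow> v \<in> V \<Longrightarrow> d u v = d v u"
  using d_le[OF wlk_sym[OF wlk_d[of u v]]] d_le[OF wlk_sym[OF wlk_d[of v u]]] by simp

lemma d_tri: "u \<in> V \<Longrightarrow> v \<in> V \<Longrightarrow> w \<in> V \<Longrightarrow> d u w \<le> d u v + d v w"
  by (rule d_le, rule wlk_trans[OF wlk_d wlk_d])

lemma d_edge: "{u, v} \<in> E \<Longrightarrow> d u v = 1"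
  using d_le[OF wlk_1] d_0[of u v] edge_verts[of u v] by fastforce

definition interval :: "'v \<Rightarrow> 'v \<Rightarrow> 'v set" where
  "interval u v = {x \<in> V. d u x + d x v = d u v}"

text \<open>Geodesics as functions \<open>nat \<Rightarrow> 'v\<close>, of which only the values up to \<open>k\<close> matter.\<close>
definition geo :: "(nat \<Rightarrow> 'v) \<Rightarrow> nat \<Rightarrow> 'v \<Rightarrow> 'v \<Rightarrow> bool" where
  "geo s k a b \<longleftrightarrow> a \<in> V \<and> b \<in> V \<and> s 0 = a \<and> s k = b \<and> k = d a b \<and>
     (\<forall>i<k. {s i, s (Suc i)} \<in> E)"

lemma wlk_fun: "wlk n u v \<Longrightarrow> \<exists>s. s 0 = u \<and> s n = v \<and> (\<forall>i<n. {s i, s (Suc i)} \<in> E)"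
proof (induction n arbitrary: u)
  case (Suc n)
  then obtain w where w: "{u, w} \<in> E" "wlk n w v" by (auto simp: wlk_Suc)
  obtain s where s: "s 0 = w" "s n = v" "\<forall>i<n. {s i, s (Suc i)} \<in> E" using Suc.IH[OF w(2)] by blast
  show ?case
  proof (intro exI[of _ "case_nat u s"] conjI allI impI)
    fix i assume "i < Suc n"
    then show "{case_nat u s i, case_nat u s (Suc i)} \<in> E" using s w by (cases i) auto
  qed (use s in auto)
qed (auto simp: wlk_0)

lemma ex_geo: "u \<in> V \<Longrightarrow> v \<in> V \<Longrightarrow> \<exists>s. geo s (d u v) u v"
  using wlk_fun[OF wlk_d[of u v]] unfolding geo_def by blast

lemma geo_wlk:
  assumes "geo s k a b" "i \<le> j" "j \<le> k" shows "wlk (j - i) (s i) (s j)"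
proof -
  have V: "s l \<in> V" if "l \<le> k" for l
  proof (cases l)
    case (Suc n)
    then have "{s n, s l} \<in> E" using assms that unfolding geo_def by auto
    then show ?thesis by (rule edge_verts)
  qed (use assms in \<open>auto simp: geo_def\<close>)
  show ?thesis using assms(2,3)
  proof (induction j rule: dec_induct)
    case base then show ?case using V by (simp add: wlk_0)
  next
    case (step n)
    then have "{s n, s (Suc n)} \<in> E" using assms(1) unfolding geo_def by auto
    then have "wlk (n - i + 1) (s i) (s (Suc n))" using step by (intro wlk_trans[OF _ wlk_1]) auto
    then show ?case using step by (simp add: Suc_diff_le)
  qed
qed

lemma geo_V: "geo s k a b \<Longrightarrow> i \<le> k \<Longrightarrow> s i \<in> V"
  using geo_wlk[of s k a b i i] by (auto simp: wlk_0)

lemma geo_d: assumes g: "geo s k a b" and ij: "i \<le> j" "j \<le> k" shows "d (s i) (s j) = j - i"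
proof -
  have V: "s 0 \<in> V" "s i \<in> V" "s j \<in> V" "s k \<in> V" using geo_V[OF g] ij by auto
  have "d (s 0) (s i) \<le> i" "d (s i) (s j) \<le> j - i" "d (s j) (s k) \<le> k - j"
    using d_le[OF geo_wlk[OF g, of 0 i]] d_le[OF geo_wlk[OF g, of i j]] d_le[OF geo_wlk[OF g, of j k]] ij
    by auto
  moreover have "k = d (s 0) (s k)" using g unfolding geo_def by auto
  moreover have "d (s 0) (s k) \<le> d (s 0) (s i) + d (s i) (s k)" "d (s i) (s k) \<le> d (s i) (s j) + d (s j) (s k)"
    using d_tri V by blast+
  ultimately show ?thesis using ij by linarith
qed

lemma geo_d': "geo s k a b \<Longrightarrow> i \<le> k \<Longrightarrow> j \<le> k \<Longrightarrow> d (s i) (s j) = (if i \<le> j then j - i else i - j)"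
  using geo_d[of s k a b i j] geo_d[of s k a b j i] d_sym[of "s i" "s j"] geo_V[of s k a b] by auto

lemma geo_0: "geo s k a b \<Longrightarrow> s 0 = a" and geo_k: "geo s k a b \<Longrightarrow> s k = b"
  and geo_len: "geo s k a b \<Longrightarrow> k = d a b" and geo_E: "geo s k a b \<Longrightarrow> i < k \<Longrightarrow> {s i, s (Suc i)} \<in> E"
  and geo_ab: "geo s k a b \<Longrightarrow> a \<in> V" "geo s k a b \<Longrightarrow> b \<in> V"
  unfolding geo_def by auto

lemma geo_da: "geo s k a b \<Longrightarrow> i \<le> k \<Longrightarrow> d a (s i) = i"
  using geo_d[of s k a b 0 i] geo_0[of s k a b] by simp

lemma geo_db: "geo s k a b \<Longrightarrow> i \<le> k \<Longrightarrow> d (s i) b = k - i"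
  using geo_d[of s k a b i k] geo_k[of s k a b] by simp

lemma geo_interval: "geo s k a b \<Longrightarrow> i \<le> k \<Longrightarrow> s i \<in> interval a b"
  using geo_da[of s k a b i] geo_db[of s k a b i] geo_len[of s k a b] geo_V[of s k a b i]
  unfolding interval_def by auto

lemma geo_rev: assumes "geo s k a b" shows "geo (\<lambda>i. s (k - i)) k b a"
  unfolding geo_def
proof (intro conjI allI impI)
  fix i assume i: "i < k"
  then have "{s (k - Suc i), s (Suc (k - Suc i))} \<in> E" using geo_E[OF assms, of "k - Suc i"] by auto
  moreover have "Suc (k - Suc i) = k - i" using i by auto
  ultimately show "{s (k - i), s (k - Suc i)} \<in> E" by (simp add: insert_commute)
qed (use assms d_sym in \<open>auto simp: geo_def\<close>)

lemma interval_iff: "u \<in> V \<Longrightarrow> v \<in> V \<Longrightarrow> x \<in> interval u v \<longleftrightarrow> x \<in> V \<and> d u x + d x v = d u v"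
  by (auto simp: interval_def)

lemma interval_comm: "u \<in> V \<Longrightarrow> v \<in> V \<Longrightarrow> interval u v = interval v u"
  using d_sym unfolding interval_def by (metis (lifting) add.commute)

lemma geo_through:
  assumes "geo s k a x" "geo t l x b" "x \<in> interval a b"
  shows "geo (\<lambda>i. if i \<le> k then s i else t (i - k)) (k + l) a b"
  unfolding geo_def
proof (intro conjI allI impI)
  fix i assume i: "i < k + l"
  show "{if i \<le> k then s i else t (i - k), if Suc i \<le> k then s (Suc i) else t (Suc i - k)} \<in> E"
  proof (cases "i < k")
    case True then show ?thesis using geo_E[OF assms(1)] by auto
  next
    case False
    then have "{t (i - k), t (Suc (i - k))} \<in> E" using i geo_E[OF assms(2)] by auto
    moreover have "i = k \<Longrightarrow> s i = t 0" using assms geo_k geo_0 by metis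
    ultimately show ?thesis using False by (auto simp: Suc_diff_le)
  qed
next
  show "(if k + l \<le> k then s (k + l) else t (k + l - k)) = b"
    using assms(1,2) by (auto simp: geo_def)
qed (use assms in \<open>auto simp: geo_def interval_def\<close>)

lemma ex_geo_through:
  assumes "u \<in> V" "v \<in> V" "x \<in> interval u v"
  shows "\<exists>s. geo s (d u v) u v \<and> s (d u x) = x"
proof -
  have x: "x \<in> V" using assms by (auto simp: interval_def)
  obtain s t where status: "geo s (d u x) u x" "geo t (d x v) x v" using ex_geo assms(1,2) x by meson
  show ?thesis using geo_through[OF status assms(3)] geo_k[OF status(1)] assms(3)
    by (intro exI[of _ "\<lambda>i. if i \<le> d u x then s i else t (i - d u x)"]) (auto simp: interval_def)
qed

lemma interval_trans:
  assumes "u \<in> V" "v \<in> V" "x \<in> interval u v" "y \<in> interval u x"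
  shows "y \<in> interval u v" "x \<in> interval y v"
proof -
  have V: "x \<in> V" "y \<in> V" using assms by (auto simp: interval_def)
  show "y \<in> interval u v" "x \<in> interval y v"
    using assms d_tri[of u y v] d_tri[of y x v] V by (auto simp: interval_def)
qed

lemma interval_trans':
  assumes "u \<in> V" "v \<in> V" "x \<in> interval u v" "y \<in> interval x v"
  shows "y \<in> interval u v" "x \<in> interval u y"
proof -
  have V: "x \<in> V" "y \<in> V" using assms by (auto simp: interval_def)
  show "y \<in> interval u v" "x \<in> interval u y"
    using assms d_tri[of u y v] d_tri[of u x y] V by (auto simp: interval_def)
qed

lemma interval_step:
  assumes "u \<in> V" "v \<in> V" "x \<in> interval u v" "x \<noteq> v"
  obtains w where "{x, w} \<in> E" "w \<in> interval u v" "d u w = Suc (d u x)" "w \<in> interval x v" "d x v = Suc (d w v)"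
proof -
  obtain s where s: "geo s (d u v) u v" "s (d u x) = x" using ex_geo_through assms(1-3) by blast
  have "d x v \<noteq> 0" using d_0 assms by (auto simp: interval_def)
  then have lt: "d u x < d u v" using assms(3) by (auto simp: interval_def)
  let ?w = "s (Suc (d u x))"
  have "{x, ?w} \<in> E" using geo_E[OF s(1) lt] s by simp
  moreover have "?w \<in> interval u v" using geo_interval[OF s(1)] lt by simp
  moreover have "d u ?w = Suc (d u x)" using geo_da[OF s(1)] lt by simp
  moreover have "d ?w v = d u v - Suc (d u x)" using geo_db[OF s(1)] lt by simp
  ultimately show ?thesis using assms lt by (intro that[of ?w]) (auto simp: interval_def d_edge)
qed

lemma edge_card: "e \<in> E \<Longrightarrow> finite e \<and> card e = 2"
  using edge_ends by fastforce

section \<open>Connections inside edge sets and simple loops\<close>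

text \<open>Connections are kept as edge sets rather than paths: concatenation is union, and only
  the cardinality and the avoided vertices have to be tracked. A simple path is extracted at the end
  by \<open>crel_path\<close>.\<close>

definition crel :: "'v set set \<Rightarrow> 'v rel" where
  "crel F = {(a, b). {a, b} \<in> F}\<^sup>*"

lemma crel_refl [simp]: "(u, u) \<in> crel F"
  by (simp add: crel_def)

lemma crel_edge: "{u, v} \<in> F \<Longrightarrow> (u, v) \<in> crel F"
  by (auto simp: crel_def)

lemma crel_trans: "(u, v) \<in> crel F \<Longrightarrow> (v, w) \<in> crel F \<Longrightarrow> (u, w) \<in> crel F"
  by (auto simp: crel_def)

lemma crel_sym: assumes "(u, v) \<in> crel F" shows "(v, u) \<in> crel F"
proof -
  have "sym {(a, b). {a, b} \<in> F}" by (auto simp: sym_def insert_commute)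
  then show ?thesis using assms unfolding crel_def by (meson sym_rtrancl symD)
qed

lemma crel_mono: "F \<subseteq> F' \<Longrightarrow> (u, v) \<in> crel F \<Longrightarrow> (u, v) \<in> crel F'"
  unfolding crel_def using rtrancl_mono[of "{(a, b). {a, b} \<in> F}" "{(a, b). {a, b} \<in> F'}"] by auto

lemma crel_trans2: "(u, v) \<in> crel F \<Longrightarrow> (v, w) \<in> crel F' \<Longrightarrow> (u, w) \<in> crel (F \<union> F')"
  using crel_mono[of F "F \<union> F'" u v] crel_mono[of F' "F \<union> F'" v w] crel_trans by blast

definition pedges :: "'v list \<Rightarrow> 'v set set" where
  "pedges p = {{p ! i, p ! Suc i} | i. Suc i < length p}"

lemma pedges_take: "pedges (take n p) \<subseteq> pedges p"
  by (force simp: pedges_def)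

lemma pedges_snoc: "p \<noteq> [] \<Longrightarrow> pedges (p @ [x]) = insert {last p, x} (pedges p)"
proof -
  assume ne: "p \<noteq> []"
  have "pedges (p @ [x]) = {{(p @ [x]) ! i, (p @ [x]) ! Suc i} | i. i < length p - 1 \<or> i = length p - 1}"
    using ne unfolding pedges_def by (intro Collect_cong ex_cong1) auto
  also have "\<dots> = insert {(p @ [x]) ! (length p - 1), (p @ [x]) ! Suc (length p - 1)}
     {{(p @ [x]) ! i, (p @ [x]) ! Suc i} | i. i < length p - 1}" by blast
  also have "{{(p @ [x]) ! i, (p @ [x]) ! Suc i} | i. i < length p - 1} = pedges p"
    unfolding pedges_def by (intro Collect_cong ex_cong1) (auto simp: nth_append)
  also have "(p @ [x]) ! (length p - 1) = last p" using ne by (simp add: nth_append last_conv_nth)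
  also have "(p @ [x]) ! Suc (length p - 1) = x" using ne by simp
  finally show ?thesis .
qed

text \<open>When the next vertex already lies on the path, the path is cut back to it; this keeps it
  simple.\<close>

lemma crel_path:
  assumes "(u, v) \<in> crel F"
  shows "\<exists>p. p \<noteq> [] \<and> distinct p \<and> hd p = u \<and> last p = v \<and> pedges p \<subseteq> F"
  using assms unfolding crel_def
proof (induction rule: rtrancl_induct)
  case base
  show ?case by (intro exI[of _ "[u]"]) (auto simp: pedges_def)
next
  case (step y z)
  then obtain p where p: "p \<noteq> []" "distinct p" "hd p = u" "last p = y" "pedges p \<subseteq> F" by blast
  show ?case
  proof (cases "z \<in> set p")
    case True
    then obtain i where i: "i < length p" "p ! i = z" by (auto simp: in_set_conv_nth)
    let ?q = "take (Suc i) p"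
    have "last ?q = z" using i by (simp add: take_Suc_conv_app_nth)
    then show ?thesis using p i pedges_take[of "Suc i" p] by (intro exI[of _ ?q]) auto
  next
    case False
    then show ?thesis using p step(2) by (intro exI[of _ "p @ [z]"]) (auto simp: pedges_snoc)
  qed
qed

lemma path_stays:
  assumes "p \<noteq> []" "hd p \<in> A" "\<And>e. e \<in> pedges p \<Longrightarrow> e \<subseteq> A \<or> e \<inter> A = {}"
  shows "set p \<subseteq> A"
proof -
  have "i < length p \<Longrightarrow> p ! i \<in> A" for i
  proof (induction i)
    case 0 then show ?case using assms by (simp add: hd_conv_nth)
  next
    case (Suc i)
    then have "{p ! i, p ! Suc i} \<in> pedges p" by (auto simp: pedges_def)
    then show ?case using assms(3) Suc by fastforce
  qed
  then show ?thesis by (auto simp: in_set_conv_nth)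
qed

lemma card_pedges:
  assumes "distinct p" shows "card (pedges p) = length p - 1" "finite (pedges p)"
proof -
  have eq: "pedges p = (\<lambda>i. {p ! i, p ! Suc i}) ` {..<length p - 1}" by (force simp: pedges_def)
  have "inj_on (\<lambda>i. {p ! i, p ! Suc i}) {..<length p - 1}"
  proof (rule inj_onI)
    fix i j assume ij: "i \<in> {..<length p - 1}" "j \<in> {..<length p - 1}"
      "{p ! i, p ! Suc i} = {p ! j, p ! Suc j}"
    then have "p ! i = p ! j \<or> (p ! i = p ! Suc j \<and> p ! Suc i = p ! j)" by (auto simp: doubleton_eq_iff)
    then have "i = j \<or> (i = Suc j \<and> Suc i = j)"
      using ij nth_eq_iff_index_eq[OF assms] by auto
    then show "i = j" by auto
  qed
  then show "card (pedges p) = length p - 1" unfolding eq by (subst card_image) auto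
  show "finite (pedges p)" unfolding eq by simp
qed

lemma loopI:
  assumes "distinct p" "3 \<le> length p" "pedges p \<subseteq> E" "{last p, hd p} \<in> E"
  shows "insert {last p, hd p} (pedges p) \<in> simple_loops V E"
proof -
  have "set p \<subseteq> V"
  proof
    fix x assume "x \<in> set p"
    then obtain i where i: "i < length p" "p ! i = x" by (auto simp: in_set_conv_nth)
    show "x \<in> V"
    proof (cases "Suc i < length p")
      case True
      then have "{p ! i, p ! Suc i} \<in> E" using assms(3) by (auto simp: pedges_def)
      then show ?thesis using edge_verts i by blast
    next
      case False
      then have "x = last p" using i by (metis Suc_lessI diff_Suc_1 last_conv_nth length_0_conv less_zeroE)
      then show ?thesis using edge_verts assms(4) by blast
    qed
  qed
  moreover have "p \<noteq> []" using assms(2) by auto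
  moreover have "\<forall>i. Suc i < length p \<longrightarrow> {p ! i, p ! Suc i} \<in> E" using assms(3) by (auto simp: pedges_def)
  ultimately have "walk V E p" using assms unfolding walk_def by auto
  then show ?thesis using assms unfolding simple_loops_def pedges_def by blast
qed

text \<open>The angle relation: for adjacent edges it says that their angle is at most about \<open>L\<close>.\<close>
definition near :: "nat \<Rightarrow> 'v set \<Rightarrow> 'v set \<Rightarrow> bool" where
  "near L e f \<longleftrightarrow> e \<in> E \<and> f \<in> E \<and> (e = f \<or> (\<exists>C\<in>simple_loops V E. e \<in> C \<and> f \<in> C \<and> card C \<le> L))"

lemma near_sym: "near L e f \<Longrightarrow> near L f e"
  by (auto simp: near_def)

lemma near_refl: "e \<in> E \<Longrightarrow> near L e e"
  by (auto simp: near_def)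

lemma loop_edges: "C \<in> simple_loops V E \<Longrightarrow> C \<subseteq> E \<and> finite C"
proof -
  assume "C \<in> simple_loops V E"
  then obtain p where p: "walk V E p" "distinct p" "3 \<le> length p" "{last p, hd p} \<in> E"
    "C = insert {last p, hd p} (pedges p)" by (auto simp: simple_loops_def pedges_def)
  show ?thesis using p card_pedges(2)[OF p(2)] by (auto simp: walk_def pedges_def)
qed

lemma near_dist:
  assumes "near L e f" "u \<in> e" "v \<in> f" shows "d u v \<le> L + 1"
proof (cases "e = f")
  case True
  then obtain a b where ab: "e = {a, b}" "{a, b} \<in> E" using edge_ends assms by (metis near_def)
  have "{b, a} \<in> E" using ab by (simp add: insert_commute)
  then show ?thesis using assms True ab d_edge d_refl edge_verts[OF ab(2)] by fastforce
next
  case False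
  then obtain C where C: "C \<in> simple_loops V E" "e \<in> C" "f \<in> C" "card C \<le> L"
    using assms by (auto simp: near_def)
  then obtain p where p: "walk V E p" "distinct p" "3 \<le> length p" "{last p, hd p} \<in> E"
    "C = insert {last p, hd p} (pedges p)" by (auto simp: simple_loops_def pedges_def)
  have "length p - 1 \<le> card C" unfolding p(5) card_pedges(1)[OF p(2), symmetric]
    using card_pedges(2)[OF p(2)] by (intro card_mono) auto
  then have len: "length p \<le> L + 1" using C by linarith
  have pV: "set p \<subseteq> V" using p by (auto simp: walk_def)
  have in_p: "x \<in> set p" if "g \<in> C" "x \<in> g" for g x
    using that p walk_def[of V E p] by (auto simp: pedges_def)
  have step: "d (p ! i) (p ! j) \<le> j - i" if "i \<le> j" "j < length p" for i j
    using that
  proof (induction j rule: dec_induct)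
    case base then show ?case using pV d_refl nth_mem by fastforce
  next
    case (step n)
    have "{p ! n, p ! Suc n} \<in> E" using p step by (auto simp: walk_def)
    then have "d (p ! n) (p ! Suc n) = 1" by (rule d_edge)
    moreover have "d (p ! i) (p ! Suc n) \<le> d (p ! i) (p ! n) + d (p ! n) (p ! Suc n)"
      using pV step by (intro d_tri) (auto intro!: subsetD[OF pV] nth_mem)
    ultimately show ?case using step by linarith
  qed
  obtain i j where ij: "i < length p" "u = p ! i" "j < length p" "v = p ! j"
    using in_p[OF C(2) assms(2)] in_p[OF C(3) assms(3)] by (metis in_set_conv_nth)
  have "u \<in> V" "v \<in> V" using ij pV by auto
  then show ?thesis using step[of i j] step[of j i] ij len d_sym[of u v] by (cases "i \<le> j") auto
qed

text \<open>The clause on \<open>\<Union>F\<close> serves to show that a connection misses a vertex: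
  it suffices that the vertex is off the interval.\<close>

lemma connect:
  assumes "u \<in> V" "v \<in> V"
  obtains F where "F \<subseteq> E" "finite F" "card F \<le> d u v" "(u, v) \<in> crel F" "\<Union>F \<subseteq> interval u v"
proof -
  obtain s where s: "geo s (d u v) u v" using ex_geo assms by blast
  let ?F = "(\<lambda>i. {s i, s (Suc i)}) ` {..<d u v}"
  have "i \<le> d u v \<Longrightarrow> (s 0, s i) \<in> crel ?F" for i
  proof (induction i)
    case (Suc i)
    then show ?case using crel_edge[of "s i" "s (Suc i)" ?F] crel_trans[of "s 0" "s i" ?F] by auto
  qed simp
  from this[of "d u v"] have "(u, v) \<in> crel ?F" unfolding geo_0[OF s] geo_k[OF s] by simp
  moreover have "card ?F \<le> d u v" using card_image_le[of "{..<d u v}"] by simp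
  moreover have "\<Union>?F \<subseteq> interval u v" using geo_interval[OF s] by auto
  ultimately show ?thesis using geo_E[OF s] by (intro that[of ?F]) auto
qed

lemma geo_connect:
  assumes "geo s k a b" "i \<le> k" "j \<le> k"
  obtains F where "F \<subseteq> E" "finite F" "card F \<le> d (s i) (s j)" "(s i, s j) \<in> crel F"
    "F \<subseteq> {{s l, s (Suc l)} | l. min i j \<le> l \<and> l < max i j}"
proof -
  define m M where "m = min i j" and "M = max i j"
  let ?F = "(\<lambda>l. {s l, s (Suc l)}) ` {m..<M}"
  have "m \<le> l \<Longrightarrow> l \<le> M \<Longrightarrow> (s m, s l) \<in> crel ?F" for l
  proof (induction l rule: dec_induct)
    case (step l)
    then show ?case using crel_edge[of "s l" "s (Suc l)" ?F] crel_trans[of "s m" "s l" ?F] by auto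
  qed simp
  then have c: "(s m, s M) \<in> crel ?F" by (simp add: m_def M_def)
  then have "(s i, s j) \<in> crel ?F"
    using crel_sym[OF c] unfolding m_def M_def by (cases "i \<le> j") auto
  moreover have "card ?F \<le> M - m" using card_image_le[of "{m..<M}"] by simp
  moreover have "M - m = d (s i) (s j)" using geo_d'[OF assms] by (auto simp: m_def M_def)
  moreover have "?F \<subseteq> E" using geo_E[OF assms(1)] assms by (auto simp: m_def M_def)
  ultimately show ?thesis by (intro that[of ?F]) (auto simp: m_def M_def)
qed

text \<open>A simple path from \<open>a\<close> to \<open>b\<close> inside \<open>F\<close> misses
  \<open>z\<close>, so it closes up through \<open>z\<close> to a simple loop with at most
  \<open>card F + 2\<close> edges, two of which are the given ones.\<close>

lemma near_at:
  assumes "{z, a} \<in> E" "{z, b} \<in> E" "(a, b) \<in> crel F" "F \<subseteq> E" "finite F" "z \<notin> \<Union>F" "card F + 2 \<le> L"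
  shows "near L {z, a} {z, b}"
proof (cases "a = b")
  case False
  obtain p where p: "p \<noteq> []" "distinct p" "hd p = a" "last p = b" "pedges p \<subseteq> F"
    using crel_path[OF assms(3)] by blast
  have len: "2 \<le> length p" using p False by (cases p; cases "tl p") auto
  have zp: "z \<notin> set p"
  proof
    assume "z \<in> set p"
    then obtain i where i: "i < length p" "p ! i = z" by (auto simp: in_set_conv_nth)
    have "\<exists>e\<in>pedges p. z \<in> e"
    proof (cases "Suc i < length p")
      case True then show ?thesis using i by (auto simp: pedges_def)
    next
      case False
      then have "i = Suc (i - 1)" "Suc (i - 1) < length p" using i len by auto
      then have "{p ! (i - 1), p ! i} \<in> pedges p" unfolding pedges_def by auto
      then show ?thesis using i by auto
    qed
    then show False using p(5) assms(6) by auto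
  qed
  have pe: "pedges (z # p) = insert {z, a} (pedges p)"
  proof -
    have "Suc i < length (z # p) \<longleftrightarrow> i = 0 \<or> (\<exists>j. i = Suc j \<and> Suc j < length p)" for i
      using p(1) by (cases i) auto
    then have "pedges (z # p) = {{(z # p) ! i, (z # p) ! Suc i} | i. i = 0 \<or> (\<exists>j. i = Suc j \<and> Suc j < length p)}"
      unfolding pedges_def by presburger
    also have "\<dots> = insert {(z # p) ! 0, (z # p) ! Suc 0}
        {{(z # p) ! Suc j, (z # p) ! Suc (Suc j)} | j. Suc j < length p}" by blast
    finally show ?thesis using p by (simp add: pedges_def hd_conv_nth)
  qed
  have "insert {last (z # p), hd (z # p)} (pedges (z # p)) \<in> simple_loops V E"
  proof (rule loopI)
    show "pedges (z # p) \<subseteq> E" using pe assms p by auto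
    show "{last (z # p), hd (z # p)} \<in> E" using p assms by (simp add: insert_commute)
  qed (use p zp len in auto)
  moreover have "insert {last (z # p), hd (z # p)} (pedges (z # p)) = insert {z, b} (insert {z, a} (pedges p))"
    using pe p by (simp add: insert_commute)
  moreover have "card (insert {z, b} (insert {z, a} (pedges p))) \<le> L"
  proof -
    have "card (pedges p) \<le> card F" by (rule card_mono[OF assms(5) p(5)])
    moreover have "finite (pedges p)" by (rule card_pedges(2)[OF p(2)])
    then have "card (insert {z, b} (insert {z, a} (pedges p))) \<le> card (pedges p) + 2"
      by (auto simp: card_insert_if)
    ultimately show ?thesis using assms(7) by linarith
  qed
  ultimately show ?thesis using assms unfolding near_def by (metis insertCI)
qed (use assms near_refl in auto)

text \<open>The lower set \<open>F1\<close> and the upper set \<open>F2\<close> are disjoint, so a simple path from \<open>u\<close> to \<open>v\<close>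
  has to use an edge of \<open>F\<close>; it closes up with \<open>{u, v}\<close>.\<close>
lemma near_cross:
  assumes uv: "{u, v} \<in> E" and c: "(u, v) \<in> crel (F1 \<union> F \<union> F2)"
    and sub: "F1 \<subseteq> E" "F \<subseteq> E" "F2 \<subseteq> E" and fin: "finite F1" "finite F" "finite F2"
    and A: "u \<in> A" "v \<notin> A" "\<Union>F1 \<subseteq> A" "\<Union>F2 \<inter> A = {}"
    and card: "card F1 + card F + card F2 + 1 \<le> L"
  shows "\<exists>f\<in>F. near L {u, v} f"
proof (cases "{u, v} \<in> F")
  case True then show ?thesis using near_refl[OF uv] by blast
next
  case False
  let ?G = "F1 \<union> F \<union> F2"
  have notG: "{u, v} \<notin> ?G" using False A by auto
  obtain p where p: "p \<noteq> []" "distinct p" "hd p = u" "last p = v" "pedges p \<subseteq> ?G"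
    using crel_path[OF c] by blast
  have uv': "u \<noteq> v" using edge_verts[OF uv] by auto
  have len: "3 \<le> length p"
  proof (rule ccontr)
    assume "\<not> 3 \<le> length p"
    moreover have "length p \<noteq> 0" using p(1) by simp
    ultimately have "length p = 1 \<or> length p = 2" by linarith
    then show False
    proof
      assume "length p = 1"
      then obtain x where "p = [x]" by (auto simp: length_Suc_conv)
      then show False using p uv' by auto
    next
      assume "length p = 2"
      then have "p = [u, v]" using p by (cases p; cases "tl p") auto
      then have "{u, v} \<in> pedges p" unfolding pedges_def by auto
      then show False using p notG by auto
    qed
  qed
  obtain f where f: "f \<in> pedges p" "f \<in> F"
  proof (rule ccontr)
    assume "\<not> thesis"
    then have "pedges p \<inter> F = {}" using that by auto
    have "e \<subseteq> A \<or> e \<inter> A = {}" if "e \<in> pedges p" for e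
    proof -
      have "e \<in> F1 \<or> e \<in> F2" using that p(5) \<open>pedges p \<inter> F = {}\<close> by blast
      then show ?thesis using A by blast
    qed
    then have "set p \<subseteq> A" using p A by (intro path_stays) auto
    then show False using p A by (metis last_in_set subsetD)
  qed
  have vu: "{last p, hd p} = {u, v}" using p by auto
  have "insert {last p, hd p} (pedges p) \<in> simple_loops V E"
    using p sub len uv vu by (intro loopI) auto
  moreover have "card (insert {last p, hd p} (pedges p)) \<le> L"
  proof -
    have "card (pedges p) \<le> card ?G" using fin by (intro card_mono[OF _ p(5)]) auto
    also have "\<dots> \<le> card F1 + card F + card F2"
      by (meson card_Un_le add_le_mono1 le_trans)
    finally have "card (pedges p) \<le> card F1 + card F + card F2" .
    moreover have "card (insert {last p, hd p} (pedges p)) \<le> card (pedges p) + 1"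
      using card_pedges(2)[OF p(2)] by (auto simp: card_insert_if)
    ultimately show ?thesis using card by linarith
  qed
  ultimately show ?thesis using f vu uv sub unfolding near_def
    by (intro bexI[of _ f]) auto
qed

end

section \<open>Small angles in fine hyperbolic graphs\<close>

locale fine_graph = conn_graph V E for V :: "'v set" and E :: "'v set set" +
  assumes fine: "uniformly_fine V E"
begin

text \<open>At most \<open>f L\<close> loops contain the edge, each with at most \<open>L\<close>
  edges; the summand 1 is the edge itself, which \<open>near\<close> admits without a loop.\<close>

lemma near_finite:
  obtains K :: nat where "K \<ge> 1" "\<And>e. finite {f. near L e f}" "\<And>e. card {f. near L e f} \<le> K"
proof -
  obtain f where f: "\<And>e L. e \<in> E \<Longrightarrow> finite {C \<in> simple_loops V E. e \<in> C \<and> card C \<le> L} \<and>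
      card {C \<in> simple_loops V E. e \<in> C \<and> card C \<le> L} \<le> f L"
    using fine unfolding uniformly_fine_def by blast
  have *: "finite {g. near L e g} \<and> card {g. near L e g} \<le> 1 + f L * L" for e
  proof (cases "e \<in> E")
    case True
    define S where "S = {C \<in> simple_loops V E. e \<in> C \<and> card C \<le> L}"
    have sub: "{g. near L e g} \<subseteq> insert e (\<Union>S)" by (auto simp: near_def S_def)
    have fin: "finite S" "card S \<le> f L" using f[OF True, of L] unfolding S_def by blast+
    have finC: "finite C" "card C \<le> L" if "C \<in> S" for C
      using that loop_edges[of C] unfolding S_def by blast+
    have "card (\<Union>S) \<le> sum card S" by (rule card_Union_le_sum_card)
    also have "\<dots> \<le> of_nat (card S) * L" by (rule sum_bounded_above) (rule finC(2))
    also have "\<dots> \<le> f L * L" using fin by simp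
    finally have "card (\<Union>S) \<le> f L * L" .
    moreover have "finite (\<Union>S)" using fin finC by (intro finite_Union)
    ultimately have "card (insert e (\<Union>S)) \<le> 1 + f L * L" "finite (insert e (\<Union>S))"
      by (auto simp: card_insert_if)
    then show ?thesis using card_mono[OF _ sub] finite_subset[OF sub] le_trans by blast
  qed (auto simp: near_def)
  show ?thesis by (rule that[of "1 + f L * L"]) (use * in auto)
qed

end

locale fine_hyp = fine_graph V E for V :: "'v set" and E :: "'v set set" +
  fixes \<delta> :: nat
  assumes thin: "geo s k a b \<Longrightarrow> geo t l b c \<Longrightarrow> geo r m a c \<Longrightarrow> i \<le> k \<Longrightarrow>
      (\<exists>j\<le>l. d (s i) (t j) \<le> \<delta>) \<or> (\<exists>j\<le>m. d (s i) (r j) \<le> \<delta>)"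
begin

text \<open>One bound for all loops formed below. The most demanding use is in
  \<open>window3\<close>, which needs \<open>84 * \<delta> + 10\<close>.\<close>

definition L0 :: nat where "L0 = 200 * \<delta> + 100"

abbreviation nr :: "'v set \<Rightarrow> 'v set \<Rightarrow> bool" where "nr \<equiv> near L0"

lemma thin_interval:
  assumes "a \<in> V" "b \<in> V" "c \<in> V" "x \<in> interval a b"
  shows "(\<exists>q\<in>interval b c. d x q \<le> \<delta>) \<or> (\<exists>q\<in>interval a c. d x q \<le> \<delta>)"
proof -
  obtain s where s: "geo s (d a b) a b" "s (d a x) = x" using ex_geo_through assms by blast
  obtain t where t: "geo t (d b c) b c" using ex_geo assms by blast
  obtain r where r: "geo r (d a c) a c" using ex_geo assms by blast
  have "d a x \<le> d a b" using assms by (auto simp: interval_def)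
  then show ?thesis using thin[OF s(1) t r, of "d a x"] s(2) geo_interval[OF t] geo_interval[OF r] by auto
qed

lemma avoid_connect:
  assumes "x \<in> V" "q \<in> V" "z \<in> V" "d x q \<le> n" "n < d z x"
  obtains F where "F \<subseteq> E" "finite F" "card F \<le> n" "(x, q) \<in> crel F" "z \<notin> \<Union>F"
proof -
  obtain F where F: "F \<subseteq> E" "finite F" "card F \<le> d x q" "(x, q) \<in> crel F" "\<Union>F \<subseteq> interval x q"
    using connect assms by blast
  have "z \<notin> interval x q" using assms d_sym[of x z] by (auto simp: interval_def)
  then show ?thesis using F assms by (intro that[of F]) auto
qed

text \<open>Follow a geodesic from \<open>z\<close> towards \<open>a\<close>. A point at distance
  \<open>t\<close> is within \<open>\<delta>\<close> of the side \<open>s\<close> or of the geodesic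
  towards \<open>b\<close>, and the short connection there cannot return to \<open>z\<close>. This
  joins \<open>za\<close> to \<open>s\<close>, or directly to \<open>zb\<close>.\<close>

lemma corner_half:
  assumes g: "geo s k a b" and z: "z \<notin> s ` {..k}" "z \<in> V"
    and a: "{z, za} \<in> E" "d z a = Suc (d za a)" and b: "{z, zb} \<in> E" "d z b = Suc (d zb b)"
  shows "(\<exists>j F. j \<le> k \<and> F \<subseteq> E \<and> finite F \<and> card F \<le> 3 * \<delta> + 2 \<and> (za, s j) \<in> crel F \<and> z \<notin> \<Union>F \<and> d z (s j) \<le> 3 * \<delta> + 2) \<or>
    (\<exists>F. F \<subseteq> E \<and> finite F \<and> card F \<le> 6 * \<delta> + 4 \<and> (za, zb) \<in> crel F \<and> z \<notin> \<Union>F)"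
proof -
  have V: "a \<in> V" "b \<in> V" "za \<in> V" "zb \<in> V" using geo_ab[OF g] edge_verts a b by auto
  have "za \<in> interval z a" "zb \<in> interval z b" using V z a b d_edge by (auto simp: interval_def)
  then obtain \<alpha> \<beta> where al: "geo \<alpha> (d z a) z a" "\<alpha> 1 = za" and be: "geo \<beta> (d z b) z b" "\<beta> 1 = zb"
    using ex_geo_through[of z a za] ex_geo_through[of z b zb] V z d_edge[OF a(1)] d_edge[OF b(1)] by auto
  have along: "\<exists>F. F \<subseteq> E \<and> finite F \<and> card F \<le> i - 1 \<and> (\<gamma> 1, \<gamma> i) \<in> crel F \<and> z \<notin> \<Union>F"
    if gam: "geo \<gamma> n z c" "1 \<le> i" "i \<le> n" for \<gamma> n c i
  proof -
    have le: "1 \<le> n" using gam by auto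
    obtain F where F: "F \<subseteq> E" "finite F" "card F \<le> d (\<gamma> 1) (\<gamma> i)" "(\<gamma> 1, \<gamma> i) \<in> crel F"
      "F \<subseteq> {{\<gamma> l, \<gamma> (Suc l)} | l. min 1 i \<le> l \<and> l < max 1 i}"
      using geo_connect[OF gam(1) le gam(3)] by blast
    have "\<gamma> l \<noteq> z" if "1 \<le> l" "l \<le> n" for l
      using geo_da[OF gam(1) that(2)] that z by (metis d_refl not_one_le_zero)
    have "z \<notin> \<Union>F"
    proof
      assume "z \<in> \<Union>F"
      then obtain l where "1 \<le> l" "l < i" "z = \<gamma> l \<or> z = \<gamma> (Suc l)" using F(5) gam by auto
      then show False using \<open>\<And>l. 1 \<le> l \<Longrightarrow> l \<le> n \<Longrightarrow> \<gamma> l \<noteq> z\<close>[of l] \<open>\<And>l. 1 \<le> l \<Longrightarrow> l \<le> n \<Longrightarrow> \<gamma> l \<noteq> z\<close>[of "Suc l"] gam by auto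
    qed
    moreover have "d (\<gamma> 1) (\<gamma> i) = i - 1" using geo_d[OF gam(1)] gam by auto
    ultimately show ?thesis using F by auto
  qed
  \<comment> \<open>More than \<open>\<delta>\<close>, so that a path of length
    \<open>\<delta>\<close> from distance \<open>t\<close> misses \<open>z\<close> and its end on
    the other geodesic is still beyond \<open>z\<close>.\<close>
  define t where "t = 2 * \<delta> + 2"
  show ?thesis
  proof (cases "d z a \<le> t")
    case True
    obtain F where "F \<subseteq> E" "finite F" "card F \<le> d z a - 1" "(\<alpha> 1, \<alpha> (d z a)) \<in> crel F" "z \<notin> \<Union>F"
      using along[OF al(1), of "d z a"] a by auto
    then show ?thesis using True geo_0[OF g] geo_k[OF al(1)] al(2) unfolding t_def
      by (intro disjI1 exI[of _ 0] exI[of _ F]) auto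
  next
    case False
    then have tle: "t \<le> d z a" by auto
    have xV: "\<alpha> t \<in> V" and dx: "d z (\<alpha> t) = t" using geo_V[OF al(1) tle] geo_da[OF al(1) tle] by auto
    obtain F where F: "F \<subseteq> E" "finite F" "card F \<le> t - 1" "(za, \<alpha> t) \<in> crel F" "z \<notin> \<Union>F"
      using along[OF al(1), of t] tle al(2) unfolding t_def by auto
    have "(\<exists>j\<le>k. d (\<alpha> t) (s j) \<le> \<delta>) \<or> (\<exists>j\<le>d z b. d (\<alpha> t) (\<beta> j) \<le> \<delta>)"
      using thin[OF al(1) g be(1) tle] .
    then show ?thesis
    proof (elim disjE exE conjE)
      fix j assume j: "j \<le> k" "d (\<alpha> t) (s j) \<le> \<delta>"
      have sV: "s j \<in> V" using geo_V[OF g] j by auto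
      have "\<delta> < d z (\<alpha> t)" using dx t_def by auto
      then obtain F' where F': "F' \<subseteq> E" "finite F'" "card F' \<le> \<delta>" "(\<alpha> t, s j) \<in> crel F'" "z \<notin> \<Union>F'"
        using avoid_connect[OF xV sV z(2) j(2)] by blast
      have "(za, s j) \<in> crel (F \<union> F')"
        using crel_trans2[OF F(4) F'(4)] .
      moreover have "card (F \<union> F') \<le> 3 * \<delta> + 2" using card_Un_le[of F F'] F F' unfolding t_def by linarith
      moreover have "d z (s j) \<le> 3 * \<delta> + 2" using d_tri[OF z(2) xV sV] j dx unfolding t_def by linarith
      ultimately show ?thesis using F F' j by (intro disjI1 exI[of _ j] exI[of _ "F \<union> F'"]) auto
    next
      fix j assume j: "j \<le> d z b" "d (\<alpha> t) (\<beta> j) \<le> \<delta>"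
      have bV: "\<beta> j \<in> V" using geo_V[OF be(1)] j by auto
      have dj: "d z (\<beta> j) = j" using geo_da[OF be(1) j(1)] .
      have "t \<le> j + \<delta>" "j \<le> t + \<delta>"
        using d_tri[OF z(2) bV xV] d_tri[OF z(2) xV bV] j dx dj d_sym[OF xV bV] by auto
      then have j1: "1 \<le> j" "j \<le> 3 * \<delta> + 2" unfolding t_def by auto
      have "\<delta> < d z (\<alpha> t)" using dx t_def by auto
      then obtain F' where F': "F' \<subseteq> E" "finite F'" "card F' \<le> \<delta>" "(\<alpha> t, \<beta> j) \<in> crel F'" "z \<notin> \<Union>F'"
        using avoid_connect[OF xV bV z(2) j(2)] by blast
      obtain F'' where F'': "F'' \<subseteq> E" "finite F''" "card F'' \<le> j - 1" "(zb, \<beta> j) \<in> crel F''" "z \<notin> \<Union>F''"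
        using along[OF be(1) j1(1) j(1)] be(2) by auto
      have "(za, \<beta> j) \<in> crel (F \<union> F')"
        using crel_trans2[OF F(4) F'(4)] .
      then have "(za, zb) \<in> crel (F \<union> F' \<union> F'')"
        using crel_trans2[OF _ crel_sym[OF F''(4)]] by blast
      moreover have "card (F \<union> F' \<union> F'') \<le> 6 * \<delta> + 4"
        using card_Un_le[of F F'] card_Un_le[of "F \<union> F'" F''] F F' F'' j1 unfolding t_def by linarith
      ultimately show ?thesis using F F' F'' by (intro disjI2 exI[of _ "F \<union> F' \<union> F''"]) auto
    qed
  qed
qed

text \<open>The two sides leaving \<open>z\<close> of a geodesic triangle make a small angle unless the third side
  passes through \<open>z\<close>.\<close>
lemma corner:
  assumes g: "geo s k a b" and z: "z \<notin> s ` {..k}" "z \<in> V"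
    and a: "{z, za} \<in> E" "d z a = Suc (d za a)" and b: "{z, zb} \<in> E" "d z b = Suc (d zb b)"
  shows "nr {z, za} {z, zb}"
proof -
  let ?s = "\<lambda>i. s (k - i)"
  have "?s ` {..k} \<subseteq> s ` {..k}" by auto
  then have z': "z \<notin> ?s ` {..k}" using z by blast
  note H1 = corner_half[OF g z a b] and H2 = corner_half[OF geo_rev[OF g] z' z(2) b a]
  have fin: "nr {z, za} {z, zb}" if F: "F \<subseteq> E" "finite F" "card F \<le> 12 * \<delta> + 8" "(za, zb) \<in> crel F" "z \<notin> \<Union>F" for F
    using near_at[OF a(1) b(1) F(4,1,2,5)] F(3) unfolding L0_def by auto
  from H1 show ?thesis
  proof
    assume "\<exists>F. F \<subseteq> E \<and> finite F \<and> card F \<le> 6 * \<delta> + 4 \<and> (za, zb) \<in> crel F \<and> z \<notin> \<Union>F"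
    then show ?thesis using fin by (elim exE conjE) (rule fin, auto)
  next
    assume "\<exists>j F. j \<le> k \<and> F \<subseteq> E \<and> finite F \<and> card F \<le> 3 * \<delta> + 2 \<and> (za, s j) \<in> crel F \<and> z \<notin> \<Union>F \<and> d z (s j) \<le> 3 * \<delta> + 2"
    then obtain j F where F: "j \<le> k" "F \<subseteq> E" "finite F" "card F \<le> 3 * \<delta> + 2" "(za, s j) \<in> crel F" "z \<notin> \<Union>F" "d z (s j) \<le> 3 * \<delta> + 2"
      by blast
    from H2 show ?thesis
    proof
      assume "\<exists>F. F \<subseteq> E \<and> finite F \<and> card F \<le> 6 * \<delta> + 4 \<and> (zb, za) \<in> crel F \<and> z \<notin> \<Union>F"
      then obtain F where "F \<subseteq> E" "finite F" "card F \<le> 6 * \<delta> + 4" "(zb, za) \<in> crel F" "z \<notin> \<Union>F" by blast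
      then show ?thesis using fin[of F] crel_sym by auto
    next
      assume "\<exists>j F. j \<le> k \<and> F \<subseteq> E \<and> finite F \<and> card F \<le> 3 * \<delta> + 2 \<and> (zb, s (k - j)) \<in> crel F \<and> z \<notin> \<Union>F \<and> d z (s (k - j)) \<le> 3 * \<delta> + 2"
      then obtain j' F' where F': "j' \<le> k" "F' \<subseteq> E" "finite F'" "card F' \<le> 3 * \<delta> + 2" "(zb, s j') \<in> crel F'"
        "z \<notin> \<Union>F'" "d z (s j') \<le> 3 * \<delta> + 2" by (metis diff_le_self)
      \<comment> \<open>Both halves end on \<open>s\<close> and are joined along it; this segment
        misses \<open>z\<close> by hypothesis and is short because both its ends are within
        \<open>3 * \<delta> + 2\<close> of \<open>z\<close>.\<close>
      obtain F'' where F'': "F'' \<subseteq> E" "finite F''" "card F'' \<le> d (s j) (s j')" "(s j, s j') \<in> crel F''"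
        "F'' \<subseteq> {{s l, s (Suc l)} | l. min j j' \<le> l \<and> l < max j j'}"
        using geo_connect[OF g F(1) F'(1)] by blast
      have "z \<notin> \<Union>F''"
      proof
        assume "z \<in> \<Union>F''"
        then obtain l where "l < max j j'" "z = s l \<or> z = s (Suc l)" using F''(5) by auto
        then show False using z(1) F(1) F'(1) by (auto simp: less_max_iff_disj)
      qed
      have sV: "s j \<in> V" "s j' \<in> V" using geo_V[OF g] F F' by auto
      have "d (s j) (s j') \<le> 6 * \<delta> + 4"
        using d_tri[OF sV(1) z(2) sV(2)] F F' d_sym[OF sV(1) z(2)] by linarith
      moreover have "(za, s j') \<in> crel (F \<union> F'')"
        using crel_trans2[OF F(5) F''(4)] .
      then have "(za, zb) \<in> crel (F \<union> F'' \<union> F')"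
        using crel_trans2[OF _ crel_sym[OF F'(5)]] by blast
      moreover have "card (F \<union> F'' \<union> F') \<le> card F + card F'' + card F'"
        using card_Un_le[of F F''] card_Un_le[of "F \<union> F''" F'] by linarith
      ultimately show ?thesis using F F' F'' \<open>z \<notin> \<Union>F''\<close> by (intro fin[of "F \<union> F'' \<union> F'"]) auto
    qed
  qed
qed

text \<open>Two geodesics that are \<open>C\<close>-close at two positions share an edge up to a
  small angle. The chosen edge is the one along which \<open>x\<close> leaves a ball around
  \<open>x j1\<close>; the detour through \<open>s\<close> must leave that ball too, and by
  \<open>near_cross\<close> it can do so only along \<open>s\<close>.\<close>

lemma window:
  assumes x: "geo x k a b" and s: "geo s m a' b'"
    and j: "j1 + 2 * C + 2 \<le> j2" "j2 \<le> k" "j2 \<le> j1 + J"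
    and i1: "i1 \<le> m" "d (x j1) (s i1) \<le> C" and i2: "i2 \<le> m" "d (x j2) (s i2) \<le> C"
    and L: "2 * J + 6 * C + 2 \<le> L0"
  shows "\<exists>i<m. nr {x (j1 + C + 1), x (j1 + C + 2)} {s i, s (Suc i)}"
proof -
  define u v where "u = x (j1 + C + 1)" and "v = x (j1 + C + 2)"
  have le: "j1 \<le> k" "j1 + C + 1 \<le> k" "j1 + C + 2 \<le> k" using j by auto
  have V: "x j1 \<in> V" "x j2 \<in> V" "u \<in> V" "v \<in> V" "s i1 \<in> V" "s i2 \<in> V"
    using geo_V[OF x] geo_V[OF s] le j i1 i2 by (auto simp: u_def v_def)
  have uv: "{u, v} \<in> E" using geo_E[OF x, of "j1 + C + 1"] le by (simp add: u_def v_def)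
  \<comment> \<open>The connection of length \<open>C\<close> at \<open>j1\<close> stays inside
    \<open>A\<close>. The one at \<open>j2\<close> stays outside because \<open>j2\<close> is at
    least \<open>2 * C + 2\<close> steps further.\<close>
  define A where "A = {y \<in> V. d (x j1) y \<le> C + 1}"
  obtain P1 where P1: "P1 \<subseteq> E" "finite P1" "card P1 \<le> d u (x j1)" "(u, x j1) \<in> crel P1"
    "P1 \<subseteq> {{x l, x (Suc l)} | l. min (j1 + C + 1) j1 \<le> l \<and> l < max (j1 + C + 1) j1}"
    unfolding u_def using geo_connect[OF x le(2) le(1)] by blast
  obtain P2 where P2: "P2 \<subseteq> E" "finite P2" "card P2 \<le> d (x j1) (s i1)" "(x j1, s i1) \<in> crel P2"
    "\<Union>P2 \<subseteq> interval (x j1) (s i1)" using connect V by blast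
  obtain F where F: "F \<subseteq> E" "finite F" "card F \<le> d (s i1) (s i2)" "(s i1, s i2) \<in> crel F"
    "F \<subseteq> {{s l, s (Suc l)} | l. min i1 i2 \<le> l \<and> l < max i1 i2}"
    using geo_connect[OF s i1(1) i2(1)] by blast
  obtain Q1 where Q1: "Q1 \<subseteq> E" "finite Q1" "card Q1 \<le> d (s i2) (x j2)" "(s i2, x j2) \<in> crel Q1"
    "\<Union>Q1 \<subseteq> interval (s i2) (x j2)" using connect V by blast
  obtain Q2 where Q2: "Q2 \<subseteq> E" "finite Q2" "card Q2 \<le> d (x j2) v" "(x j2, v) \<in> crel Q2"
    "Q2 \<subseteq> {{x l, x (Suc l)} | l. min j2 (j1 + C + 2) \<le> l \<and> l < max j2 (j1 + C + 2)}"
    unfolding v_def using geo_connect[OF x j(2) le(3)] by blast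
  have dd: "d (x j1) u = C + 1" "d (x j1) v = C + 2" "d (x j1) (x j2) = j2 - j1" "d v (x j2) = j2 - (j1 + C + 2)"
    unfolding u_def v_def using geo_d[OF x] le j by auto
  have "\<exists>f\<in>F. nr {u, v} f"
  proof (rule near_cross[OF uv, of "P1 \<union> P2" F "Q1 \<union> Q2" A])
    have "(u, s i1) \<in> crel (P1 \<union> P2)"
      using crel_trans2[OF P1(4) P2(4)] .
    then have 1: "(u, s i2) \<in> crel (P1 \<union> P2 \<union> F)"
      using crel_trans2[OF _ F(4)] by blast
    have "(s i2, v) \<in> crel (Q1 \<union> Q2)"
      using crel_trans2[OF Q1(4) Q2(4)] .
    then show "(u, v) \<in> crel (P1 \<union> P2 \<union> F \<union> (Q1 \<union> Q2))"
      using crel_trans2[OF 1] by blast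
    show "u \<in> A" "v \<notin> A" using dd V by (auto simp: A_def)
    have "x l \<in> A" if "j1 \<le> l" "l \<le> j1 + C + 1" for l
      using geo_d[OF x that(1)] that le geo_V[OF x] by (auto simp: A_def)
    then have "\<Union>P1 \<subseteq> A" using P1(5) by fastforce
    moreover have "\<Union>P2 \<subseteq> A" using P2(5) i1 by (auto simp: A_def interval_def)
    ultimately show "\<Union>(P1 \<union> P2) \<subseteq> A" by auto
    have "x l \<notin> A" if "j1 + C + 2 \<le> l" "l \<le> k" for l
      using geo_d[OF x _ that(2), of j1] that by (auto simp: A_def)
    then have 2: "\<Union>Q2 \<inter> A = {}" using Q2(5) j by fastforce
    have "y \<notin> A" if "y \<in> interval (s i2) (x j2)" for y
    proof -
      have y: "y \<in> V" "d y (x j2) \<le> C" using that i2 d_sym[of "s i2" "x j2"] V by (auto simp: interval_def)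
      then show ?thesis using d_tri[OF V(1) y(1) V(2)] dd j by (auto simp: A_def)
    qed
    then have "\<Union>Q1 \<inter> A = {}" using Q1(5) by blast
    then show "\<Union>(Q1 \<union> Q2) \<inter> A = {}" using 2 by auto
    have c1: "card (P1 \<union> P2) \<le> C + 1 + C"
      using card_Un_le[of P1 P2] P1(3) P2(3) dd i1 d_sym[OF V(3,1)] by linarith
    have c2: "card (Q1 \<union> Q2) \<le> C + J"
      using card_Un_le[of Q1 Q2] Q1(3) Q2(3) dd i2 d_sym[OF V(6,2)] d_sym[OF V(2,4)] j by linarith
    have "d (s i1) (s i2) \<le> C + J + C"
      using d_tri[OF V(5,1,6)] d_tri[OF V(1,2,6)] i1 i2 dd j d_sym[OF V(5,1)] by linarith
    then have c3: "card F \<le> C + J + C" using F(3) by linarith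
    show "card (P1 \<union> P2) + card F + card (Q1 \<union> Q2) + 1 \<le> L0" using c1 c2 c3 L by linarith
  qed (use P1 P2 F Q1 Q2 in auto)
  then obtain f where f: "f \<in> F" "nr {u, v} f" by blast
  then obtain l where "f = {s l, s (Suc l)}" "l < max i1 i2" using F(5) by blast
  then show ?thesis using f i1 i2 unfolding u_def v_def by (intro exI[of _ l]) auto
qed

end

lemma card_image_factor:
  assumes "finite T" "\<Phi> ` Y \<subseteq> T" "\<And>y y'. y \<in> Y \<Longrightarrow> y' \<in> Y \<Longrightarrow> \<Phi> y = \<Phi> y' \<Longrightarrow> h y = h y'"
  shows "finite (h ` Y) \<and> card (h ` Y) \<le> card T"
proof -
  have "h ` Y \<subseteq> (\<lambda>t. h (SOME y. y \<in> Y \<and> \<Phi> y = t)) ` T"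
  proof
    fix a assume "a \<in> h ` Y"
    then obtain y where y: "y \<in> Y" "a = h y" by blast
    then have "(SOME y'. y' \<in> Y \<and> \<Phi> y' = \<Phi> y) \<in> Y \<and> \<Phi> (SOME y'. y' \<in> Y \<and> \<Phi> y' = \<Phi> y) = \<Phi> y"
      by (intro someI[of "\<lambda>y'. y' \<in> Y \<and> \<Phi> y' = \<Phi> y" y]) auto
    then have "h (SOME y'. y' \<in> Y \<and> \<Phi> y' = \<Phi> y) = h y" using assms(3) y by blast
    then show "a \<in> (\<lambda>t. h (SOME y. y \<in> Y \<and> \<Phi> y = t)) ` T" using y assms(2)
      by (intro image_eqI[of _ _ "\<Phi> y"]) auto
  qed
  then show ?thesis using assms(1) by (meson card_image_le card_mono finite_imageI finite_subset le_trans)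
qed

context conn_graph
begin

section \<open>Atoms of the horofunctions\<close>

text \<open>Vertices are equivalent when their distance functions agree, up to a constant, on the ball of
  radius \<open>m\<close> around \<open>c\<close>; the equation is arranged so that no subtraction occurs.\<close>
definition atom :: "'v \<Rightarrow> nat \<Rightarrow> 'v \<Rightarrow> 'v set" where
  "atom c m y = {y' \<in> V. \<forall>p\<in>V. d c p \<le> m \<longrightarrow> d y p + d y' c = d y' p + d y c}"

lemma atom_sub: "atom c m y \<subseteq> V"
  by (auto simp: atom_def)

lemma atom_self: "y \<in> V \<Longrightarrow> y \<in> atom c m y"
  by (auto simp: atom_def)

lemma atom_D: "y' \<in> atom c m y \<Longrightarrow> p \<in> V \<Longrightarrow> d c p \<le> m \<Longrightarrow> d y p + d y' c = d y' p + d y c"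
  by (auto simp: atom_def)

lemma atom_sym: "y \<in> V \<Longrightarrow> y' \<in> atom c m y \<Longrightarrow> y \<in> atom c m y'"
  by (auto simp: atom_def)

lemma atom_trans: "y' \<in> atom c m y \<Longrightarrow> y'' \<in> atom c m y' \<Longrightarrow> y'' \<in> atom c m y"
  by (fastforce simp: atom_def)

lemma atom_eq: "y \<in> V \<Longrightarrow> y' \<in> atom c m y \<Longrightarrow> atom c m y' = atom c m y"
  using atom_sym atom_trans by blast

lemma atom_mono: "m \<le> m' \<Longrightarrow> atom c m' y \<subseteq> atom c m y"
  by (auto simp: atom_def)

lemma atom_0: "c \<in> V \<Longrightarrow> y \<in> V \<Longrightarrow> atom c 0 y = V"
  by (auto simp: atom_def d_0)

lemma atom_interval:
  assumes "c \<in> V" "y \<in> V" "y' \<in> atom c m y" "z \<in> interval c y" "d c z \<le> m"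
  shows "z \<in> interval c y'"
proof -
  have V: "y' \<in> V" "z \<in> V" using assms by (auto simp: atom_def interval_def)
  then show ?thesis using atom_D[OF assms(3) V(2) assms(5)] assms V
      d_sym[of y z] d_sym[of y c] d_sym[of y' z] d_sym[of y' c]
    by (auto simp: interval_def)
qed

text \<open>Here \<open>y\<close> itself is in the ball, so it lies on a geodesic from
  \<open>c\<close> to \<open>y'\<close>. The next vertex towards \<open>y'\<close> is in the ball as
  well; going there increases the distance from \<open>y\<close> and decreases that from
  \<open>y'\<close>, so the two distance functions do not differ by a constant.\<close>

lemma atom_single:
  assumes "c \<in> V" "y \<in> V" "y' \<in> atom c m y" "d c y < m" shows "y' = y"
proof (rule ccontr)
  assume ne: "y' \<noteq> y"
  have V: "y' \<in> V" using assms by (auto simp: atom_def)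
  have "y \<in> interval c y" using assms by (auto simp: interval_def)
  then have y: "y \<in> interval c y'" using atom_interval assms by auto
  then obtain p where p: "{y, p} \<in> E" "p \<in> interval c y'" "d c p = Suc (d c y)" "d y y' = Suc (d p y')"
    using interval_step[of c y' y] assms V ne by metis
  then have pV: "p \<in> V" by (auto simp: interval_def)
  have "d y p + d y' c = d y' p + d y c" using atom_D[OF assms(3) pV] p assms by auto
  then show False using p y d_edge[OF p(1)] d_sym[of y' c] d_sym[of y c] d_sym[of y' p] V pV assms
    by (auto simp: interval_def)
qed

lemma atom_far:
  assumes "c \<in> V" "y \<in> V" "y' \<in> atom c m y" "m \<le> d c y" shows "m \<le> d c y'"
  using atom_single[of c y' y m] atom_sym[of y y' c m] atom_sub assms by (metis not_le subsetD)

text \<open>Each of \<open>y\<close>, \<open>y'\<close> reaches \<open>p\<close> through a point of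
  \<open>Q\<close>; sending the other vertex through the same point gives one of the two
  inequalities.\<close>

lemma cross:
  assumes V: "p \<in> V" "y \<in> V" "y' \<in> V" and q: "q \<in> interval p y" "q \<in> Q" and q': "q' \<in> interval p y'" "q' \<in> Q"
    and Q: "\<And>q. q \<in> Q \<Longrightarrow> d y q + a' = d y' q + a"
  shows "d y p + a' = d y' p + a"
proof -
  have qV: "q \<in> V" "q' \<in> V" using q q' by (auto simp: interval_def)
  have "d y p = d y q + d q p" "d y' p = d y' q' + d q' p"
    using q q' V qV d_sym by (auto simp: interval_def)
  moreover have "d y p \<le> d y q' + d q' p" "d y' p \<le> d y' q + d q p" using d_tri V qV by auto
  ultimately show ?thesis using Q[OF q(2)] Q[OF q'(2)] by linarith
qed

text \<open>The set \<open>Q\<close> acts as a screen between the ball and the two vertices: by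
  \<open>cross\<close>, the difference of their distance functions on the ball is the constant it
  has on \<open>Q\<close>.\<close>

lemma atomI:
  assumes V: "c \<in> V" "y \<in> V" "y' \<in> V"
    and Q: "\<And>q q'. q \<in> Q \<Longrightarrow> q' \<in> Q \<Longrightarrow> d y q + d y' q' = d y' q + d y q'"
    and cr: "\<And>p. p \<in> V \<Longrightarrow> d c p \<le> m \<Longrightarrow> interval p y \<inter> Q \<noteq> {} \<and> interval p y' \<inter> Q \<noteq> {}"
  shows "y' \<in> atom c m y"
  unfolding atom_def
proof (intro CollectI conjI ballI impI)
  have "interval c y \<inter> Q \<noteq> {}" using cr[OF V(1)] V by auto
  then obtain q0 where q0: "q0 \<in> Q" by blast
  have *: "d y p + d y' q0 = d y' p + d y q0" if "p \<in> V" "d c p \<le> m" for p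
    using cr[OF that] cross[OF that(1) V(2,3), of _ Q _ "d y' q0" "d y q0"] Q q0 by fast
  fix p assume "p \<in> V" "d c p \<le> m"
  then show "d y p + d y' c = d y' p + d y c" using *[of p] *[of c] V by auto
qed (rule V)

lemma geo_edge:
  assumes "c \<in> V" "y \<in> V" "{x, x'} \<in> E" "d c x' = Suc (d c x)" "x' \<in> interval c y"
  shows "\<exists>s. geo s (d c y) c y \<and> s (d c x) = x \<and> s (Suc (d c x)) = x'"
proof -
  have V: "x \<in> V" "x' \<in> V" using edge_verts assms by blast+
  have "x \<in> interval c x'" using assms V d_edge by (auto simp: interval_def)
  from interval_trans[OF assms(1,2,5) this] have x: "x \<in> interval c y" "x' \<in> interval x y" .
  obtain s t where s: "geo s (d c x) c x" and t: "geo t (d x y) x y" "t (d x x') = x'"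
    using ex_geo_through[OF V(1) assms(2) x(2)] ex_geo[OF assms(1) V(1)] by blast
  have "d c x + d x y = d c y" using x by (auto simp: interval_def)
  then show ?thesis using geo_through[OF s t(1) x(1)] t(2) d_edge[OF assms(3)] geo_k[OF s]
    by (intro exI[of _ "\<lambda>i. if i \<le> d c x then s i else t (i - d c x)"]) auto
qed

end

section \<open>Finiteness of the atoms at an edge\<close>

context fine_hyp
begin

lemma corner_interval:
  assumes "a \<in> V" "b \<in> V" "z \<in> V" "z \<notin> interval a b"
    and "{z, za} \<in> E" "d z a = Suc (d za a)" "{z, zb} \<in> E" "d z b = Suc (d zb b)"
  shows "nr {z, za} {z, zb}"
proof -
  obtain s where s: "geo s (d a b) a b" using ex_geo assms by blast
  then have "z \<notin> s ` {..d a b}" using geo_interval[OF s] assms(4) by auto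
  then show ?thesis using corner[OF s] assms by blast
qed

definition Kn :: nat where
  "Kn = (SOME K. K \<ge> 1 \<and> (\<forall>e. finite {f. nr e f} \<and> card {f. nr e f} \<le> K))"

lemma Kn: "Kn \<ge> 1" "finite {f. nr e f}" "card {f. nr e f} \<le> Kn"
proof -
  have "\<exists>K::nat. K \<ge> 1 \<and> (\<forall>e. finite {f. nr e f} \<and> card {f. nr e f} \<le> K)"
    using near_finite[of L0] by metis
  from someI_ex[OF this] show "Kn \<ge> 1" "finite {f. nr e f}" "card {f. nr e f} \<le> Kn"
    unfolding Kn_def by blast+
qed

primrec near_ball :: "nat \<Rightarrow> 'v set set \<Rightarrow> 'v set set" where
  "near_ball 0 B = B"
| "near_ball (Suc n) B = {f. \<exists>e\<in>near_ball n B. nr e f}"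

lemma near_ball_fin: assumes "finite B" shows "finite (near_ball n B) \<and> card (near_ball n B) \<le> card B * Kn ^ n"
proof (induction n)
  case (Suc n)
  have eq: "near_ball (Suc n) B = (\<Union>e\<in>near_ball n B. {f. nr e f})" by auto
  have "card (near_ball (Suc n) B) \<le> (\<Sum>e\<in>near_ball n B. card {f. nr e f})"
    unfolding eq using Suc by (intro card_UN_le) auto
  also have "\<dots> \<le> of_nat (card (near_ball n B)) * Kn" by (rule sum_bounded_above) (rule Kn)
  also have "\<dots> \<le> card B * Kn ^ n * Kn" using Suc by (intro mult_right_mono) auto
  finally have "card (near_ball (Suc n) B) \<le> card B * Kn ^ Suc n" by (simp add: ac_simps)
  moreover have "finite (near_ball (Suc n) B)" unfolding eq using Suc Kn by (intro finite_UN_I) auto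
  ultimately show ?case by blast
qed (use assms in auto)

lemma near_ball_E: "B \<subseteq> E \<Longrightarrow> near_ball n B \<subseteq> E"
  by (induction n) (auto simp: near_def)

lemma near_ball_Suc: "B \<subseteq> E \<Longrightarrow> near_ball n B \<subseteq> near_ball (Suc n) B"
  using near_ball_E[of B n] near_refl by fastforce

lemma near_ball_mono: "B \<subseteq> E \<Longrightarrow> n \<le> m \<Longrightarrow> near_ball n B \<subseteq> near_ball m B"
  using lift_Suc_mono_le[of "\<lambda>n. near_ball n B" n m] near_ball_Suc by blast

lemma near_ball_mono': "B \<subseteq> B' \<Longrightarrow> near_ball n B \<subseteq> near_ball n B'"
  by (induction n) auto

lemma near_ball_add: "near_ball n (near_ball m B) = near_ball (m + n) B"
  by (induction n) auto

lemma near_ball_sing: "f \<in> near_ball n {e} \<Longrightarrow> e \<in> near_ball m B \<Longrightarrow> f \<in> near_ball (m + n) B"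
  using near_ball_mono'[of "{e}" "near_ball m B" n] near_ball_add[of n m B] by auto

definition Qs :: "'v set \<Rightarrow> 'v set" where
  "Qs g = \<Union>{f. nr g f}"

lemma Qs_fin: "finite (Qs g) \<and> card (Qs g) \<le> 2 * Kn"
proof -
  have fe: "finite f" "card f = 2" if "f \<in> {f. nr g f}" for f
    using that edge_card by (auto simp: near_def)
  have "card (Qs g) \<le> sum card {f. nr g f}" unfolding Qs_def by (rule card_Union_le_sum_card)
  also have "\<dots> \<le> of_nat (card {f. nr g f}) * 2" by (rule sum_bounded_above) (use fe in auto)
  also have "\<dots> \<le> 2 * Kn" using Kn(3)[of g] by simp
  finally show ?thesis using fe Kn(2)[of g] unfolding Qs_def by blast
qed

definition Kt :: nat where "Kt = (2 * (L0 + 1) + 1) ^ (2 * Kn)"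

text \<open>With \<open>Qs g\<close> as a screen, the atom of \<open>y\<close> depends only on the
  distances from \<open>y\<close> to \<open>Qs g\<close>, normalised at \<open>q0\<close>. These are
  integers of absolute value at most \<open>L0 + 1\<close> on at most \<open>2 * Kn\<close> points,
  and \<open>Kt\<close> counts such functions.\<close>

lemma atoms_through:
  fixes m :: nat
  assumes c: "c \<in> V" and g: "g \<in> E"
  defines "Y \<equiv> {y \<in> V. \<forall>p\<in>V. d c p \<le> m \<longrightarrow> interval p y \<inter> Qs g \<noteq> {}}"
  shows "finite (atom c m ` Y) \<and> card (atom c m ` Y) \<le> Kt"
proof -
  obtain q0 q1 where q0: "g = {q0, q1}" "q0 \<in> V" using edge_ends[OF g] by blast
  let ?M = "int (L0 + 1)"
  let ?\<Phi> = "\<lambda>y. restrict (\<lambda>q. int (d y q) - int (d y q0)) (Qs g)"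
  let ?T = "Qs g \<rightarrow>\<^sub>E {- ?M..?M}"
  have QV: "q \<in> V" "d q0 q \<le> L0 + 1" if q: "q \<in> Qs g" for q
  proof -
    obtain f where f: "nr g f" "q \<in> f" using q by (auto simp: Qs_def)
    then have "f \<in> E" by (auto simp: near_def)
    then show "q \<in> V" using f edge_ends by blast
    show "d q0 q \<le> L0 + 1" using near_dist[OF f(1) _ f(2)] q0 by auto
  qed
  have "card ?T = (2 * (L0 + 1) + 1) ^ card (Qs g)"
  proof -
    have "card {- ?M..?M} = 2 * (L0 + 1) + 1" by (simp add: nat_add_distrib nat_mult_distrib)
    then show ?thesis using Qs_fin[of g] by (simp add: card_PiE)
  qed
  also have "\<dots> \<le> Kt" unfolding Kt_def using Qs_fin[of g] by (intro power_increasing) auto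
  finally have cT: "card ?T \<le> Kt" .
  have fT: "finite ?T" using Qs_fin[of g] by (intro finite_PiE) auto
  have im: "?\<Phi> ` Y \<subseteq> ?T"
  proof
    fix \<phi> assume "\<phi> \<in> ?\<Phi> ` Y"
    then obtain y where y: "y \<in> V" "\<phi> = ?\<Phi> y" by (auto simp: Y_def)
    have "\<bar>int (d y q) - int (d y q0)\<bar> \<le> ?M" if q: "q \<in> Qs g" for q
      using d_tri[OF y(1) q0(2) QV(1)[OF q]] d_tri[OF y(1) QV(1)[OF q] q0(2)] QV(2)[OF q]
        d_sym[OF q0(2) QV(1)[OF q]] by linarith
    then show "\<phi> \<in> ?T" unfolding y(2) by (fastforce intro: restrict_PiE_iff[THEN iffD2])
  qed
  have fac: "atom c m y = atom c m y'" if y: "y \<in> Y" "y' \<in> Y" and eq: "?\<Phi> y = ?\<Phi> y'" for y y'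
  proof -
    have V: "y \<in> V" "y' \<in> V" using y by (auto simp: Y_def)
    have e: "int (d y q) - int (d y q0) = int (d y' q) - int (d y' q0)" if "q \<in> Qs g" for q
      using fun_cong[OF eq, of q] that by simp
    have "y' \<in> atom c m y"
    proof (rule atomI[OF c V, of "Qs g"])
      fix q q' assume "q \<in> Qs g" "q' \<in> Qs g"
      then show "d y q + d y' q' = d y' q + d y q'" using e[of q] e[of q'] by linarith
    qed (use y in \<open>auto simp: Y_def\<close>)
    then show ?thesis using atom_eq V by blast
  qed
  have "finite (atom c m ` Y) \<and> card (atom c m ` Y) \<le> card ?T"
    by (rule card_image_factor[OF fT im]) (rule fac)
  then show ?thesis using cT by linarith
qed

text \<open>Just beyond the offset \<open>\<delta> + 1\<close> plus the separation
  \<open>2 * \<delta> + 2\<close> that \<open>window\<close> needs for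
  \<open>C = \<delta>\<close>.\<close>

definition Ra :: nat where "Ra = 3 * \<delta> + 4"

definition Ka :: nat where "Ka = 2 * Kn ^ (2 * Ra) + Kn ^ (2 * Ra) * Kt"

text \<open>Follow a geodesic from \<open>c\<close> over the given edge to \<open>y\<close>. Until
  it meets a vertex that screens \<open>y\<close> from the ball, consecutive edges make small
  angles, so the geodesic has boundedly many choices of edges for \<open>Ra\<close> steps. If a
  screening vertex comes early, it has the same atom as \<open>y\<close>; if not, a near edge
  \<open>g\<close> makes \<open>Qs g\<close> a screen. The two summands of \<open>Ka\<close> count
  these cases.\<close>

lemma atoms_at_edge:
  assumes c: "c \<in> V" and xx: "{x, x'} \<in> E" "d c x' = Suc (d c x)" "m = d c x'"
  defines "S \<equiv> {atom c m y | y. y \<in> V \<and> x' \<in> interval c y}"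
  shows "finite S \<and> card S \<le> Ka"
proof -
  let ?B = "near_ball (2 * Ra) {{x, x'}}"
  define Y where "Y = (\<lambda>g. {y \<in> V. \<forall>p\<in>V. d c p \<le> m \<longrightarrow> interval p y \<inter> Qs g \<noteq> {}})"
  have BE: "?B \<subseteq> E" using xx near_ball_E[of "{{x, x'}}"] by auto
  have B: "finite ?B" "card ?B \<le> Kn ^ (2 * Ra)" using near_ball_fin[of "{{x, x'}}" "2 * Ra"] by auto
  have sub: "S \<subseteq> atom c m ` \<Union>?B \<union> (\<Union>g\<in>?B. atom c m ` Y g)"
  proof
    fix D assume "D \<in> S"
    then obtain y where y: "D = atom c m y" "y \<in> V" "x' \<in> interval c y" by (auto simp: S_def)
    define k where "k = d c y"
    obtain s where s: "geo s k c y" "s (d c x) = x" "s (Suc (d c x)) = x'"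
      using geo_edge[OF c y(2) xx(1,2) y(3)] unfolding k_def by blast
    have m: "m = Suc (d c x)" "m \<le> k" using xx y(3) by (auto simp: interval_def k_def)
    define good where "good = (\<lambda>j. \<forall>p\<in>V. d c p \<le> m \<longrightarrow> s j \<in> interval p y)"
    have sV: "i \<le> k \<Longrightarrow> s i \<in> V" for i using geo_V[OF s(1)] .
    have gk: "good k" unfolding good_def using geo_k[OF s(1)] y by (auto simp: interval_def)
    \<comment> \<open>Two small angles at \<open>z = s j\<close>: from the forward edge to the
      direction of \<open>p\<close>, since \<open>p\<close> shows that \<open>j\<close> is not good,
      and from there to the backward edge, since \<open>z\<close> is at least as far from
      \<open>c\<close> as \<open>p\<close>, hence on no geodesic from \<open>c\<close> to
      \<open>p\<close>.\<close>
    have small: "{s j, s (Suc j)} \<in> near_ball 2 {{s (j - 1), s j}}" if j: "m \<le> j" "j < k" "\<not> good j" for j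
    proof -
      obtain p where p: "p \<in> V" "d c p \<le> m" "s j \<notin> interval p y" using j by (auto simp: good_def)
      define z where "z = s j"
      have z: "z \<in> V" "d c z = j" using sV geo_da[OF s(1)] j by (auto simp: z_def)
      have "z \<noteq> p" using p y by (auto simp: z_def interval_def)
      have "p \<in> interval z p" "z \<in> interval z p" using z p by (auto simp: interval_def)
      then obtain w where w: "{z, w} \<in> E" "d z p = Suc (d w p)"
        using interval_step[OF z(1) p(1) _ \<open>z \<noteq> p\<close>] by metis
      have e1: "{z, s (Suc j)} \<in> E" using geo_E[OF s(1)] j by (auto simp: z_def)
      have "d z y = Suc (d (s (Suc j)) y)" using geo_db[OF s(1)] j by (auto simp: z_def)
      then have n1: "nr {z, w} {z, s (Suc j)}"
        using corner_interval[OF p(1) y(2) z(1) _ w e1] p(3) by (simp add: z_def)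
      have "z \<notin> interval c p" using z p j d_0[OF z(1) p(1)] \<open>z \<noteq> p\<close> by (auto simp: interval_def)
      moreover have "j - 1 < k" "Suc (j - 1) = j" using j m by auto
      then have "{z, s (j - 1)} \<in> E" using geo_E[OF s(1), of "j - 1"] by (simp add: z_def insert_commute)
      moreover have "d z c = Suc (d (s (j - 1)) c)"
        using z j m c sV geo_da[OF s(1), of "j - 1"] d_sym[of z c] d_sym[of "s (j - 1)" c] by auto
      ultimately have n2: "nr {z, s (j - 1)} {z, w}"
        using corner_interval[OF c p(1) z(1)] w by blast
      have "{s (j - 1), s j} = {z, s (j - 1)}" by (auto simp: z_def)
      then show ?thesis using n1 n2 by (auto simp: numeral_2_eq_2 z_def)
    qed
    define j0 where "j0 = (LEAST j. m \<le> j \<and> good j)"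
    have j0: "m \<le> j0 \<and> good j0" unfolding j0_def by (rule LeastI[of _ k]) (use gk m in auto)
    have j0k: "j0 \<le> k" unfolding j0_def by (rule Least_le) (use gk m in auto)
    have bad: "\<not> good j" if "m \<le> j" "j < j0" for j using not_less_Least that unfolding j0_def by blast
    have chain: "{s (j - 1), s j} \<in> near_ball (2 * (j - m)) {{x, x'}}" if "m \<le> j" "j \<le> j0" for j
      using that
    proof (induction j rule: dec_induct)
      case base
      show ?case using s m by auto
    next
      case (step j)
      have "{s j, s (Suc j)} \<in> near_ball 2 {{s (j - 1), s j}}" using small[of j] step bad[of j] j0k by auto
      then have "{s j, s (Suc j)} \<in> near_ball (2 * (j - m) + 2) {{x, x'}}" using step by (intro near_ball_sing) auto
      moreover have "2 * (j - m) + 2 = 2 * (Suc j - m)" using step by auto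
      ultimately show ?case by (metis diff_Suc_1)
    qed
    have inB: "{s (j - 1), s j} \<in> ?B" if "m \<le> j" "j \<le> j0" "j \<le> m + Ra" for j
    proof -
      have "2 * (j - m) \<le> 2 * Ra" using that by auto
      then show ?thesis using chain[OF that(1,2)] near_ball_mono[of "{{x, x'}}"] xx by blast
    qed
    show "D \<in> atom c m ` \<Union>?B \<union> (\<Union>g\<in>?B. atom c m ` Y g)"
    proof (cases "j0 \<le> m + Ra")
      case True
      have "s j0 \<in> \<Union>?B" using inB[of j0] j0 True by auto
      moreover have "s j0 \<in> atom c m y"
      proof (rule atomI[OF c y(2) sV[OF j0k], of "{s j0}"])
        fix p assume p: "p \<in> V" "d c p \<le> m"
        then show "interval p y \<inter> {s j0} \<noteq> {} \<and> interval p (s j0) \<inter> {s j0} \<noteq> {}"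
          using j0 sV[OF j0k] by (auto simp: good_def interval_def)
      qed auto
      then have "D = atom c m (s j0)" using atom_eq y by auto
      ultimately show ?thesis by blast
    next
      case False
      \<comment> \<open>From this level on the geodesic is too far from the ball to be close to a
        side from \<open>c\<close> to \<open>p\<close>, so it follows the side from \<open>y\<close>
        to \<open>p\<close>, for every \<open>p\<close> in the ball and with the same
        window.\<close>
      define j1 where "j1 = m + \<delta> + 1"
      define g where "g = {s (j1 + \<delta> + 1), s (j1 + \<delta> + 2)}"
      have idx: "j1 + \<delta> + 2 \<le> j0" "m \<le> j1 + \<delta> + 2" "j1 + \<delta> + 2 \<le> m + Ra" using False unfolding j1_def Ra_def by linarith+
      have gB: "g \<in> ?B" using inB[OF idx(2,1,3)] unfolding g_def by auto
      have "interval p y \<inter> Qs g \<noteq> {}" if p: "p \<in> V" "d c p \<le> m" for p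
      proof -
        obtain \<sigma> \<tau> where status: "geo \<sigma> (d y p) y p" "geo \<tau> (d c p) c p" using ex_geo p y c by meson
        have close: "\<exists>i\<le>d y p. d (s j) (\<sigma> i) \<le> \<delta>" if j: "m + \<delta> < j" "j \<le> k" for j
        proof -
          have False if i: "i \<le> d c p" "d (s j) (\<tau> i) \<le> \<delta>" for i
          proof -
            have "\<tau> i \<in> V" "d c (\<tau> i) = i" using geo_V[OF status(2)] geo_da[OF status(2)] i by auto
            then show False using d_tri[OF c, of "\<tau> i" "s j"] geo_da[OF s(1) j(2)] sV[OF j(2)] i j p
                d_sym[of "\<tau> i" "s j"] by auto
          qed
          then show ?thesis using thin[OF s(1) status(1) status(2) j(2)] by blast
        qed
        obtain i1 where i1: "i1 \<le> d y p" "d (s j1) (\<sigma> i1) \<le> \<delta>"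
          using close[of j1] idx j0k unfolding j1_def by auto
        obtain i2 where i2: "i2 \<le> d y p" "d (s (j1 + 2 * \<delta> + 2)) (\<sigma> i2) \<le> \<delta>"
          using close[of "j1 + 2 * \<delta> + 2"] idx j0k False unfolding j1_def Ra_def by auto
        have "\<exists>i<d y p. nr {s (j1 + \<delta> + 1), s (j1 + \<delta> + 2)} {\<sigma> i, \<sigma> (Suc i)}"
        proof (rule window[OF s(1) status(1) _ _ _ i1 i2])
          show "j1 + 2 * \<delta> + 2 \<le> k" using False j0k unfolding j1_def Ra_def by linarith
          show "2 * (2 * \<delta> + 2) + 6 * \<delta> + 2 \<le> L0" by (simp add: L0_def)
        qed auto
        then obtain i where i: "i < d y p" "nr g {\<sigma> i, \<sigma> (Suc i)}" unfolding g_def by blast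
        then have "\<sigma> i \<in> Qs g" by (auto simp: Qs_def)
        moreover have "\<sigma> i \<in> interval p y" using geo_interval[OF status(1), of i] i interval_comm p y by auto
        ultimately show ?thesis by blast
      qed
      then have "y \<in> Y g" using y by (auto simp: Y_def)
      then show ?thesis using gB y by blast
    qed
  qed
  have fe: "finite e" "card e = 2" if "e \<in> ?B" for e using that BE edge_card by auto
  have "card (\<Union>?B) \<le> sum card ?B" by (rule card_Union_le_sum_card)
  also have "\<dots> \<le> of_nat (card ?B) * 2" by (rule sum_bounded_above) (use fe in auto)
  finally have c1: "card (\<Union>?B) \<le> 2 * Kn ^ (2 * Ra)" using B by simp
  have f1: "finite (\<Union>?B)" using B(1) fe(1) by (rule finite_Union)
  have c1': "card (atom c m ` \<Union>?B) \<le> 2 * Kn ^ (2 * Ra)" using card_image_le[OF f1] c1 le_trans by blast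
  have t: "finite (atom c m ` Y g) \<and> card (atom c m ` Y g) \<le> Kt" if "g \<in> ?B" for g
    unfolding Y_def using atoms_through[OF c, of g m] that BE by auto
  have "card (\<Union>g\<in>?B. atom c m ` Y g) \<le> (\<Sum>g\<in>?B. card (atom c m ` Y g))" using B(1) by (rule card_UN_le)
  also have "\<dots> \<le> of_nat (card ?B) * Kt" by (rule sum_bounded_above) (use t in auto)
  also have "\<dots> \<le> Kn ^ (2 * Ra) * Kt" using B(2) by simp
  finally have c2: "card (\<Union>g\<in>?B. atom c m ` Y g) \<le> Kn ^ (2 * Ra) * Kt" .
  let ?U = "atom c m ` \<Union>?B \<union> (\<Union>g\<in>?B. atom c m ` Y g)"
  have fU: "finite ?U" using f1 t B(1) by blast
  have "card ?U \<le> Ka" using card_Un_le[of "atom c m ` \<Union>?B" "\<Union>g\<in>?B. atom c m ` Y g"] c1' c2 unfolding Ka_def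
    by linarith
  then show ?thesis using sub fU card_mono[OF fU sub] finite_subset[OF sub fU] by linarith
qed

end

section \<open>Slices, the guess and its jumps\<close>

context conn_graph
begin

definition slice :: "'v \<Rightarrow> nat \<Rightarrow> 'v \<Rightarrow> 'v set" where
  "slice c m y = {z \<in> interval c y. d c z = m}"

lemma slice_eq:
  assumes "c \<in> V" "y \<in> V" "y' \<in> atom c m y" shows "slice c m y' = slice c m y"
proof -
  have "y' \<in> V" "y \<in> atom c m y'" using assms atom_sub atom_sym by blast+
  then show ?thesis using atom_interval[of c y y' m] atom_interval[of c y' y m] assms unfolding slice_def by auto
qed

lemma slice_ne: assumes "c \<in> V" "y \<in> V" "m \<le> d c y" shows "slice c m y \<noteq> {}"
proof -
  obtain s where s: "geo s (d c y) c y" using ex_geo assms by blast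
  then have "s m \<in> slice c m y" using geo_interval[OF s] geo_da[OF s] assms by (auto simp: slice_def)
  then show ?thesis by blast
qed

lemma slice_top: assumes "c \<in> V" "y \<in> V" shows "slice c (d c y) y = {y}"
  using assms by (auto simp: slice_def interval_def d_0)

text \<open>The guess, from the atom of \<open>y\<close> at level \<open>m\<close> alone, whether \<open>y\<close> lies in \<open>A\<close>; an atom meeting both
  \<open>A\<close> and its complement is decided by its slice. Along the atoms of \<open>y\<close> the guess ends with the truth,
  so that the indicator of \<open>A\<close> is the signed sum of the indicators of the atoms at which it changes.\<close>
definition status :: "'v \<Rightarrow> 'v set \<Rightarrow> nat \<Rightarrow> nat \<Rightarrow> 'v \<Rightarrow> bool" where
  "status c A ms m y \<longleftrightarrow> ms \<le> m \<and>
     (atom c m y \<subseteq> A \<or> (atom c m y \<inter> A \<noteq> {} \<and> slice c m y \<subseteq> A))"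

lemma status_eq: "c \<in> V \<Longrightarrow> y \<in> V \<Longrightarrow> y' \<in> atom c m y \<Longrightarrow> status c A ms m y' = status c A ms m y"
  unfolding status_def using atom_eq slice_eq by metis

definition jump :: "'v \<Rightarrow> 'v set \<Rightarrow> nat \<Rightarrow> nat \<Rightarrow> 'v \<Rightarrow> bool" where
  "jump c A ms m y \<longleftrightarrow> status c A ms m y \<noteq> (0 < m \<and> status c A ms (m - 1) y)"

lemma status_pred_eq: "c \<in> V \<Longrightarrow> y \<in> V \<Longrightarrow> y' \<in> atom c m y \<Longrightarrow> status c A ms (m - 1) y' = status c A ms (m - 1) y"
  using status_eq atom_mono[of "m - 1" m c y] by (meson diff_le_self subsetD)

lemma jump_eq: "c \<in> V \<Longrightarrow> y \<in> V \<Longrightarrow> y' \<in> atom c m y \<Longrightarrow> jump c A ms m y' = jump c A ms m y"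
  unfolding jump_def using status_eq status_pred_eq by metis

text \<open>Beyond level \<open>d c y\<close> the atom of \<open>y\<close> is the singleton of
  \<open>y\<close> (\<open>atom_single\<close>). With these repetitions included, evaluation at
  \<open>c\<close> would have infinite norm.\<close>

definition levels :: "'v \<Rightarrow> (nat \<times> 'v set) set" where
  "levels c = {(m, atom c m y) | m y. y \<in> V \<and> m \<le> d c y}"

definition jumps :: "'v \<Rightarrow> 'v set \<Rightarrow> nat \<Rightarrow> (nat \<times> 'v set) set" where
  "jumps c A ms = {(m, atom c m y) | m y. y \<in> V \<and> m \<le> d c y \<and> jump c A ms m y}"

lemma jumps_sub: "jumps c A ms \<subseteq> levels c"
  by (auto simp: jumps_def levels_def)

text \<open>A change of the guess has two causes at once. The larger atom is mixed, witnessed by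
  \<open>y1\<close> and \<open>y2\<close>. And membership in \<open>A\<close> changes between a
  vertex \<open>z\<close> of the slice and a vertex \<open>b\<close> beyond it: \<open>b\<close> is
  \<open>y\<close>, the next slice vertex, or an outsider of the smaller atom.\<close>

lemma jump_split:
  assumes c: "c \<in> V" and y: "y \<in> V" "m \<le> d c y" and A: "A \<subseteq> V" and j: "jump c A ms m y" "ms < m"
  obtains y1 y2 z z' b where
    "y1 \<in> atom c (m - 1) y" "y1 \<in> A" "y2 \<in> atom c (m - 1) y" "y2 \<notin> A"
    "{z, z'} \<in> E" "z \<in> interval c y" "d c z = m - 1" "z' \<in> interval c y" "d c z' = m"
    "b \<in> V" "z' \<in> interval c b" "d z b = Suc (d z' b)" "(z \<in> A) \<noteq> (b \<in> A)"
proof -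
  note result = that
  let ?D = "atom c m y" and ?D' = "atom c (m - 1) y"
  have m: "0 < m" "ms \<le> m" "ms \<le> m - 1" using j by auto
  have sub: "?D \<subseteq> ?D'" by (rule atom_mono) auto
  have yD: "y \<in> ?D" using y atom_self by auto
  have ne: "status c A ms m y \<noteq> status c A ms (m - 1) y" using j m by (auto simp: jump_def)
  have m1: "\<not> ?D' \<subseteq> A"
  proof
    assume "?D' \<subseteq> A"
    then have "status c A ms m y" "status c A ms (m - 1) y" using m sub unfolding status_def by auto
    then show False using ne by simp
  qed
  have m2: "?D' \<inter> A \<noteq> {}"
  proof
    assume "?D' \<inter> A = {}"
    moreover have "?D \<inter> A = {}" using calculation sub by auto
    ultimately have "\<not> status c A ms m y" "\<not> status c A ms (m - 1) y" using yD sub unfolding status_def by auto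
    then show False using ne by simp
  qed
  obtain y1 y2 where y12: "y1 \<in> ?D'" "y1 \<in> A" "y2 \<in> ?D'" "y2 \<notin> A" using m1 m2 by blast
  \<comment> \<open>It is enough to find such \<open>z\<close> and \<open>b\<close>: the first edge
    of a geodesic from \<open>z\<close> to \<open>b\<close> ends in the slice of level
    \<open>m\<close>, hence also on a geodesic from \<open>c\<close> to \<open>y\<close>.\<close>
  have up: thesis if b: "b \<in> V" "z \<in> interval c b" "d c z = m - 1" "m \<le> d c b" "(z \<in> A) \<noteq> (b \<in> A)"
     and zy: "\<And>u. u \<in> slice c m b \<Longrightarrow> u \<in> interval c y" "z \<in> interval c y" for z b
  proof -
    have "z \<noteq> b" using b by auto
    obtain z' where z': "{z, z'} \<in> E" "z' \<in> interval c b" "d c z' = Suc (d c z)" "d z b = Suc (d z' b)"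
      using interval_step[OF c b(1,2) \<open>z \<noteq> b\<close>] by metis
    have dz: "d c z' = m" using z' b m by auto
    have zin: "z' \<in> interval c y" using zy(1)[of z'] z' dz by (auto simp: slice_def)
    show thesis by (rule result[OF y12 z'(1) zy(2) b(3) zin dz b(1) z'(2,4) b(5)])
  qed
  show thesis
  proof (cases "status c A ms m y")
    case True
    then have "\<not> status c A ms (m - 1) y" using ne by simp
    then obtain z where z: "z \<in> slice c (m - 1) y" "z \<notin> A" using m1 m2 m unfolding status_def by blast
    then have z1: "z \<in> interval c y" "d c z = m - 1" by (auto simp: slice_def)
    show thesis
    proof (cases "?D \<subseteq> A")
      case True
      then show thesis using up[of y z] z z1 y yD by (auto simp: slice_def)
    next
      case False
      then have sl: "slice c m y \<subseteq> A" using True unfolding status_def by auto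
      have "z \<noteq> y" using z1 y m by auto
      then obtain z' where z': "{z, z'} \<in> E" "z' \<in> interval c y" "d c z' = Suc (d c z)" "z' \<in> interval z y"
        using interval_step[OF c y(1) z1(1)] by metis
      have V: "z' \<in> V" using z' by (auto simp: interval_def)
      have in_A: "z' \<in> A" using z' sl z1 m by (auto simp: slice_def)
      have "z \<in> interval c z'" using z' V d_edge[OF z'(1)] z1 by (auto simp: interval_def)
      moreover have "slice c m z' \<subseteq> {z'}" using slice_top[OF c V] z' z1 m by auto
      ultimately show thesis using up[of z' z] V z' z1 z in_A m by auto
    qed
  next
    case False
    then have "status c A ms (m - 1) y" using ne by simp
    then have sl: "slice c (m - 1) y \<subseteq> A" using m1 unfolding status_def by auto
    have "\<not> ?D \<subseteq> A" using False m unfolding status_def by auto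
    then obtain b where b: "b \<in> ?D" "b \<notin> A" by blast
    have bV: "b \<in> V" using b atom_sub by blast
    have mb: "m \<le> d c b" using atom_far[OF c y(1) b(1) y(2)] .
    have bD': "b \<in> ?D'" using b sub by auto
    have "slice c (m - 1) y \<noteq> {}" by (rule slice_ne) (use c y in auto)
    then obtain z where z: "z \<in> slice c (m - 1) y" by blast
    then have "z \<in> interval c b" using slice_eq[OF c y(1) bD'] by (auto simp: slice_def)
    moreover have "slice c m b = slice c m y" using slice_eq[OF c y(1) b(1)] .
    ultimately show thesis using up[of b z] bV mb z sl b by (auto simp: slice_def)
  qed
qed

end

context fine_hyp
begin

lemma thin_geo:
  assumes "a \<in> V" "b \<in> V" "geo r m a e" "x \<in> interval a b"
  shows "(\<exists>q\<in>interval b e. d x q \<le> \<delta>) \<or> (\<exists>j\<le>m. d x (r j) \<le> \<delta>)"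
proof -
  have e: "e \<in> V" using geo_ab assms by blast
  obtain s where s: "geo s (d a b) a b" "s (d a x) = x" using ex_geo_through assms by blast
  obtain t where t: "geo t (d b e) b e" using ex_geo assms e by blast
  have "d a x \<le> d a b" using assms by (auto simp: interval_def)
  then show ?thesis using thin[OF s(1) t assms(3), of "d a x"] s(2) geo_interval[OF t] by auto
qed

text \<open>The separation \<open>2 * C + 2\<close> of \<open>window\<close> for the closeness
  \<open>C = 6 * \<delta>\<close> reached in \<open>close_A\<close>. The other constants are what
  the proof consumes: \<open>Rw\<close> covers three positions \<open>wd\<close> apart with a
  margin, \<open>C0\<close> comes out in \<open>B0_second\<close>, and \<open>N0\<close> exceeds
  \<open>3 + 3 * Rw\<close>, three angles for each edge.\<close>

definition wd :: nat where "wd = 12 * \<delta> + 2"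
definition Rw :: nat where "Rw = 2 * wd + \<delta> + 1"
definition C0 :: nat where "C0 = L0 + 2 + Rw + 2 * wd"
definition N0 :: nat where "N0 = 4 * Rw + 4"

end

section \<open>Change of base point\<close>

text \<open>The atom of \<open>y0\<close> at level \<open>n\<close> seen from \<open>c'\<close> is
  to be written by atoms seen from \<open>c\<close>. By \<open>A_z'\<close> the vertex
  \<open>z'\<close> lies between \<open>c'\<close> and every vertex of that atom, so
  \<open>\<gamma>\<close> followed by \<open>\<gamma>'\<close> leads from \<open>c\<close> to
  it.\<close>

locale base_change = fine_hyp V E \<delta> for V :: "'v set" and E :: "'v set set" and \<delta> :: nat +
  fixes c c' y0 z' :: 'v and n l :: nat and \<gamma> \<gamma>' :: "nat \<Rightarrow> 'v"
  assumes cV: "c \<in> V" "c' \<in> V" and y0: "y0 \<in> V" "n \<le> d c' y0"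
    and z': "z' \<in> interval c' y0" "d c' z' = n"
    and gam: "geo \<gamma> l c c'" and gam': "geo \<gamma>' n c' z'"
begin

text \<open>All changes of the status take place at a bounded angular distance from these edges; the
  restriction on \<open>i\<close> keeps their number linear in \<open>l\<close>.\<close>
definition B0 :: "'v set set" where
  "B0 = (\<lambda>i. {\<gamma> i, \<gamma> (Suc i)}) ` {..<l} \<union> (\<lambda>i. {\<gamma>' i, \<gamma>' (Suc i)}) ` {i. i < n \<and> n \<le> i + 2 * l + C0}"

lemma l: "l = d c c'" using geo_len[OF gam] .

lemma z'V: "z' \<in> V" using z' by (auto simp: interval_def)

lemma B0_E: "B0 \<subseteq> E"
  using geo_E[OF gam] geo_E[OF gam'] by (auto simp: B0_def)

lemma B0_fin: "finite B0" "card B0 \<le> 3 * l + C0"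
proof -
  let ?I = "{i. i < n \<and> n \<le> i + 2 * l + C0}"
  have sub: "?I \<subseteq> {n - (2 * l + C0)..<n}" by auto
  have fI: "finite ?I" by auto
  have "card ?I \<le> card {n - (2 * l + C0)..<n}" by (rule card_mono[OF _ sub]) auto
  then have cI: "card ?I \<le> 2 * l + C0" by simp
  show "finite B0" unfolding B0_def using fI by simp
  have "card B0 \<le> card {..<l} + card ?I" unfolding B0_def
    by (rule le_trans[OF card_Un_le]) (intro add_mono card_image_le fI, simp)
  then show "card B0 \<le> 3 * l + C0" using cI by simp
qed

lemma A_z': "y \<in> atom c' n y0 \<Longrightarrow> z' \<in> interval c' y"
  using atom_interval[OF cV(2) y0(1) _ z'(1)] z' by auto

lemma A_far: "y \<in> atom c' n y0 \<Longrightarrow> n \<le> d c' y"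
  using atom_far[OF cV(2) y0(1) _ y0(2)] .

text \<open>\<open>h\<close> stands for an edge at \<open>x\<close> making a small angle with the directions of \<open>c'\<close>.\<close>
lemma toward:
  assumes x: "x \<in> V" "x \<noteq> c'" and h: "\<And>w. {x, w} \<in> E \<Longrightarrow> d x c' = Suc (d w c') \<Longrightarrow> nr {x, w} h"
  shows "(\<exists>i<l. h \<in> near_ball 1 {{\<gamma> i, \<gamma> (Suc i)}}) \<or>
    (x \<noteq> c \<and> (\<forall>v. {v, x} \<in> E \<and> d c x = Suc (d c v) \<longrightarrow> h \<in> near_ball 2 {{v, x}}))"
proof (cases "x \<in> \<gamma> ` {..l}")
  case True
  then obtain i where i: "i \<le> l" "x = \<gamma> i" by auto
  then have lt: "i < l" using x geo_k[OF gam] by (cases "i = l") auto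
  then have "{x, \<gamma> (Suc i)} \<in> E" "d x c' = Suc (d (\<gamma> (Suc i)) c')"
    using i geo_E[OF gam] geo_db[OF gam, of i] geo_db[OF gam, of "Suc i"] by auto
  from h[OF this] have "h \<in> near_ball 1 {{\<gamma> i, \<gamma> (Suc i)}}" using i by simp
  then show ?thesis using lt by blast
next
  case False
  have "\<gamma> 0 = c" using geo_0[OF gam] .
  then have xc: "x \<noteq> c" using False by force
  have "x \<in> interval x c'" using x cV by (auto simp: interval_def)
  then obtain w where w: "{x, w} \<in> E" "d x c' = Suc (d w c')" using interval_step[OF x(1) cV(2) _ x(2)] by metis
  have "h \<in> near_ball 2 {{v, x}}" if v: "{v, x} \<in> E" "d c x = Suc (d c v)" for v
  proof -
    have vV: "v \<in> V" using edge_verts v by blast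
    have "{x, v} \<in> E" "d x c = Suc (d v c)" using v d_sym[OF cV(1) x(1)] d_sym[OF cV(1) vV] by (auto simp: insert_commute)
    then have "nr {x, v} {x, w}" using corner[OF gam False x(1) _ _ w] by blast
    then show ?thesis using h[OF w] by (auto simp: numeral_2_eq_2 insert_commute)
  qed
  then show ?thesis using xc by blast
qed

text \<open>A chain of small angles at \<open>x\<close> turns the edge towards \<open>b\<close> into
  the direction of \<open>p\<close>, then of \<open>c'\<close>, then back towards \<open>c\<close>.
  A link is missing only if \<open>x\<close> lies on the geodesic in question, and then the edge is
  near an edge of \<open>\<gamma>\<close> or \<open>\<gamma>'\<close>. At most three links
  occur.\<close>

lemma trichotomy:
  assumes x: "{x, x'} \<in> E" and b: "b \<in> V" "d x b = Suc (d x' b)"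
    and p: "p \<in> V" "d c' p \<le> n" "x \<notin> interval p b"
    and y1: "d c' x < n \<Longrightarrow> y1 \<in> atom c' n y0" "d c' x < n \<Longrightarrow> d x y1 = Suc (d x' y1)"
  shows "(\<exists>i<l. {x, x'} \<in> near_ball 3 {{\<gamma> i, \<gamma> (Suc i)}}) \<or>
    (\<exists>i<n. x = \<gamma>' i \<and> {x, x'} \<in> near_ball 3 {{\<gamma>' i, \<gamma>' (Suc i)}}) \<or>
    (x \<noteq> c \<and> (\<forall>v. {v, x} \<in> E \<and> d c x = Suc (d c v) \<longrightarrow> {x, x'} \<in> near_ball 3 {{v, x}}))"
proof -
  have V: "x \<in> V" "x' \<in> V" using edge_verts x by blast+
  have xp: "x \<noteq> p" using p b by (auto simp: interval_def)
  have fin: ?thesis if xc: "x \<noteq> c'" and h: "\<And>w. {x, w} \<in> E \<Longrightarrow> d x c' = Suc (d w c') \<Longrightarrow> nr {x, w} h"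
    and hx: "nr h {x, x'}" for h
  proof -
    have s: "{x, x'} \<in> near_ball 3 B" if "h \<in> near_ball 2 B" for B using that hx by (auto simp: numeral_3_eq_3 numeral_2_eq_2)
    have s1: "near_ball 1 {{\<gamma> i, \<gamma> (Suc i)}} \<subseteq> near_ball 2 {{\<gamma> i, \<gamma> (Suc i)}}" if "i < l" for i
      using near_ball_mono[of "{{\<gamma> i, \<gamma> (Suc i)}}" 1 2] geo_E[OF gam that] by auto
    from toward[OF V(1) xc h] show ?thesis
    proof
      assume "\<exists>i<l. h \<in> near_ball 1 {{\<gamma> i, \<gamma> (Suc i)}}"
      then obtain i where "i < l" "h \<in> near_ball 2 {{\<gamma> i, \<gamma> (Suc i)}}" using s1 by blast
      then show ?thesis using s by blast
    next
      assume "x \<noteq> c \<and> (\<forall>v. {v, x} \<in> E \<and> d c x = Suc (d c v) \<longrightarrow> h \<in> near_ball 2 {{v, x}})"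
      then show ?thesis using s by blast
    qed
  qed
  show ?thesis
  proof (cases "x \<in> interval c' p")
    case False
    have "x \<in> interval x p" using V p by (auto simp: interval_def)
    then obtain w where w: "{x, w} \<in> E" "d x p = Suc (d w p)" using interval_step[OF V(1) p(1) _ xp] by metis
    have "nr {x, w} {x, x'}" using corner_interval[OF p(1) b(1) V(1) p(3) w x b(2)] .
    moreover have "x \<noteq> c'" using False p cV by (auto simp: interval_def)
    moreover have "nr {x, u} {x, w}" if "{x, u} \<in> E" "d x c' = Suc (d u c')" for u
      using corner_interval[OF cV(2) p(1) V(1) False that w] .
    ultimately show ?thesis using fin by blast
  next
    \<comment> \<open>Now \<open>x\<close> is between \<open>c'\<close> and \<open>p\<close>, hence
      within \<open>n\<close> of \<open>c'\<close>, and the chain through \<open>p\<close> breaks.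
      It is replaced by one through \<open>y1\<close> and \<open>z'\<close>: the edge also points to
      \<open>y1\<close>, and \<open>x\<close> is too close to \<open>c'\<close> to lie beyond
      \<open>z'\<close>.\<close>
    case True
    have "d x p \<noteq> 0" using xp d_0[OF V(1) p(1)] by simp
    then have lt: "d c' x < n" using True p by (auto simp: interval_def)
    note y1 = y1(1)[OF lt] y1(2)[OF lt]
    have y1V: "y1 \<in> V" using y1 atom_sub by blast
    have zy: "z' \<in> interval c' y1" using A_z' y1 by blast
    have "x \<notin> interval z' y1"
    proof
      assume "x \<in> interval z' y1"
      then have "z' \<in> interval c' x" using interval_trans'(2)[OF cV(2) y1V zy] by blast
      then show False using lt z' by (auto simp: interval_def)
    qed
    then have nz: "nr {x, u} {x, x'}" if "{x, u} \<in> E" "d x z' = Suc (d u z')" for u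
      using corner_interval[OF z'V y1V V(1) _ that x y1(2)] by blast
    show ?thesis
    proof (cases "x \<in> \<gamma>' ` {..n}")
      case True
      then obtain i where i: "i \<le> n" "x = \<gamma>' i" by auto
      then have "i < n" using lt geo_da[OF gam' i(1)] by auto
      then have "{x, \<gamma>' (Suc i)} \<in> E" "d x z' = Suc (d (\<gamma>' (Suc i)) z')"
        using i geo_E[OF gam'] geo_db[OF gam', of i] geo_db[OF gam', of "Suc i"] by auto
      from nz[OF this] have "{x, x'} \<in> near_ball 1 {{\<gamma>' i, \<gamma>' (Suc i)}}" using i by simp
      then have "{x, x'} \<in> near_ball 3 {{\<gamma>' i, \<gamma>' (Suc i)}}"
        using near_ball_mono[of "{{\<gamma>' i, \<gamma>' (Suc i)}}" 1 3] geo_E[OF gam' \<open>i < n\<close>] by auto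
      then show ?thesis using i \<open>i < n\<close> by blast
    next
      case False
      have "\<gamma>' 0 = c'" "\<gamma>' n = z'" using geo_0[OF gam'] geo_k[OF gam'] by auto
      then have ne: "x \<noteq> c'" "x \<noteq> z'" using False by force+
      have "x \<in> interval x z'" using V z'V by (auto simp: interval_def)
      then obtain w where w: "{x, w} \<in> E" "d x z' = Suc (d w z')" using interval_step[OF V(1) z'V _ ne(2)] by metis
      have "nr {x, u} {x, w}" if "{x, u} \<in> E" "d x c' = Suc (d u c')" for u
        using corner[OF gam' False V(1) that w] .
      then show ?thesis using fin[OF ne(1) _ nz[OF w]] by blast
    qed
  qed
qed

text \<open>Otherwise the ball around \<open>c\<close> would screen \<open>y1\<close> and
  \<open>y2\<close> from the ball around \<open>c'\<close>, and by \<open>atomI\<close> their common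
  atom seen from \<open>c\<close> would put them into the same atom seen from
  \<open>c'\<close>.\<close>

lemma mixed_point:
  assumes y: "y \<in> V" and y1: "y1 \<in> atom c m y" "y1 \<in> atom c' n y0" and y2: "y2 \<in> atom c m y" "y2 \<notin> atom c' n y0"
  obtains p b where "p \<in> V" "d c' p \<le> n" "b = y1 \<or> b = y2" "\<And>q. q \<in> interval p b \<Longrightarrow> m < d c q"
proof -
  let ?Q = "{q \<in> V. d c q \<le> m}"
  have V: "y1 \<in> V" "y2 \<in> V" using y1 y2 atom_sub by blast+
  have "\<exists>p\<in>V. d c' p \<le> n \<and> (\<exists>b\<in>{y1, y2}. interval p b \<inter> ?Q = {})"
  proof (rule ccontr)
    assume no: "\<not> ?thesis"
    have "y2 \<in> atom c' n y1"
    proof (rule atomI[OF cV(2) V, of ?Q])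
      fix q q' assume "q \<in> ?Q" "q' \<in> ?Q"
      then show "d y1 q + d y2 q' = d y2 q + d y1 q'"
        using atom_D[OF y1(1), of q] atom_D[OF y1(1), of q'] atom_D[OF y2(1), of q] atom_D[OF y2(1), of q'] by auto
    qed (use no in blast)
    then show False using y1(2) y2(2) atom_trans by blast
  qed
  then obtain p b where pb: "p \<in> V" "d c' p \<le> n" "b = y1 \<or> b = y2" "interval p b \<inter> ?Q = {}" by blast
  have "m < d c q" if "q \<in> interval p b" for q
  proof -
    have "q \<in> V" using that by (auto simp: interval_def)
    then show ?thesis using pb(4) that by fastforce
  qed
  then show thesis using that pb(1-3) by blast
qed

text \<open>In the triangle \<open>c\<close>, \<open>b\<close>, \<open>p\<close> the side from
  \<open>p\<close> to \<open>b\<close> avoids the ball, so \<open>x\<close> is close to the side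
  from \<open>c\<close> to \<open>p\<close>. The triangle \<open>c\<close>, \<open>p\<close>,
  \<open>c'\<close> then leads to \<open>\<gamma>\<close> or to a point within \<open>n\<close> of
  \<open>c'\<close>.\<close>

lemma close_mixed:
  assumes b: "b \<in> V" "x \<in> interval c b" "d c x + \<delta> \<le> m"
    and p: "p \<in> V" "d c' p \<le> n" "\<And>q. q \<in> interval p b \<Longrightarrow> m < d c q"
  shows "(\<exists>i\<le>l. d x (\<gamma> i) \<le> 6 * \<delta>) \<or> d c' x \<le> n + 2 * \<delta>"
proof -
  have xV: "x \<in> V" using b by (auto simp: interval_def)
  have "\<not> (\<exists>q\<in>interval b p. d x q \<le> \<delta>)"
  proof
    assume "\<exists>q\<in>interval b p. d x q \<le> \<delta>"
    then obtain q where q: "q \<in> interval b p" "d x q \<le> \<delta>" by blast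
    then have "q \<in> V" "m < d c q" using p(3)[of q] interval_comm[OF b(1) p(1)] by (auto simp: interval_def)
    then show False using d_tri[OF cV(1) xV, of q] q b by linarith
  qed
  then obtain q where q: "q \<in> interval c p" "d x q \<le> \<delta>" using thin_interval[OF cV(1) b(1) p(1) b(2)] by blast
  have qV: "q \<in> V" using q by (auto simp: interval_def)
  from thin_geo[OF cV(1) p(1) gam q(1)] show ?thesis
  proof
    assume "\<exists>u\<in>interval p c'. d q u \<le> \<delta>"
    then obtain u where u: "u \<in> interval p c'" "d q u \<le> \<delta>" by blast
    have uV: "u \<in> V" using u by (auto simp: interval_def)
    have "d u c' \<le> n" using u p d_sym[OF cV(2) p(1)] by (auto simp: interval_def)
    then have "d x c' \<le> n + 2 * \<delta>"
      using d_tri[OF xV qV cV(2)] d_tri[OF qV uV cV(2)] q u by linarith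
    then show ?thesis using d_sym[OF cV(2) xV] by simp
  next
    assume "\<exists>j\<le>l. d q (\<gamma> j) \<le> \<delta>"
    then obtain j where j: "j \<le> l" "d q (\<gamma> j) \<le> \<delta>" by blast
    have "d x (\<gamma> j) \<le> 6 * \<delta>" using d_tri[OF xV qV geo_V[OF gam j(1)]] j q by linarith
    then show ?thesis using j by blast
  qed
qed

text \<open>Two thin triangles lead from \<open>x\<close> to \<open>\<gamma>\<close>, to
  \<open>\<gamma>'\<close>, or beyond \<open>z'\<close>. In the last case the point is still within
  \<open>n + 4 * \<delta>\<close> of \<open>c'\<close>, so at most \<open>4 * \<delta>\<close>
  beyond \<open>z'\<close>; with the two thinness steps this gives
  \<open>6 * \<delta>\<close>.\<close>

lemma close_A:
  assumes y1: "y1 \<in> atom c' n y0" and x: "x \<in> interval c y1" "d c' x \<le> n + 2 * \<delta>"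
  shows "(\<exists>i\<le>l. d x (\<gamma> i) \<le> 6 * \<delta>) \<or> (\<exists>i\<le>n. d x (\<gamma>' i) \<le> 6 * \<delta>)"
proof -
  have V: "y1 \<in> V" "x \<in> V" using y1 x atom_sub by (auto simp: interval_def)
  from thin_geo[OF cV(1) V(1) gam x(1)] show ?thesis
  proof
    assume "\<exists>q\<in>interval y1 c'. d x q \<le> \<delta>"
    then obtain q where q: "q \<in> interval c' y1" "d x q \<le> \<delta>" using interval_comm[OF V(1) cV(2)] by blast
    have qV: "q \<in> V" using q by (auto simp: interval_def)
    have dq: "d c' q \<le> n + 3 * \<delta>" using d_tri[OF cV(2) V(2) qV] q x by linarith
    from thin_geo[OF cV(2) V(1) gam' q(1)] show ?thesis
    proof
      assume "\<exists>r\<in>interval y1 z'. d q r \<le> \<delta>"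
      then obtain r where r: "r \<in> interval z' y1" "d q r \<le> \<delta>" using interval_comm[OF V(1) z'V] by blast
      have rV: "r \<in> V" using r by (auto simp: interval_def)
      have "z' \<in> interval c' r" using interval_trans'(2)[OF cV(2) V(1) A_z'[OF y1] r(1)] .
      then have "n + d z' r = d c' r" using z' by (auto simp: interval_def)
      then have "d r z' \<le> 4 * \<delta>" using d_tri[OF cV(2) qV rV] dq r d_sym[OF rV z'V] by linarith
      then have "d x z' \<le> 6 * \<delta>" using d_tri[OF V(2) qV z'V] d_tri[OF qV rV z'V] q r by linarith
      then show ?thesis using geo_k[OF gam'] by auto
    next
      assume "\<exists>j\<le>n. d q (\<gamma>' j) \<le> \<delta>"
      then obtain j where j: "j \<le> n" "d q (\<gamma>' j) \<le> \<delta>" by blast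
      have "d x (\<gamma>' j) \<le> 6 * \<delta>" using d_tri[OF V(2) qV geo_V[OF gam' j(1)]] j q by linarith
      then show ?thesis using j by blast
    qed
  next
    assume "\<exists>j\<le>l. d x (\<gamma> j) \<le> \<delta>"
    then show ?thesis by fastforce
  qed
qed

text \<open>Of three positions two are close to the same one of \<open>\<gamma>\<close> and
  \<open>\<gamma>'\<close>, and \<open>window\<close> applies to these.\<close>

lemma window3:
  assumes s: "geo s k c b" and j: "j + 2 * wd \<le> k"
    and cl: "\<And>i. i = j \<or> i = j + wd \<or> i = j + 2 * wd \<Longrightarrow>
       (\<exists>i'\<le>l. d (s i) (\<gamma> i') \<le> 6 * \<delta>) \<or> (\<exists>i'\<le>n. d (s i) (\<gamma>' i') \<le> 6 * \<delta>)"
  shows "\<exists>j'. j \<le> j' \<and> j' < j + 2 * wd \<and> ((\<exists>i<l. nr {s j', s (Suc j')} {\<gamma> i, \<gamma> (Suc i)}) \<or>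
     (\<exists>i<n. nr {s j', s (Suc j')} {\<gamma>' i, \<gamma>' (Suc i)}))"
proof -
  have two: "\<exists>j'. j \<le> j' \<and> j' < j + 2 * wd \<and> (\<exists>i<m. nr {s j', s (Suc j')} {t i, t (Suc i)})"
    if t: "geo t m a e" and ij: "j \<le> j1" "j1 + wd \<le> j2" "j2 \<le> j + 2 * wd"
      and e1: "\<exists>i'\<le>m. d (s j1) (t i') \<le> 6 * \<delta>" and e2: "\<exists>i'\<le>m. d (s j2) (t i') \<le> 6 * \<delta>" for t m a e j1 j2
  proof -
    obtain i1 i2 where i: "i1 \<le> m" "d (s j1) (t i1) \<le> 6 * \<delta>" "i2 \<le> m" "d (s j2) (t i2) \<le> 6 * \<delta>"
      using e1 e2 by blast
    have "\<exists>i<m. nr {s (j1 + 6 * \<delta> + 1), s (j1 + 6 * \<delta> + 2)} {t i, t (Suc i)}"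
    proof (rule window[OF s t _ _ _ i])
      show "j1 + 2 * (6 * \<delta>) + 2 \<le> j2" "j2 \<le> k" "j2 \<le> j1 + 2 * wd" using ij j by (auto simp: wd_def)
      show "2 * (2 * wd) + 6 * (6 * \<delta>) + 2 \<le> L0" by (simp add: wd_def L0_def)
    qed
    then show ?thesis using ij by (intro exI[of _ "j1 + 6 * \<delta> + 1"]) (auto simp: wd_def)
  qed
  define X X' where "X = (\<lambda>i. \<exists>i'\<le>l. d (s i) (\<gamma> i') \<le> 6 * \<delta>)" and "X' = (\<lambda>i. \<exists>i'\<le>n. d (s i) (\<gamma>' i') \<le> 6 * \<delta>)"
  have c: "X j \<or> X' j" "X (j + wd) \<or> X' (j + wd)" "X (j + 2 * wd) \<or> X' (j + 2 * wd)"
    using cl unfolding X_def X'_def by blast+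
  have pair: ?thesis if "j \<le> j1" "j1 + wd \<le> j2" "j2 \<le> j + 2 * wd" "(X j1 \<and> X j2) \<or> (X' j1 \<and> X' j2)" for j1 j2
    using two[OF gam that(1-3)] two[OF gam' that(1-3)] that(4) unfolding X_def X'_def by blast
  consider "X j \<and> X (j + wd) \<or> X' j \<and> X' (j + wd)" | "X j \<and> X (j + 2 * wd) \<or> X' j \<and> X' (j + 2 * wd)"
    | "X (j + wd) \<and> X (j + 2 * wd) \<or> X' (j + wd) \<and> X' (j + 2 * wd)" using c by blast
  then show ?thesis
  proof cases
    case 1 then show ?thesis by (intro pair[of j "j + wd"]) auto
  next
    case 2 then show ?thesis by (intro pair[of j "j + 2 * wd"]) auto
  next
    case 3 then show ?thesis by (intro pair[of "j + wd" "j + 2 * wd"]) auto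
  qed
qed

lemma B0_first: "i < l \<Longrightarrow> {\<gamma> i, \<gamma> (Suc i)} \<in> B0"
  by (auto simp: B0_def)

text \<open>Passing through \<open>c'\<close> bounds \<open>d c x\<close> by
  \<open>l + i + L0 + 1\<close>; the resulting lower bound on \<open>i\<close> is exactly the
  restriction in \<open>B0\<close>.\<close>

lemma B0_second:
  assumes "i < n" "x \<in> V" "d x (\<gamma>' i) \<le> L0 + 1" "n \<le> d c x + l + 2 * wd + Rw + 1"
  shows "{\<gamma>' i, \<gamma>' (Suc i)} \<in> B0"
proof -
  have g: "\<gamma>' i \<in> V" "d c' (\<gamma>' i) = i" using geo_V[OF gam', of i] geo_da[OF gam', of i] assms by auto
  have "d c x \<le> l + i + (L0 + 1)"
    using d_tri[OF cV(1) cV(2) assms(2)] d_tri[OF cV(2) g(1) assms(2)] g d_sym[OF g(1) assms(2)] assms l by linarith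
  then have "n \<le> i + 2 * l + C0" using assms unfolding C0_def by linarith
  then show ?thesis using assms unfolding B0_def by blast
qed

lemma window3_B0:
  assumes s: "geo s k c b" and j: "j + 2 * wd \<le> k" "n \<le> j + l + 2 * wd + Rw + 1"
    and cl: "\<And>i. i = j \<or> i = j + wd \<or> i = j + 2 * wd \<Longrightarrow>
       (\<exists>i'\<le>l. d (s i) (\<gamma> i') \<le> 6 * \<delta>) \<or> (\<exists>i'\<le>n. d (s i) (\<gamma>' i') \<le> 6 * \<delta>)"
  shows "\<exists>j'. j \<le> j' \<and> j' < j + 2 * wd \<and> {s j', s (Suc j')} \<in> near_ball 1 B0"
proof -
  obtain j' where j': "j \<le> j'" "j' < j + 2 * wd" and e: "(\<exists>i<l. nr {s j', s (Suc j')} {\<gamma> i, \<gamma> (Suc i)}) \<or>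
     (\<exists>i<n. nr {s j', s (Suc j')} {\<gamma>' i, \<gamma>' (Suc i)})" using window3[OF s j(1) cl] by blast
  have "\<exists>e\<in>B0. nr e {s j', s (Suc j')}"
  proof -
    from e show ?thesis
    proof
      assume "\<exists>i<l. nr {s j', s (Suc j')} {\<gamma> i, \<gamma> (Suc i)}"
      then show ?thesis using B0_first near_sym by blast
    next
      assume "\<exists>i<n. nr {s j', s (Suc j')} {\<gamma>' i, \<gamma>' (Suc i)}"
      then obtain i where i: "i < n" "nr {s j', s (Suc j')} {\<gamma>' i, \<gamma>' (Suc i)}" by blast
      have k: "j' \<le> k" using j j' by linarith
      have "d (s j') (\<gamma>' i) \<le> L0 + 1" using near_dist[OF i(2)] by blast
      then have "{\<gamma>' i, \<gamma>' (Suc i)} \<in> B0"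
        using B0_second[OF i(1) geo_V[OF s k]] geo_da[OF s k] j j' by auto
      then show ?thesis using i near_sym by blast
    qed
  qed
  then show ?thesis using j' by auto
qed

end

section \<open>Location and number of the jumps\<close>

context base_change
begin

abbreviation A0 :: "'v set" where "A0 \<equiv> atom c' n y0"

text \<open>Vertices of \<open>A0\<close> are at distance at least \<open>n - l\<close> from
  \<open>c\<close>, so a guess that starts only here still ends with the truth. The late start makes
  the levels of the jumps comparable with \<open>n\<close>, which the weights require;
  \<open>2 * wd\<close> leaves room for one window.\<close>

definition mst :: nat where "mst = n - (l + 2 * wd)"

text \<open>Take a geodesic from \<open>c\<close> to \<open>b\<close> through the edge of
  \<open>jump_split\<close>. Some edge shortly before that one is near \<open>B0\<close>, and from
  there \<open>trichotomy\<close> carries nearness upwards, either afresh from \<open>B0\<close> or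
  from the preceding edge.\<close>

lemma jump_edge:
  assumes y: "y \<in> V" "m \<le> d c y" and jm: "jump c A0 mst m y" "mst < m"
  shows "m \<le> n + l \<and> (\<exists>z z2. {z, z2} \<in> near_ball N0 B0 \<and> d c z2 = Suc (d c z) \<and> d c z2 = m \<and> z2 \<in> interval c y)"
proof -
  obtain y1 y2 z z2 b where y1: "y1 \<in> atom c (m - 1) y" "y1 \<in> A0" and y2: "y2 \<in> atom c (m - 1) y" "y2 \<notin> A0"
    and z: "{z, z2} \<in> E" "z \<in> interval c y" "d c z = m - 1" "z2 \<in> interval c y" "d c z2 = m"
    and b: "b \<in> V" "z2 \<in> interval c b" "d z b = Suc (d z2 b)" "(z \<in> A0) \<noteq> (b \<in> A0)"
    using jump_split[OF cV(1) y atom_sub jm] by metis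
  obtain p bb where p: "p \<in> V" "d c' p \<le> n" and bb: "bb = y1 \<or> bb = y2"
    and far: "\<And>q. q \<in> interval p bb \<Longrightarrow> m - 1 < d c q"
    using mixed_point[OF y(1) y1 y2] by metis
  have m0: "0 < m" using jm by auto
  have V: "y1 \<in> V" "y2 \<in> V" "bb \<in> V" "z \<in> V" "z2 \<in> V" using y1 y2 bb z atom_sub by (auto simp: interval_def)
  have bbD: "bb \<in> atom c (m - 1) y" using bb y1 y2 by auto
  have dz2: "d c z2 = Suc (d c z)" using z m0 by simp
  obtain s where s: "geo s (d c b) c b" "s (m - 1) = z" "s m = z2"
    using geo_edge[OF cV(1) b(1) z(1) dz2 b(2)] z m0 by auto
  define k where "k = d c b"
  have mk: "m \<le> k" using b(2) z unfolding k_def by (auto simp: interval_def)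
  note s = s[folded k_def]
  have sV: "j \<le> k \<Longrightarrow> s j \<in> V" and sd: "j \<le> k \<Longrightarrow> d c (s j) = j" for j
    using geo_V[OF s(1)] geo_da[OF s(1)] by auto
  \<comment> \<open>Below level \<open>m\<close> the geodesic to \<open>b\<close> is also the
    beginning of geodesics to all vertices of the atom at level \<open>m - 1\<close>, in particular
    to \<open>y1\<close> and \<open>bb\<close>.\<close>
  have s_in: "s j \<in> interval c u" if "j \<le> m - 1" "u \<in> atom c (m - 1) y" for j u
  proof -
    have u: "u \<in> V" using that atom_sub by blast
    have "z \<in> interval c u" using atom_interval[OF cV(1) y(1) that(2) z(2)] z by auto
    moreover have "s j \<in> interval c z"
      using geo_d[OF s(1) that(1)] sd[of j] sV[of j] s(2) z that mk by (auto simp: interval_def)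
    ultimately show ?thesis using interval_trans(1)[OF cV(1) u] by blast
  qed
  have s_step: "d (s j) u = Suc (d (s (Suc j)) u)" if j: "Suc j \<le> m - 1" and u: "u \<in> atom c (m - 1) y" for j u
    using s_in[of j u] s_in[of "Suc j" u] that sd[of j] sd[of "Suc j"] mk by (auto simp: interval_def)
  have edge: "j < k \<Longrightarrow> {s j, s (Suc j)} \<in> E" for j using geo_E[OF s(1)] .
  let ?tri = "\<lambda>j. (\<exists>i<l. {s j, s (Suc j)} \<in> near_ball 3 {{\<gamma> i, \<gamma> (Suc i)}}) \<or>
    (\<exists>i<n. s j = \<gamma>' i \<and> {s j, s (Suc j)} \<in> near_ball 3 {{\<gamma>' i, \<gamma>' (Suc i)}}) \<or>
    (s j \<noteq> c \<and> (\<forall>v. {v, s j} \<in> E \<and> d c (s j) = Suc (d c v) \<longrightarrow> {s j, s (Suc j)} \<in> near_ball 3 {{v, s j}}))"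
  have tri: "?tri j" if j: "j \<le> m - 1" for j
  proof (cases "j < m - 1")
    case True
    show ?thesis
    proof (rule trichotomy[OF _ V(3) _ p])
      show "{s j, s (Suc j)} \<in> E" using edge True mk by auto
      show "d (s j) bb = Suc (d (s (Suc j)) bb)" using s_step True bbD by auto
      show "s j \<notin> interval p bb" using far[of "s j"] sd[of j] j mk by auto
      show "y1 \<in> A0" by (rule y1)
      show "d (s j) y1 = Suc (d (s (Suc j)) y1)" using s_step True y1 by auto
    qed
  next
    case False
    then have jz: "s j = z" "s (Suc j) = z2" using j s m0 by (auto simp: Suc_diff_1 le_less)
    \<comment> \<open>For the last edge \<open>bb\<close> is of no help, and the change of
      membership is used: if \<open>z\<close> screened \<open>b\<close> from the ball around
      \<open>c'\<close>, both would lie in the same atom seen from \<open>c'\<close>.\<close>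
    have "\<exists>p1\<in>V. d c' p1 \<le> n \<and> z \<notin> interval p1 b"
    proof (rule ccontr)
      assume no: "\<not> ?thesis"
      have "z \<in> atom c' n b"
      proof (rule atomI[OF cV(2) b(1) V(4), of "{z}"])
        fix q assume "q \<in> V" "d c' q \<le> n"
        then show "interval q b \<inter> {z} \<noteq> {} \<and> interval q z \<inter> {z} \<noteq> {}" using no V by (auto simp: interval_def)
      qed auto
      then show False using b(1,4) V(4) atom_trans atom_sym by blast
    qed
    then obtain p1 where p1: "p1 \<in> V" "d c' p1 \<le> n" "z \<notin> interval p1 b" by blast
    have "b \<in> A0" if "d c' z < n" using A_far[of z] that b(4) by auto
    then show ?thesis unfolding jz using trichotomy[OF z(1) b(1,3) p1, of b] b(3) by blast
  qed
  have inB: "{s j, s (Suc j)} \<in> near_ball 3 B0" if j: "j \<le> m - 1" "m - 1 \<le> j + Rw"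
    and h: "(\<exists>i<l. {s j, s (Suc j)} \<in> near_ball 3 {{\<gamma> i, \<gamma> (Suc i)}}) \<or>
      (\<exists>i<n. s j = \<gamma>' i \<and> {s j, s (Suc j)} \<in> near_ball 3 {{\<gamma>' i, \<gamma>' (Suc i)}})" for j
  proof -
    have "\<exists>e\<in>B0. {s j, s (Suc j)} \<in> near_ball 3 {e}"
      using h
    proof
      assume "\<exists>i<l. {s j, s (Suc j)} \<in> near_ball 3 {{\<gamma> i, \<gamma> (Suc i)}}"
      then show ?thesis using B0_first by blast
    next
      assume "\<exists>i<n. s j = \<gamma>' i \<and> {s j, s (Suc j)} \<in> near_ball 3 {{\<gamma>' i, \<gamma>' (Suc i)}}"
      then obtain i where i: "i < n" "s j = \<gamma>' i" "{s j, s (Suc j)} \<in> near_ball 3 {{\<gamma>' i, \<gamma>' (Suc i)}}" by blast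
      have jk: "j \<le> k" using j mk by linarith
      have "n \<le> j + l + 2 * wd + Rw + 1" using j jm(2) unfolding mst_def by linarith
      then have "{\<gamma>' i, \<gamma>' (Suc i)} \<in> B0"
        using B0_second[OF i(1) sV[OF jk]] i(2) sd[OF jk] sV[OF jk] by auto
      then show ?thesis using i by blast
    qed
    then show ?thesis using near_ball_mono'[of _ B0 3] by blast
  qed
  \<comment> \<open>Near the root the start is the first edge, where the third alternative of
    \<open>trichotomy\<close> is excluded by \<open>s 0 = c\<close>. Higher up it is a window on
    three positions below level \<open>m - \<delta>\<close>.\<close>
  have "\<exists>j0\<le>m - 1. m - 1 \<le> j0 + Rw \<and> {s j0, s (Suc j0)} \<in> near_ball 3 B0"
  proof (cases "m - 1 \<le> Rw")
    case True
    have "s 0 = c" using geo_0[OF s(1)] .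
    then have "{s 0, s (Suc 0)} \<in> near_ball 3 B0" using tri[of 0] True by (intro inB) auto
    then show ?thesis using True by (intro exI[of _ 0]) auto
  next
    case False
    define j where "j = m - 1 - (\<delta> + 2 * wd)"
    have jd: "j + \<delta> + 2 * wd = m - 1" using False unfolding j_def Rw_def by linarith
    have "\<exists>j'. j \<le> j' \<and> j' < j + 2 * wd \<and> {s j', s (Suc j')} \<in> near_ball 1 B0"
    proof (rule window3_B0[OF s(1)])
      show "j + 2 * wd \<le> k" using jd mk by linarith
      show "n \<le> j + l + 2 * wd + Rw + 1" using jd jm(2) unfolding mst_def Rw_def by linarith
      fix i assume "i = j \<or> i = j + wd \<or> i = j + 2 * wd"
      then have i: "i + \<delta> \<le> m - 1" using jd by linarith
      then have ik: "i \<le> k" "i \<le> m - 1" using mk by linarith+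
      have "(\<exists>i'\<le>l. d (s i) (\<gamma> i') \<le> 6 * \<delta>) \<or> d c' (s i) \<le> n + 2 * \<delta>"
        by (rule close_mixed[OF V(3) s_in[OF ik(2) bbD] _ p far]) (use i sd[OF ik(1)] in auto)
      then show "(\<exists>i'\<le>l. d (s i) (\<gamma> i') \<le> 6 * \<delta>) \<or> (\<exists>i'\<le>n. d (s i) (\<gamma>' i') \<le> 6 * \<delta>)"
        using close_A[OF y1(2) s_in[OF ik(2) y1(1)]] by blast
    qed
    then obtain j' where j': "j \<le> j'" "j' < j + 2 * wd" "{s j', s (Suc j')} \<in> near_ball 1 B0" by blast
    have "near_ball 1 B0 \<subseteq> near_ball 3 B0" by (rule near_ball_mono[OF B0_E]) simp
    then show ?thesis using j' jd by (intro exI[of _ j']) (auto simp: Rw_def)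
  qed
  then obtain j0 where j0: "j0 \<le> m - 1" "m - 1 \<le> j0 + Rw" "{s j0, s (Suc j0)} \<in> near_ball 3 B0" by blast
  have chain: "{s j, s (Suc j)} \<in> near_ball (3 + 3 * (j - j0)) B0" if "j0 \<le> j" "j \<le> m - 1" for j
    using that
  proof (induction j rule: dec_induct)
    case base
    then show ?case using j0 by simp
  next
    case (step j)
    have IH: "{s j, s (Suc j)} \<in> near_ball (3 + 3 * (j - j0)) B0" using step by auto
    have k: "Suc j \<le> k" using step mk by linarith
    consider "{s (Suc j), s (Suc (Suc j))} \<in> near_ball 3 B0"
      | "{s (Suc j), s (Suc (Suc j))} \<in> near_ball 3 {{s j, s (Suc j)}}"
      using tri[of "Suc j"] inB[of "Suc j"] step j0 edge[of j] k sd[of j] sd[of "Suc j"] by fastforce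
    then show ?case
    proof cases
      case 1
      then show ?thesis using near_ball_mono[OF B0_E, of 3 "3 + 3 * (Suc j - j0)"] by auto
    next
      case 2
      then have "{s (Suc j), s (Suc (Suc j))} \<in> near_ball (3 + 3 * (j - j0) + 3) B0" using near_ball_sing IH by blast
      moreover have "3 + 3 * (j - j0) + 3 = 3 + 3 * (Suc j - j0)" using step by auto
      ultimately show ?thesis by simp
    qed
  qed
  have "{z, z2} \<in> near_ball (3 + 3 * (m - 1 - j0)) B0" using chain[of "m - 1"] j0 s m0 by auto
  moreover have "3 + 3 * (m - 1 - j0) \<le> N0" using j0 unfolding N0_def by linarith
  ultimately have "{z, z2} \<in> near_ball N0 B0" using near_ball_mono[OF B0_E] by blast
  \<comment> \<open>The point \<open>p\<close> is outside the ball of radius \<open>m - 1\<close>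
    around \<open>c\<close> but within \<open>n\<close> of \<open>c'\<close>.\<close>
  moreover have "m \<le> n + l"
  proof -
    have "p \<in> interval p bb" using p V by (auto simp: interval_def)
    then have "m - 1 < d c p" by (rule far)
    moreover have "d c p \<le> l + n" using d_tri[OF cV p(1)] p(2) l by linarith
    ultimately show ?thesis by linarith
  qed
  ultimately show ?thesis using dz2 z by blast
qed

text \<open>At the starting level the guess may become true without any change of slice. An element
  of \<open>A0\<close> in the atom then has a geodesic from \<open>c\<close> that passes near
  \<open>B0\<close> a little above this level; the jump is found as a coarsening of an atom at that
  edge.\<close>

lemma jump_first:
  assumes y: "y \<in> V" and m: "0 < mst" and s: "status c A0 mst mst y"
  shows "\<exists>x x2 y1. {x, x2} \<in> near_ball 1 B0 \<and> d c x2 = Suc (d c x) \<and> y1 \<in> atom c mst y \<and> x2 \<in> interval c y1 \<and> mst \<le> d c x2"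
proof -
  have n: "n = mst + l + 2 * wd" using m unfolding mst_def by linarith
  have "atom c mst y \<inter> A0 \<noteq> {}" using s atom_self[OF y] unfolding status_def by blast
  then obtain y1 where y1: "y1 \<in> atom c mst y" "y1 \<in> A0" by blast
  have V: "y1 \<in> V" using y1 atom_sub by blast
  have far: "mst + 2 * wd \<le> d c y1"
    using A_far[OF y1(2)] d_tri[OF cV(2,1) V] d_sym[OF cV] n l by linarith
  obtain t where t: "geo t (d c y1) c y1" using ex_geo cV V by blast
  have "\<exists>j'. mst \<le> j' \<and> j' < mst + 2 * wd \<and> {t j', t (Suc j')} \<in> near_ball 1 B0"
  proof (rule window3_B0[OF t far])
    show "n \<le> mst + l + 2 * wd + Rw + 1" using n by linarith
    fix i assume "i = mst \<or> i = mst + wd \<or> i = mst + 2 * wd"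
    then have i: "i \<le> mst + 2 * wd" by linarith
    then have ik: "i \<le> d c y1" using far by linarith
    have "d c' (t i) \<le> n + 2 * \<delta>"
      using d_tri[OF cV(2,1) geo_V[OF t ik]] geo_da[OF t ik] d_sym[OF cV] n l i by linarith
    then show "(\<exists>i'\<le>l. d (t i) (\<gamma> i') \<le> 6 * \<delta>) \<or> (\<exists>i'\<le>n. d (t i) (\<gamma>' i') \<le> 6 * \<delta>)"
      using close_A[OF y1(2) geo_interval[OF t ik]] by blast
  qed
  then obtain j where j: "mst \<le> j" "j < mst + 2 * wd" "{t j, t (Suc j)} \<in> near_ball 1 B0" by blast
  have k: "Suc j \<le> d c y1" using j far by linarith
  have "d c (t (Suc j)) = Suc (d c (t j))" "mst \<le> d c (t (Suc j))"
    using geo_da[OF t k] geo_da[OF t, of j] k j by auto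
  then show ?thesis using j(3) y1(1) geo_interval[OF t k] by blast
qed

end

context fine_hyp
begin

definition edge_atoms :: "'v \<Rightarrow> 'v set \<Rightarrow> (nat \<times> 'v set) set" where
  "edge_atoms c g = {(d c x2, atom c (d c x2) y) | x x2 y. g = {x, x2} \<and> d c x2 = Suc (d c x) \<and> y \<in> V \<and> x2 \<in> interval c y}"

lemma edge_atoms_fin: assumes "c \<in> V" "g \<in> E" shows "finite (edge_atoms c g) \<and> card (edge_atoms c g) \<le> Ka"
proof (cases "edge_atoms c g = {}")
  case False
  then obtain x x2 where x: "g = {x, x2}" "d c x2 = Suc (d c x)" by (auto simp: edge_atoms_def)
  let ?S = "{atom c (d c x2) y | y. y \<in> V \<and> x2 \<in> interval c y}"
  have S: "finite ?S \<and> card ?S \<le> Ka" using atoms_at_edge[OF assms(1) _ x(2) refl] assms(2) x(1) by auto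
  have sub: "edge_atoms c g \<subseteq> Pair (d c x2) ` ?S"
  proof
    fix t assume "t \<in> edge_atoms c g"
    then obtain u u2 y where u: "g = {u, u2}" "d c u2 = Suc (d c u)" "y \<in> V" "u2 \<in> interval c y"
      "t = (d c u2, atom c (d c u2) y)" by (auto simp: edge_atoms_def)
    then have "u2 = x2" using x by (auto simp: doubleton_eq_iff)
    then show "t \<in> Pair (d c x2) ` ?S" using u by auto
  qed
  show ?thesis using S card_mono[OF _ sub] card_image_le[of ?S "Pair (d c x2)"] finite_subset[OF sub]
    by (meson finite_imageI le_trans)
qed auto

lemma edge_atoms_Union:
  assumes "c \<in> V" "finite B" "B \<subseteq> E"
  shows "finite (\<Union>g\<in>near_ball k B. edge_atoms c g) \<and> card (\<Union>g\<in>near_ball k B. edge_atoms c g) \<le> card B * Kn ^ k * Ka"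
proof -
  have t: "finite (edge_atoms c g) \<and> card (edge_atoms c g) \<le> Ka" if "g \<in> near_ball k B" for g
    using edge_atoms_fin[OF assms(1)] that near_ball_E[OF assms(3)] by blast
  have f: "finite (near_ball k B)" "card (near_ball k B) \<le> card B * Kn ^ k" using near_ball_fin[OF assms(2)] by auto
  have "card (\<Union>g\<in>near_ball k B. edge_atoms c g) \<le> (\<Sum>g\<in>near_ball k B. card (edge_atoms c g))" using f(1) by (rule card_UN_le)
  also have "\<dots> \<le> of_nat (card (near_ball k B)) * Ka" by (rule sum_bounded_above) (use t in auto)
  also have "\<dots> \<le> card B * Kn ^ k * Ka" using f(2) by simp
  finally show ?thesis using f(1) t by blast
qed

definition KJ :: nat where "KJ = 1 + 2 * ((3 + C0) * Kn ^ N0 * Ka)"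

end

context base_change
begin

text \<open>Jumps occur at level 0, where the atom is \<open>V\<close>, at level \<open>mst\<close>,
  and above it; the three summands of \<open>KJ\<close> bound these families. Each edge near
  \<open>B0\<close> carries at most \<open>Ka\<close> atoms, and \<open>B0\<close> is linear in
  \<open>l\<close>.\<close>

lemma jumps_fin: "finite (jumps c A0 mst) \<and> card (jumps c A0 mst) \<le> KJ * (l + 1)"
proof -
  let ?U = "\<lambda>k. \<Union>g\<in>near_ball k B0. edge_atoms c g"
  \<comment> \<open>Sends an atom to the atom of level \<open>mst\<close> containing it.\<close>
  let ?co = "\<lambda>t. (mst, atom c mst (SOME y. y \<in> snd t))"
  have sub: "jumps c A0 mst \<subseteq> {(0, V)} \<union> ?U N0 \<union> ?co ` ?U 1"
  proof
    fix t assume "t \<in> jumps c A0 mst"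
    then obtain m y where t: "t = (m, atom c m y)" "y \<in> V" "m \<le> d c y" "jump c A0 mst m y"
      by (auto simp: jumps_def)
    consider "m < mst" | "m = 0" | "m = mst" "0 < m" | "mst < m" by linarith
    then show "t \<in> {(0, V)} \<union> ?U N0 \<union> ?co ` ?U 1"
    proof cases
      case 1
      then show ?thesis using t(4) by (auto simp: jump_def status_def)
    next
      case 2
      then show ?thesis using t atom_0[OF cV(1)] by auto
    next
      case 3
      then have "status c A0 mst mst y" using t(4) by (auto simp: jump_def status_def)
      then obtain x x2 y1 where x: "{x, x2} \<in> near_ball 1 B0" "d c x2 = Suc (d c x)" "y1 \<in> atom c mst y"
        "x2 \<in> interval c y1" "mst \<le> d c x2" using jump_first[OF t(2)] 3 by metis
      let ?D = "atom c (d c x2) y1"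
      have y1: "y1 \<in> V" using x atom_sub by blast
      have "(d c x2, ?D) \<in> ?U 1" using x y1 unfolding edge_atoms_def by blast
      moreover have "?co (d c x2, ?D) = t"
      proof -
        have "(SOME y. y \<in> ?D) \<in> ?D" using atom_self[OF y1] by (rule someI)
        then have "(SOME y. y \<in> ?D) \<in> atom c mst y1" using atom_mono[OF x(5)] by blast
        then have "(SOME y. y \<in> ?D) \<in> atom c mst y" using x(3) atom_trans by blast
        then show ?thesis using atom_eq[OF t(2)] t(1) 3 by auto
      qed
      ultimately have "t \<in> ?co ` ?U 1" by (rule rev_image_eqI[OF _ sym])
      then show ?thesis by (rule UnI2)
    next
      case 4
      obtain z z2 where "{z, z2} \<in> near_ball N0 B0" "d c z2 = Suc (d c z)" "d c z2 = m" "z2 \<in> interval c y"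
        using jump_edge[OF t(2-4) 4] by blast
      then have "t \<in> ?U N0" using t unfolding edge_atoms_def by blast
      then show ?thesis by blast
    qed
  qed
  let ?b = "card B0 * Kn ^ N0 * Ka"
  have U: "finite (?U N0)" "card (?U N0) \<le> ?b" "finite (?U 1)" "card (?U 1) \<le> card B0 * Kn ^ 1 * Ka"
    using edge_atoms_Union[OF cV(1) B0_fin(1) B0_E, of N0] edge_atoms_Union[OF cV(1) B0_fin(1) B0_E, of 1] by auto
  have "Kn ^ 1 \<le> Kn ^ N0" using Kn(1) by (intro power_increasing) (auto simp: N0_def)
  then have "card B0 * Kn ^ 1 * Ka \<le> ?b" by (intro mult_right_mono mult_left_mono) auto
  then have "card (?co ` ?U 1) \<le> ?b" using card_image_le[OF U(3), of ?co] U(4) by linarith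
  moreover have "card ({(0, V)} \<union> ?U N0) \<le> 1 + ?b"
    using card_Un_le[of "{(0, V)}" "?U N0"] U(2) by simp
  ultimately have c: "card ({(0, V)} \<union> ?U N0 \<union> ?co ` ?U 1) \<le> 1 + 2 * ?b"
    using card_Un_le[of "{(0, V)} \<union> ?U N0" "?co ` ?U 1"] by linarith
  have "card B0 \<le> (3 + C0) * (l + 1)" using B0_fin(2) by (simp add: algebra_simps)
  then have "?b \<le> (3 + C0) * (l + 1) * Kn ^ N0 * Ka" by (intro mult_right_mono) auto
  then have "1 + 2 * ?b \<le> KJ * (l + 1)" unfolding KJ_def by (simp add: algebra_simps)
  moreover have "finite ({(0, V)} \<union> ?U N0 \<union> ?co ` ?U 1)" using U by blast
  ultimately show ?thesis using sub c card_mono[OF _ sub] finite_subset[OF sub] by (meson le_trans)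
qed

lemma jumps_level:
  assumes "(m, D) \<in> jumps c A0 mst" shows "m \<le> n + l \<and> n \<le> m + l + 2 * wd"
proof -
  obtain y where y: "y \<in> V" "m \<le> d c y" "jump c A0 mst m y" using assms by (auto simp: jumps_def)
  have ge: "mst \<le> m" using y(3) by (auto simp: jump_def status_def)
  have "m \<le> n + l"
  proof (cases "mst < m")
    case True then show ?thesis using jump_edge[OF y True] by blast
  next
    case False
    then have "m = mst" using ge by simp
    then show ?thesis unfolding mst_def by simp
  qed
  then show ?thesis using ge unfolding mst_def by linarith
qed

end

section \<open>Indicators as signed sums over the jumps\<close>

context conn_graph
begin

text \<open>This bounds how many atoms of one level seen from \<open>c'\<close> use a given atom
  seen from \<open>c\<close>. A jump requires the guess to be true at level \<open>m\<close> or
  \<open>m - 1\<close>, so the target contains \<open>y\<close> or the vertex picked from one of the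
  two slices, and atoms of one level are disjoint.\<close>

lemma jump_targets:
  assumes c: "c \<in> V" "c' \<in> V" and y: "y \<in> V" "m \<le> d c y"
  obtains T where "finite T" "card T \<le> 3"
    "\<And>y0 ms. y0 \<in> V \<Longrightarrow> jump c (atom c' n y0) ms m y \<Longrightarrow> atom c' n y0 \<in> T"
proof -
  obtain z where z: "z \<in> slice c m y" using slice_ne[OF c(1) y] by blast
  have "slice c (m - 1) y \<noteq> {}" by (rule slice_ne) (use c y in auto)
  then obtain z1 where z1: "z1 \<in> slice c (m - 1) y" by blast
  let ?T = "{atom c' n y, atom c' n z, atom c' n z1}"
  have "atom c' n y0 \<in> ?T" if y0: "y0 \<in> V" and j: "jump c (atom c' n y0) ms m y" for y0 ms
  proof -
    let ?A = "atom c' n y0"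
    have eq: "u \<in> ?A \<Longrightarrow> atom c' n u = ?A" for u using atom_eq[OF y0] by blast
    have "y \<in> ?A \<or> z \<in> ?A \<or> z1 \<in> ?A"
    proof (cases "status c ?A ms m y")
      case True
      then show ?thesis using atom_self[OF y(1)] z unfolding status_def by blast
    next
      case False
      then have s: "status c ?A ms (m - 1) y" using j by (auto simp: jump_def)
      have "\<not> atom c (m - 1) y \<subseteq> ?A"
      proof
        assume "atom c (m - 1) y \<subseteq> ?A"
        then have "atom c m y \<subseteq> ?A" using atom_mono[of "m - 1" m c y] by auto
        then show False using False s unfolding status_def by auto
      qed
      then show ?thesis using s z1 unfolding status_def by blast
    qed
    then show ?thesis using eq by (metis insertCI)
  qed
  moreover have "card ?T \<le> 3" by (simp add: card_insert_if)
  ultimately show thesis using that[of ?T] by auto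
qed

definition status_diff :: "'v \<Rightarrow> 'v set \<Rightarrow> nat \<Rightarrow> nat \<Rightarrow> 'v \<Rightarrow> complex" where
  "status_diff c A ms m y = of_bool (status c A ms m y) - of_bool (0 < m \<and> status c A ms (m - 1) y)"

lemma status_diff_sum: "(\<Sum>m\<le>k. status_diff c A ms m y) = of_bool (status c A ms k y)"
  by (induction k) (auto simp: status_diff_def)

lemma status_diff_0: "\<not> jump c A ms m y \<Longrightarrow> status_diff c A ms m y = 0"
  by (auto simp: status_diff_def jump_def)

lemma status_diff_norm: "cmod (status_diff c A ms m y) \<le> 1"
  by (auto simp: status_diff_def)

text \<open>The coefficient belongs to the atom; the choice of the vertex is harmless by
  \<open>jump_coeff_eq\<close>.\<close>

definition jump_coeff :: "'v \<Rightarrow> 'v set \<Rightarrow> nat \<Rightarrow> nat \<times> 'v set \<Rightarrow> complex" where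
  "jump_coeff c A ms t = status_diff c A ms (fst t) (SOME y. y \<in> V \<and> snd t = atom c (fst t) y)"

lemma jump_coeff_norm: "cmod (jump_coeff c A ms t) \<le> 1"
  by (simp add: jump_coeff_def status_diff_norm)

lemma jump_coeff_eq: assumes "c \<in> V" "y \<in> V" shows "jump_coeff c A ms (m, atom c m y) = status_diff c A ms m y"
proof -
  define u where "u = (SOME u. u \<in> V \<and> atom c m y = atom c m u)"
  have "u \<in> V \<and> atom c m y = atom c m u" unfolding u_def by (rule someI[of _ y]) (use assms in auto)
  then have "u \<in> atom c m y" using atom_self by blast
  then have "status_diff c A ms m u = status_diff c A ms m y"
    unfolding status_diff_def using status_eq[OF assms] status_pred_eq[OF assms] by simp
  then show ?thesis by (simp add: jump_coeff_def u_def)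
qed

lemma jumps_at:
  assumes c: "c \<in> V" and y: "y \<in> V" and M: "M \<subseteq> {..d c y}" and fin: "finite (jumps c A ms)"
  shows "(\<Sum>t\<in>{t \<in> jumps c A ms. fst t \<in> M}. jump_coeff c A ms t * of_bool (y \<in> snd t)) = (\<Sum>m\<in>M. status_diff c A ms m y)"
proof -
  have fM: "finite M" using M finite_subset by blast
  let ?M = "{m \<in> M. jump c A ms m y}"
  let ?f = "\<lambda>m. (m, atom c m y)"
  have "(\<Sum>t\<in>{t \<in> jumps c A ms. fst t \<in> M}. jump_coeff c A ms t * of_bool (y \<in> snd t)) =
      (\<Sum>t\<in>?f ` ?M. jump_coeff c A ms t * of_bool (y \<in> snd t))"
  proof (rule sum.mono_neutral_right)
    show "finite {t \<in> jumps c A ms. fst t \<in> M}" using fin by auto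
    show "?f ` ?M \<subseteq> {t \<in> jumps c A ms. fst t \<in> M}" using M y by (auto simp: jumps_def)
    show "\<forall>t\<in>{t \<in> jumps c A ms. fst t \<in> M} - ?f ` ?M. jump_coeff c A ms t * of_bool (y \<in> snd t) = 0"
    proof
      fix t assume t: "t \<in> {t \<in> jumps c A ms. fst t \<in> M} - ?f ` ?M"
      then obtain m u where u: "t = (m, atom c m u)" "u \<in> V" "m \<le> d c u" "jump c A ms m u" "m \<in> M"
        by (auto simp: jumps_def)
      have "y \<notin> atom c m u"
      proof
        assume yu: "y \<in> atom c m u"
        then have "t = ?f m" "jump c A ms m y" using atom_eq u jump_eq[OF c u(2) yu] by auto
        then show False using t u by auto
      qed
      then show "jump_coeff c A ms t * of_bool (y \<in> snd t) = 0" using u by simp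
    qed
  qed
  also have "\<dots> = (\<Sum>m\<in>?M. status_diff c A ms m y)"
    by (subst sum.reindex) (auto simp: inj_on_def jump_coeff_eq[OF c y] atom_self[OF y])
  also have "\<dots> = (\<Sum>m\<in>M. status_diff c A ms m y)"
    using fM by (intro sum.mono_neutral_left) (auto simp: status_diff_0)
  finally show ?thesis .
qed

lemma status_top: assumes "c \<in> V" "y \<in> V" shows "status c A ms (d c y) y \<longleftrightarrow> ms \<le> d c y \<and> y \<in> A"
  using slice_top[OF assms] atom_self[OF assms(2), of c "d c y"] unfolding status_def by auto

lemma levels_fst: "c \<in> V \<Longrightarrow> t \<in> levels c \<Longrightarrow> y \<in> snd t \<Longrightarrow> fst t \<le> d c y"
  using atom_far by (auto simp: levels_def)

text \<open>Only the atoms of \<open>y\<close> itself contribute, one for each level, and the sum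
  telescopes to the guess at level \<open>d c y\<close>. There the slice is \<open>y\<close> alone,
  so the guess is the truth.\<close>

lemma jumps_indicator:
  assumes c: "c \<in> V" and y: "y \<in> V" and fin: "finite (jumps c A ms)" and ms: "y \<in> A \<Longrightarrow> ms \<le> d c y"
  shows "(\<Sum>t\<in>jumps c A ms. jump_coeff c A ms t * of_bool (y \<in> snd t)) = of_bool (y \<in> A)"
proof -
  have "(\<Sum>t\<in>jumps c A ms. jump_coeff c A ms t * of_bool (y \<in> snd t)) =
     (\<Sum>t\<in>{t \<in> jumps c A ms. fst t \<in> {..d c y}}. jump_coeff c A ms t * of_bool (y \<in> snd t))"
  proof (rule sum.mono_neutral_right[OF fin])
    show "\<forall>t\<in>jumps c A ms - {t \<in> jumps c A ms. fst t \<in> {..d c y}}. jump_coeff c A ms t * of_bool (y \<in> snd t) = 0"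
    proof
      fix t assume t: "t \<in> jumps c A ms - {t \<in> jumps c A ms. fst t \<in> {..d c y}}"
      then have "y \<notin> snd t" using levels_fst[OF c, of t y] jumps_sub by auto
      then show "jump_coeff c A ms t * of_bool (y \<in> snd t) = 0" by simp
    qed
  qed auto
  also have "\<dots> = (\<Sum>m\<in>{..d c y}. status_diff c A ms m y)" by (rule jumps_at[OF c y _ fin]) auto
  also have "\<dots> = of_bool (status c A ms (d c y) y)" by (rule status_diff_sum)
  finally show ?thesis using status_top[OF c y] ms by auto
qed

text \<open>The same telescoping started at level \<open>k\<close>. It expands the product of two
  indicators, of \<open>A\<close> and of an atom seen from \<open>c\<close>, by atoms of level at
  least \<open>k\<close>; the guess at level \<open>k\<close> is the initial value.\<close>

lemma jumps_indicator_within: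
  assumes c: "c \<in> V" and y: "y \<in> V" and fin: "finite (jumps c A ms)" and ms: "y \<in> A \<Longrightarrow> ms \<le> d c y"
    and u: "u \<in> V" "k \<le> d c u"
  shows "(\<Sum>t\<in>{t \<in> jumps c A ms. k < fst t \<and> snd t \<subseteq> atom c k u}. jump_coeff c A ms t * of_bool (y \<in> snd t)) +
     of_bool (status c A ms k u) * of_bool (y \<in> atom c k u) = (of_bool (y \<in> A) * of_bool (y \<in> atom c k u) :: complex)"
proof (cases "y \<in> atom c k u")
  case False
  then have "(\<Sum>t\<in>{t \<in> jumps c A ms. k < fst t \<and> snd t \<subseteq> atom c k u}. jump_coeff c A ms t * of_bool (y \<in> snd t)) = 0"
    by (intro sum.neutral) auto
  then show ?thesis using False by simp
next
  case True
  have ky: "k \<le> d c y" using atom_far[OF c u(1) True u(2)] .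
  have sub: "snd t \<subseteq> atom c k u" if t: "t \<in> jumps c A ms" "k < fst t" "y \<in> snd t" for t
  proof -
    obtain m v where v: "t = (m, atom c m v)" "v \<in> V" using t by (auto simp: jumps_def)
    then have "snd t = atom c m y" using t atom_eq by auto
    then show ?thesis using atom_mono[of k m c y] atom_eq[OF u(1) True] t v by auto
  qed
  have "(\<Sum>t\<in>{t \<in> jumps c A ms. k < fst t \<and> snd t \<subseteq> atom c k u}. jump_coeff c A ms t * of_bool (y \<in> snd t)) =
     (\<Sum>t\<in>{t \<in> jumps c A ms. fst t \<in> {k<..d c y}}. jump_coeff c A ms t * of_bool (y \<in> snd t))"
  proof (rule sum.mono_neutral_cong)
    fix t assume t: "t \<in> {t \<in> jumps c A ms. fst t \<in> {k<..d c y}} - {t \<in> jumps c A ms. k < fst t \<and> snd t \<subseteq> atom c k u}"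
    then have "y \<notin> snd t" using sub[of t] by auto
    then show "jump_coeff c A ms t * of_bool (y \<in> snd t) = 0" by simp
  next
    fix t assume t: "t \<in> {t \<in> jumps c A ms. k < fst t \<and> snd t \<subseteq> atom c k u} - {t \<in> jumps c A ms. fst t \<in> {k<..d c y}}"
    then have "y \<notin> snd t" using levels_fst[OF c, of t y] jumps_sub by auto
    then show "jump_coeff c A ms t * of_bool (y \<in> snd t) = 0" by simp
  qed (use fin in auto)
  also have "\<dots> = (\<Sum>m\<in>{k<..d c y}. status_diff c A ms m y)" by (rule jumps_at[OF c y _ fin]) auto
  also have "\<dots> = (\<Sum>m\<le>d c y. status_diff c A ms m y) - (\<Sum>m\<le>k. status_diff c A ms m y)"
  proof -
    have "{..d c y} = {..k} \<union> {k<..d c y}" using ky by auto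
    then show ?thesis by (simp add: sum.union_disjoint disjoint_iff)
  qed
  also have "\<dots> = of_bool (status c A ms (d c y) y) - of_bool (status c A ms k u)"
    using status_eq[OF c u(1) True] by (simp add: status_diff_sum)
  finally show ?thesis using True status_top[OF c y] ms by auto
qed

end

section \<open>Functionals on the span of the atoms\<close>

context conn_graph
begin

definition ind :: "'v set \<Rightarrow> 'v \<Rightarrow> complex" where "ind D x = of_bool (x \<in> D)"

definition allatoms :: "'v set set" where
  "allatoms = {atom c m y | c m y. c \<in> V \<and> y \<in> V \<and> m \<le> d c y}"

inductive_set atom_span :: "('v \<Rightarrow> complex) set" where
  atom_span_0: "(\<lambda>_. 0) \<in> atom_span"
| atom_span_step: "\<phi> \<in> atom_span \<Longrightarrow> D \<in> allatoms \<Longrightarrow> (\<lambda>x. \<phi> x + a * ind D x) \<in> atom_span"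

lemma atom_span_add: "\<phi> \<in> atom_span \<Longrightarrow> \<psi> \<in> atom_span \<Longrightarrow> (\<lambda>x. \<phi> x + \<psi> x) \<in> atom_span"
proof (induction rule: atom_span.induct)
  case (atom_span_step \<phi> D a)
  then show ?case using atom_span.atom_span_step[of "\<lambda>x. \<phi> x + \<psi> x" D a] by (simp add: ac_simps)
qed simp

lemma atom_span_scale: "\<phi> \<in> atom_span \<Longrightarrow> (\<lambda>x. b * \<phi> x) \<in> atom_span"
proof (induction rule: atom_span.induct)
  case (atom_span_step \<phi> D a)
  then show ?case using atom_span.atom_span_step[of "\<lambda>x. b * \<phi> x" D "b * a"] by (simp add: algebra_simps)
qed (simp add: atom_span_0)

lemma atom_span_ind: "D \<in> allatoms \<Longrightarrow> ind D \<in> atom_span"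
  using atom_span_step[OF atom_span_0, of D 1] by simp

lemma atom_span_sum: "finite T \<Longrightarrow> (\<And>t. t \<in> T \<Longrightarrow> \<phi> t \<in> atom_span) \<Longrightarrow> (\<lambda>x. \<Sum>t\<in>T. \<phi> t x) \<in> atom_span"
  by (induction T rule: finite_induct) (auto intro: atom_span_0 atom_span_add)

lemma levels_allatoms: "c \<in> V \<Longrightarrow> t \<in> levels c \<Longrightarrow> snd t \<in> allatoms"
  unfolding levels_def allatoms_def by fastforce

text \<open>The value 0 off the span lets functionals that agree on the span be equal as
  functions.\<close>

definition functional :: "(('v \<Rightarrow> complex) \<Rightarrow> complex) \<Rightarrow> bool" where
  "functional F \<longleftrightarrow> (\<forall>\<phi>\<in>atom_span. \<forall>\<psi>\<in>atom_span. F (\<lambda>x. \<phi> x + \<psi> x) = F \<phi> + F \<psi>) \<and>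
     (\<forall>a. \<forall>\<phi>\<in>atom_span. F (\<lambda>x. a * \<phi> x) = a * F \<phi>) \<and> (\<forall>\<phi>. \<phi> \<notin> atom_span \<longrightarrow> F \<phi> = 0)"

lemma functional_add: "functional F \<Longrightarrow> \<phi> \<in> atom_span \<Longrightarrow> \<psi> \<in> atom_span \<Longrightarrow> F (\<lambda>x. \<phi> x + \<psi> x) = F \<phi> + F \<psi>"
  and functional_scale: "functional F \<Longrightarrow> \<phi> \<in> atom_span \<Longrightarrow> F (\<lambda>x. a * \<phi> x) = a * F \<phi>"
  by (auto simp: functional_def)

lemma functional_0: "functional F \<Longrightarrow> F (\<lambda>_. 0) = 0"
  using functional_scale[OF _ atom_span_0, of F 0] by simp

lemma functional_sum:
  assumes "functional F" "finite T" "\<And>t. t \<in> T \<Longrightarrow> \<phi> t \<in> atom_span"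
  shows "F (\<lambda>x. \<Sum>t\<in>T. \<phi> t x) = (\<Sum>t\<in>T. F (\<phi> t))"
  using assms(2,3)
proof (induction T rule: finite_induct)
  case (insert t T)
  then show ?case using functional_add[OF assms(1), of "\<phi> t" "\<lambda>x. \<Sum>t\<in>T. \<phi> t x"] atom_span_sum[of T \<phi>] by auto
qed (simp add: functional_0[OF assms(1)])

lemma functional_sum_ind:
  assumes "functional F" "finite T" "\<And>t. t \<in> T \<Longrightarrow> D t \<in> allatoms"
  shows "F (\<lambda>x. \<Sum>t\<in>T. a t * ind (D t) x) = (\<Sum>t\<in>T. a t * F (ind (D t)))"
  using functional_sum[OF assms(1,2), of "\<lambda>t x. a t * ind (D t) x"] assms functional_scale[OF assms(1) atom_span_ind] atom_span_scale[OF atom_span_ind]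
  by auto

text \<open>The exponent has to beat the cubic number of atoms in the estimate of the total mass below.\<close>
definition wt :: "nat \<Rightarrow> real" where "wt m = (real m + 1) ^ 8"

lemma wt_ge1: "wt m \<ge> 1" by (simp add: wt_def one_le_power)

definition sq :: "(('v \<Rightarrow> complex) \<Rightarrow> complex) \<Rightarrow> nat \<times> 'v set \<Rightarrow> real" where
  "sq F t = wt (fst t) * (cmod (F (ind (snd t))))\<^sup>2"

lemma sq_ge0: "sq F t \<ge> 0"
  using wt_ge1[of "fst t"] by (simp add: sq_def)

end

section \<open>Change of base point for functionals and their norms\<close>

context fine_hyp
begin

lemma level_jumps:
  assumes c: "c \<in> V" "c' \<in> V" and nA: "(n, A) \<in> levels c'"
  defines "J \<equiv> jumps c A (n - (d c c' + 2 * wd))"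
  shows "finite J" "card J \<le> KJ * (d c c' + 1)"
    "\<And>m D. (m, D) \<in> J \<Longrightarrow> m \<le> n + d c c' \<and> n \<le> m + d c c' + 2 * wd"
    "\<And>y. y \<in> A \<Longrightarrow> y \<in> V \<and> n - (d c c' + 2 * wd) \<le> d c y"
    "ind A = (\<lambda>x. \<Sum>t\<in>J. jump_coeff c A (n - (d c c' + 2 * wd)) t * ind (snd t) x)"
proof -
  obtain y0 where y0: "y0 \<in> V" "n \<le> d c' y0" "A = atom c' n y0" using nA by (auto simp: levels_def)
  obtain s where s: "geo s (d c' y0) c' y0" using ex_geo c y0 by blast
  note yA = y0(3)
  have z: "s n \<in> interval c' y0" "d c' (s n) = n" using geo_interval[OF s] geo_da[OF s] y0 by auto
  have zV: "s n \<in> V" using z by (auto simp: interval_def)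
  obtain g where g: "geo g (d c c') c c'" using ex_geo c by blast
  obtain g' where g': "geo g' n c' (s n)" using ex_geo[OF c(2) zV] z by auto
  interpret base_change V E \<delta> c c' y0 "s n" n "d c c'" g g'
    using c y0 z g g' by unfold_locales auto
  have J: "J = jumps c A0 mst" unfolding J_def yA mst_def ..
  show fin: "finite J" and "card J \<le> KJ * (d c c' + 1)" using jumps_fin unfolding J by auto
  show "\<And>m D. (m, D) \<in> J \<Longrightarrow> m \<le> n + d c c' \<and> n \<le> m + d c c' + 2 * wd"
    using jumps_level unfolding J by auto
  show far: "y \<in> V \<and> n - (d c c' + 2 * wd) \<le> d c y" if "y \<in> A" for y
  proof -
    have y: "y \<in> V" "n \<le> d c' y" using that yA atom_sub A_far by auto
    then show ?thesis using d_tri[OF c(2,1) y(1)] d_sym[OF c] by linarith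
  qed
  show "ind A = (\<lambda>x. \<Sum>t\<in>J. jump_coeff c A (n - (d c c' + 2 * wd)) t * ind (snd t) x)"
  proof
    fix x
    show "ind A x = (\<Sum>t\<in>J. jump_coeff c A (n - (d c c' + 2 * wd)) t * ind (snd t) x)"
    proof (cases "x \<in> V")
      case True
      have "(\<Sum>t\<in>J. jump_coeff c A (n - (d c c' + 2 * wd)) t * of_bool (x \<in> snd t)) = of_bool (x \<in> A)"
        unfolding J_def using fin far by (intro jumps_indicator[OF c(1) True]) (auto simp: J_def)
      then show ?thesis by (simp add: ind_def)
    next
      case False
      have "x \<notin> snd t" if t: "t \<in> J" for t
      proof -
        obtain m y where "t = (m, atom c m y)" using t by (auto simp: J_def jumps_def)
        then show ?thesis using False atom_sub[of c m y] by auto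
      qed
      moreover have "x \<notin> A" using False atom_sub yA by auto
      ultimately show ?thesis by (simp add: ind_def)
    qed
  qed
qed

lemma level_expand:
  assumes "c \<in> V" "c' \<in> V" "(n, A) \<in> levels c'" "functional F"
  defines "J \<equiv> jumps c A (n - (d c c' + 2 * wd))"
  shows "F (ind A) = (\<Sum>t\<in>J. jump_coeff c A (n - (d c c' + 2 * wd)) t * F (ind (snd t)))"
proof -
  note L = level_jumps[OF assms(1-3), folded J_def]
  have "t \<in> J \<Longrightarrow> snd t \<in> allatoms" for t
    using levels_allatoms[OF assms(1)] jumps_sub unfolding J_def by blast
  then show ?thesis by (subst L(5), intro functional_sum_ind[OF assms(4) L(1)]) auto
qed

text \<open>One finite set and one family of coefficients serve all functionals; hence values on the
  atoms seen from a single vertex determine a functional, and their convergence carries over to the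
  whole span.\<close>

lemma atom_span_expand:
  assumes c: "c \<in> V" and "\<phi> \<in> atom_span"
  shows "\<exists>T a. finite T \<and> T \<subseteq> levels c \<and> (\<forall>F. functional F \<longrightarrow> F \<phi> = (\<Sum>t\<in>T. a t * F (ind (snd t))))"
  using assms(2)
proof (induction rule: atom_span.induct)
  case atom_span_0
  show ?case by (intro exI[of _ "{}"]) (auto simp: functional_0)
next
  case (atom_span_step \<phi> D b)
  then obtain T a where T: "finite T" "T \<subseteq> levels c" "\<And>F. functional F \<Longrightarrow> F \<phi> = (\<Sum>t\<in>T. a t * F (ind (snd t)))" by blast
  obtain c' n y where D: "c' \<in> V" "(n, D) \<in> levels c'"
    using atom_span_step(2) unfolding allatoms_def levels_def by blast
  define J where "J = jumps c D (n - (d c c' + 2 * wd))"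
  define j where "j = jump_coeff c D (n - (d c c' + 2 * wd))"
  have J: "finite J" "J \<subseteq> levels c" using level_jumps(1)[OF c D] jumps_sub unfolding J_def by auto
  let ?a = "\<lambda>t. (if t \<in> T then a t else 0) + b * (if t \<in> J then j t else 0)"
  have "F (\<lambda>x. \<phi> x + b * ind D x) = (\<Sum>t\<in>T \<union> J. ?a t * F (ind (snd t)))" if F: "functional F" for F
  proof -
    have "F (\<lambda>x. \<phi> x + b * ind D x) = F \<phi> + b * F (ind D)"
      using functional_add[OF F atom_span_step(1) atom_span_scale[OF atom_span_ind[OF atom_span_step(2)]]] functional_scale[OF F atom_span_ind[OF atom_span_step(2)]] by simp
    also have "F \<phi> = (\<Sum>t\<in>T \<union> J. (if t \<in> T then a t else 0) * F (ind (snd t)))"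
      unfolding T(3)[OF F] using T(1) J(1) by (intro sum.mono_neutral_cong_left) auto
    also have "F (ind D) = (\<Sum>t\<in>T \<union> J. (if t \<in> J then j t else 0) * F (ind (snd t)))"
      unfolding level_expand[OF c D F] J_def[symmetric] j_def[symmetric] using T(1) J(1)
      by (intro sum.mono_neutral_cong_left) auto
    finally show ?thesis by (simp add: sum_distrib_left sum.distrib algebra_simps)
  qed
  then show ?case using T J by (intro exI[of _ "T \<union> J"] exI[of _ ?a]) auto
qed

lemma functional_eq:
  assumes "c \<in> V" "functional F" "functional F'" "\<And>t. t \<in> levels c \<Longrightarrow> F (ind (snd t)) = F' (ind (snd t))"
  shows "F = F'"
proof
  fix \<phi>
  show "F \<phi> = F' \<phi>"
  proof (cases "\<phi> \<in> atom_span")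
    case True
    obtain T a where T: "finite T" "T \<subseteq> levels c" "\<And>F. functional F \<Longrightarrow> F \<phi> = (\<Sum>t\<in>T. a t * F (ind (snd t)))"
      using atom_span_expand[OF assms(1) True] by blast
    show ?thesis unfolding T(3)[OF assms(2)] T(3)[OF assms(3)] using T(2) assms(4) by (intro sum.cong) auto
  qed (use assms in \<open>auto simp: functional_def\<close>)
qed

lemma functional_limit:
  assumes c: "c \<in> V" and F: "\<And>k. functional (F k)"
    and lim: "\<And>t. t \<in> levels c \<Longrightarrow> (\<lambda>k. F k (ind (snd t))) \<longlonglongrightarrow> x t"
  shows "\<exists>G. functional G \<and> (\<forall>t\<in>levels c. G (ind (snd t)) = x t)"
proof -
  have cv: "convergent (\<lambda>k. F k \<phi>)" if \<phi>: "\<phi> \<in> atom_span" for \<phi>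
  proof -
    obtain T a where T: "finite T" "T \<subseteq> levels c" "\<And>F. functional F \<Longrightarrow> F \<phi> = (\<Sum>t\<in>T. a t * F (ind (snd t)))"
      using atom_span_expand[OF c \<phi>] by blast
    have "(\<lambda>k. F k \<phi>) \<longlonglongrightarrow> (\<Sum>t\<in>T. a t * x t)"
      unfolding T(3)[OF F] using T(2) lim by (intro tendsto_sum tendsto_mult tendsto_const) auto
    then show ?thesis by (auto simp: convergent_def)
  qed
  define G where "G = (\<lambda>\<phi>. if \<phi> \<in> atom_span then lim (\<lambda>k. F k \<phi>) else 0)"
  have G: "(\<lambda>k. F k \<phi>) \<longlonglongrightarrow> G \<phi>" if "\<phi> \<in> atom_span" for \<phi>
    using cv[OF that] that by (simp add: G_def convergent_LIMSEQ_iff)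
  have "functional G" unfolding functional_def
  proof (intro conjI ballI allI impI)
    fix \<phi> \<psi> assume p: "\<phi> \<in> atom_span" "\<psi> \<in> atom_span"
    have "(\<lambda>k. F k (\<lambda>x. \<phi> x + \<psi> x)) \<longlonglongrightarrow> G \<phi> + G \<psi>"
      using functional_add[OF F p] tendsto_add[OF G[OF p(1)] G[OF p(2)]] by simp
    then show "G (\<lambda>x. \<phi> x + \<psi> x) = G \<phi> + G \<psi>" using G[OF atom_span_add[OF p]] LIMSEQ_unique by blast
  next
    fix a \<phi> assume p: "\<phi> \<in> atom_span"
    have "(\<lambda>k. F k (\<lambda>x. a * \<phi> x)) \<longlonglongrightarrow> a * G \<phi>"
      using functional_scale[OF F p] tendsto_mult[OF tendsto_const G[OF p]] by simp
    then show "G (\<lambda>x. a * \<phi> x) = a * G \<phi>" using G[OF atom_span_scale[OF p]] LIMSEQ_unique by blast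
  qed (auto simp: G_def)
  moreover have "G (ind (snd t)) = x t" if "t \<in> levels c" for t
    using G[OF atom_span_ind[OF levels_allatoms[OF c that]]] lim[OF that] LIMSEQ_unique by blast
  ultimately show ?thesis by blast
qed

definition KB :: real where "KB = 3 * real (2 * wd + 3) ^ 9 * real KJ"

text \<open>Cauchy-Schwarz over \<open>O(l)\<close> jumps, comparison of the weights by
  \<open>q\<close>, and double counting with multiplicity \<open>M\<close>. The exponents 1, 8 and 1
  add up to 10, and \<open>KB\<close> collects the constants.\<close>

lemma base_bound:
  assumes c: "c \<in> V" "c' \<in> V" and F: "functional F" and sm: "sq F summable_on levels c"
  shows "sq F summable_on levels c' \<and> infsum (sq F) (levels c') \<le> KB * (real (d c c') + 1) ^ 10 * infsum (sq F) (levels c)"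
proof -
  define l where "l = d c c'"
  define N where "N = infsum (sq F) (levels c)"
  have N0: "N \<ge> 0" unfolding N_def by (rule infsum_nonneg) (rule sq_ge0)
  define J where "J = (\<lambda>t'. jumps c (snd t') (fst t' - (l + 2 * wd)))"
  define q where "q = real (l + 2 * wd + 1) ^ 8"
  have J: "finite (J t')" "card (J t') \<le> KJ * (l + 1)" "J t' \<subseteq> levels c"
    "\<And>t. t \<in> J t' \<Longrightarrow> fst t \<le> fst t' + l \<and> fst t' \<le> fst t + l + 2 * wd"
    "cmod (F (ind (snd t'))) \<le> (\<Sum>t\<in>J t'. cmod (F (ind (snd t))))" if t': "t' \<in> levels c'" for t'
  proof -
    have nA: "(fst t', snd t') \<in> levels c'" using t' by simp
    note L = level_jumps[OF c nA, folded l_def]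
    show "finite (J t')" "card (J t') \<le> KJ * (l + 1)" using L(1,2) unfolding J_def by auto
    show "J t' \<subseteq> levels c" unfolding J_def by (rule jumps_sub)
    show "fst t \<le> fst t' + l \<and> fst t' \<le> fst t + l + 2 * wd" if "t \<in> J t'" for t
      using L(3)[of "fst t" "snd t"] that unfolding J_def by simp
    have "F (ind (snd t')) = (\<Sum>t\<in>J t'. jump_coeff c (snd t') (fst t' - (l + 2 * wd)) t * F (ind (snd t)))"
      using level_expand[OF c nA F] unfolding J_def l_def .
    also have "cmod \<dots> \<le> (\<Sum>t\<in>J t'. cmod (F (ind (snd t))))"
      by (rule sum_norm_le) (simp add: norm_mult mult_left_le_one_le jump_coeff_norm)
    finally show "cmod (F (ind (snd t'))) \<le> (\<Sum>t\<in>J t'. cmod (F (ind (snd t))))" .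
  qed
  have one: "sq F t' \<le> real (KJ * (l + 1)) * q * (\<Sum>t\<in>J t'. sq F t)" if t': "t' \<in> levels c'" for t'
  proof -
    let ?S = "\<Sum>t\<in>J t'. (cmod (F (ind (snd t))))\<^sup>2"
    have "(cmod (F (ind (snd t'))))\<^sup>2 \<le> (\<Sum>t\<in>J t'. cmod (F (ind (snd t))))\<^sup>2"
      using J(5)[OF t'] by (intro power_mono) auto
    also have "\<dots> \<le> ?S * real (card (J t'))" by (rule sum_squared_le_sum_of_squares)
    also have "\<dots> \<le> ?S * real (KJ * (l + 1))" using J(2)[OF t'] by (intro mult_left_mono sum_nonneg) (auto simp: of_nat_le_iff simp del: of_nat_mult)
    finally have "(cmod (F (ind (snd t'))))\<^sup>2 \<le> real (KJ * (l + 1)) * ?S" by (simp add: mult.commute)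
    then have "sq F t' \<le> wt (fst t') * (real (KJ * (l + 1)) * ?S)"
      unfolding sq_def using wt_ge1[of "fst t'"] by (intro mult_left_mono) auto
    also have "\<dots> = real (KJ * (l + 1)) * (wt (fst t') * ?S)" by (rule mult.left_commute)
    also have "\<dots> = real (KJ * (l + 1)) * (\<Sum>t\<in>J t'. wt (fst t') * (cmod (F (ind (snd t))))\<^sup>2)"
      by (rule arg_cong[OF sum_distrib_left])
    also have "\<dots> \<le> real (KJ * (l + 1)) * (\<Sum>t\<in>J t'. q * sq F t)"
    proof (intro mult_left_mono sum_mono)
      fix t assume t: "t \<in> J t'"
      have "fst t' + 1 \<le> (l + 2 * wd + 1) * (fst t + 1)" using J(4)[OF t' t] by (simp add: algebra_simps)
      then have "real (fst t' + 1) \<le> real ((l + 2 * wd + 1) * (fst t + 1))" by (rule of_nat_mono)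
      then have "real (fst t') + 1 \<le> real (l + 2 * wd + 1) * (real (fst t) + 1)"
        by (simp only: of_nat_mult of_nat_add of_nat_1)
      then have "wt (fst t') \<le> (real (l + 2 * wd + 1) * (real (fst t) + 1)) ^ 8"
        unfolding wt_def by (intro power_mono) auto
      also have "\<dots> = q * wt (fst t)" unfolding q_def wt_def by (rule power_mult_distrib)
      finally show "wt (fst t') * (cmod (F (ind (snd t))))\<^sup>2 \<le> q * sq F t"
        unfolding sq_def by (simp add: mult.assoc[symmetric] mult_right_mono)
    qed auto
    also have "\<dots> = real (KJ * (l + 1)) * q * (\<Sum>t\<in>J t'. sq F t)"
      by (simp only: sum_distrib_left[symmetric] mult.assoc)
    finally show ?thesis .
  qed
  have q0: "q \<ge> 0" by (simp add: q_def)
  \<comment> \<open>Three targets by \<open>jump_targets\<close> for each of the at most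
    \<open>2 * l + 2 * wd + 1\<close> levels that can have a jump at the level of the given
    atom.\<close>
  define M where "M = 3 * (2 * l + 2 * wd + 1)"
  have fin: "sum (sq F) S \<le> real (KJ * (l + 1)) * q * (real M * N)" if S: "finite S" "S \<subseteq> levels c'" for S
  proof -
    define U where "U = (\<Union>t'\<in>S. J t')"
    have fU: "finite U" "U \<subseteq> levels c" unfolding U_def using S J by blast+
    have mult: "card {t' \<in> S. t \<in> J t'} \<le> M" if t: "t \<in> U" for t
    proof -
      have "t \<in> levels c" using t fU by blast
      then obtain m y where y: "t = (m, atom c m y)" "y \<in> V" "m \<le> d c y" by (auto simp: levels_def)
      have "\<exists>T. finite T \<and> card T \<le> 3 \<and> (\<forall>y0 ms. y0 \<in> V \<and> jump c (atom c' n y0) ms m y \<longrightarrow> atom c' n y0 \<in> T)" for n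
        using jump_targets[OF c y(2,3), of n] by metis
      then obtain T where T: "\<And>n. finite (T n)" "\<And>n. card (T n) \<le> 3"
        "\<And>n y0 ms. y0 \<in> V \<Longrightarrow> jump c (atom c' n y0) ms m y \<Longrightarrow> atom c' n y0 \<in> T n" by metis
      have "{t' \<in> S. t \<in> J t'} \<subseteq> (SIGMA n:{m - l..m + l + 2 * wd}. T n)"
      proof
        fix t' assume t': "t' \<in> {t' \<in> S. t \<in> J t'}"
        then have tl: "t' \<in> levels c'" using S by blast
        then obtain n y0 where n: "t' = (n, atom c' n y0)" "y0 \<in> V" by (auto simp: levels_def)
        obtain y' where y': "atom c m y = atom c m y'" "y' \<in> V" "jump c (atom c' n y0) (n - (l + 2 * wd)) m y'"
          using t' n y(1) unfolding J_def jumps_def by auto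
        have "y' \<in> atom c m y" using y' atom_self by blast
        then have "jump c (atom c' n y0) (n - (l + 2 * wd)) m y" using jump_eq[OF c(1) y(2)] y' by blast
        moreover have "n \<in> {m - l..m + l + 2 * wd}" using J(4)[OF tl, of t] t' n y(1) by auto
        ultimately show "t' \<in> (SIGMA n:{m - l..m + l + 2 * wd}. T n)" using T(3) n by auto
      qed
      moreover have fS: "finite (SIGMA n:{m - l..m + l + 2 * wd}. T n)" using T(1) by auto
      ultimately have "card {t' \<in> S. t \<in> J t'} \<le> card (SIGMA n:{m - l..m + l + 2 * wd}. T n)"
        by (intro card_mono) auto
      also have "\<dots> = (\<Sum>n\<in>{m - l..m + l + 2 * wd}. card (T n))" using T(1) by (intro card_SigmaI) auto
      also have "\<dots> \<le> of_nat (card {m - l..m + l + 2 * wd}) * 3" by (rule sum_bounded_above) (use T(2) in auto)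
      also have "\<dots> \<le> M" unfolding M_def by auto
      finally show ?thesis .
    qed
    have "(\<Sum>t'\<in>S. \<Sum>t\<in>J t'. sq F t) = (\<Sum>t'\<in>S. \<Sum>t\<in>{t \<in> U. t \<in> J t'}. sq F t)"
      by (intro sum.cong refl) (auto simp: U_def)
    also have "\<dots> = (\<Sum>t\<in>U. \<Sum>t'\<in>{t' \<in> S. t \<in> J t'}. sq F t)"
      by (rule sum.swap_restrict[OF S(1) fU(1)])
    also have "\<dots> \<le> (\<Sum>t\<in>U. real M * sq F t)"
      using mult sq_ge0 by (intro sum_mono) (auto intro!: mult_right_mono)
    also have "\<dots> = real M * (\<Sum>t\<in>U. sq F t)" by (simp add: sum_distrib_left)
    also have "\<dots> \<le> real M * N" unfolding N_def
      by (intro mult_left_mono finite_sum_le_infsum[OF sm fU] sq_ge0) auto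
    finally have sw: "(\<Sum>t'\<in>S. \<Sum>t\<in>J t'. sq F t) \<le> real M * N" .
    have "sum (sq F) S \<le> (\<Sum>t'\<in>S. real (KJ * (l + 1)) * q * (\<Sum>t\<in>J t'. sq F t))"
      using one S by (intro sum_mono) auto
    also have "\<dots> = real (KJ * (l + 1)) * q * (\<Sum>t'\<in>S. \<Sum>t\<in>J t'. sq F t)" by (simp add: sum_distrib_left)
    also have "\<dots> \<le> real (KJ * (l + 1)) * q * (real M * N)" using sw q0 by (intro mult_left_mono) auto
    finally show ?thesis .
  qed
  have fac: "real (KJ * (l + 1)) * q * (real M * N) \<le> KB * (real l + 1) ^ 10 * N"
  proof -
    define D where "D = real (2 * wd + 3)"
    have "l + 2 * wd + 1 \<le> (2 * wd + 3) * (l + 1)" "2 * l + 2 * wd + 1 \<le> (2 * wd + 3) * (l + 1)"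
      by (auto simp: algebra_simps)
    from of_nat_mono[OF this(1), where ?'a = real] of_nat_mono[OF this(2), where ?'a = real]
    have a: "real (l + 2 * wd + 1) \<le> D * real (l + 1)" and b: "real (2 * l + 2 * wd + 1) \<le> D * real (l + 1)"
      unfolding D_def of_nat_mult[of "2 * wd + 3"] .
    define x where "x = real (l + 1)"
    have x: "x \<ge> 0" "real l + 1 = x" by (simp_all add: x_def)
    have "q \<le> (D * x) ^ 8" unfolding q_def x_def using a by (intro power_mono) auto
    moreover have "real M \<le> 3 * (D * x)" unfolding M_def x_def using b by simp
    ultimately have "q * real M \<le> (D * x) ^ 8 * (3 * (D * x))"
      by (intro mult_mono) auto
    also have "\<dots> = 3 * D ^ 9 * x ^ 9"
      by (simp add: power_mult_distrib eval_nat_numeral)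
    finally have "real (KJ * (l + 1)) * (q * real M) \<le> real (KJ * (l + 1)) * (3 * D ^ 9 * x ^ 9)"
      by (intro mult_left_mono) auto
    also have "real (KJ * (l + 1)) = real KJ * x" unfolding x_def by (rule of_nat_mult)
    also have "real KJ * x * (3 * D ^ 9 * x ^ 9) = KB * x ^ 10"
      unfolding KB_def D_def[symmetric] by (simp add: eval_nat_numeral)
    finally have "real (KJ * (l + 1)) * (q * real M) \<le> KB * x ^ 10" unfolding x_def of_nat_mult .
    from mult_right_mono[OF this N0] show ?thesis unfolding x(2) by (simp only: mult.assoc)
  qed
  have bd: "bdd_above (sum (sq F) ` {S. S \<subseteq> levels c' \<and> finite S})"
    using fin by (intro bdd_aboveI2[of _ _ "real (KJ * (l + 1)) * q * (real M * N)"]) auto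
  have s': "sq F summable_on levels c'" by (rule nonneg_bdd_above_summable_on[OF sq_ge0 bd])
  have "infsum (sq F) (levels c') \<le> real (KJ * (l + 1)) * q * (real M * N)"
    by (rule infsum_le_finite_sums[OF s']) (use fin in auto)
  then show ?thesis using s' fac unfolding l_def N_def by linarith
qed

lemma level_0: "c \<in> V \<Longrightarrow> (0, V) \<in> levels c"
  using atom_0[of c c] unfolding levels_def by force

lemma V_atom: "V \<noteq> {} \<Longrightarrow> V \<in> allatoms"
  using level_0 levels_allatoms by fastforce

lemma ex_functional:
  assumes c: "c \<in> V"
  shows "\<exists>F. functional F \<and> sq F summable_on levels c \<and> F (ind V) = 1"
proof -
  \<comment> \<open>evaluation at \<open>c\<close>: an atom of positive level never contains \<open>c\<close>\<close>
  define F where "F = (\<lambda>\<phi>. if \<phi> \<in> atom_span then \<phi> c else 0)"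
  have l: "functional F" unfolding functional_def F_def by (auto simp: atom_span_add atom_span_scale)
  have F: "F (ind D) = of_bool (c \<in> D)" if "D \<in> allatoms" for D
    using atom_span_ind[OF that] by (simp add: F_def ind_def)
  have "sq F t = 0" if t: "t \<in> levels c - {(0, V)}" for t
  proof -
    obtain m y where y: "t = (m, atom c m y)" "y \<in> V" "m \<le> d c y" using t by (auto simp: levels_def)
    have "c \<notin> atom c m y"
    proof
      assume "c \<in> atom c m y"
      then have "m = 0" using atom_far[OF c y(2) _ y(3), of c] c by simp
      then show False using t y atom_0[OF c y(2)] by simp
    qed
    then show ?thesis using F[OF levels_allatoms[OF c]] t y by (auto simp: sq_def)
  qed
  then have "sq F summable_on levels c \<longleftrightarrow> sq F summable_on {(0, V)}"
    using level_0[OF c] by (intro summable_on_cong_neutral) auto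
  moreover have "F (ind V) = 1" using F V_atom c by fastforce
  ultimately show ?thesis using l by auto
qed

end

section \<open>Cutting the total mass between two distant base vertices\<close>

context fine_hyp
begin

definition wv :: nat where "wv = 2 * \<delta> + 2"

text \<open>Atoms of vertices to which some geodesic from \<open>c\<close> still runs along
  \<open>\<gamma>\<close> from level \<open>N\<close> to \<open>N + wv\<close>; the distance
  \<open>wv\<close> is what \<open>window\<close> needs for \<open>C = \<delta>\<close>.\<close>

definition tracked :: "'v \<Rightarrow> nat \<Rightarrow> (nat \<Rightarrow> 'v) \<Rightarrow> nat \<Rightarrow> 'v set set" where
  "tracked c N \<gamma> l = {atom c N y | y s. y \<in> V \<and> geo s (d c y) c y \<and> N + wv \<le> d c y \<and>
     (\<exists>i\<le>l. d (s N) (\<gamma> i) \<le> \<delta>) \<and> (\<exists>i\<le>l. d (s (N + wv)) (\<gamma> i) \<le> \<delta>)}"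

text \<open>Such a geodesic has an edge near \<open>\<gamma>\<close> slightly above level
  \<open>N\<close>. There are boundedly many atoms at each of these linearly many edges, and the
  tracked atoms are their coarsenings to level \<open>N\<close>.\<close>

lemma tracked_fin:
  assumes c: "c \<in> V" and g: "geo \<gamma> l a b"
  shows "finite (tracked c N \<gamma> l) \<and> card (tracked c N \<gamma> l) \<le> l * (Kn * Ka)"
proof -
  define B where "B = (\<lambda>i. {\<gamma> i, \<gamma> (Suc i)}) ` {..<l}"
  have B: "finite B" "B \<subseteq> E" "card B \<le> l"
    using geo_E[OF g] card_image_le[of "{..<l}" "\<lambda>i. {\<gamma> i, \<gamma> (Suc i)}"] unfolding B_def by auto
  let ?U = "\<Union>g\<in>near_ball 1 B. edge_atoms c g"
  let ?co = "\<lambda>t. atom c N (SOME y. y \<in> snd t)"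
  have U: "finite ?U" "card ?U \<le> card B * Kn ^ 1 * Ka" using edge_atoms_Union[OF c B(1,2), of 1] by auto
  have "card B * Kn ^ 1 * Ka \<le> l * Kn ^ 1 * Ka" using B(3) by (intro mult_right_mono) auto
  moreover have "l * Kn ^ 1 * Ka = l * (Kn * Ka)" by simp
  ultimately have cU: "card (?co ` ?U) \<le> l * (Kn * Ka)" using card_image_le[OF U(1), of ?co] U(2) by linarith
  have "tracked c N \<gamma> l \<subseteq> ?co ` ?U"
  proof
    fix D assume "D \<in> tracked c N \<gamma> l"
    then obtain y s where y: "D = atom c N y" "y \<in> V" "geo s (d c y) c y" "N + wv \<le> d c y"
      "\<exists>i\<le>l. d (s N) (\<gamma> i) \<le> \<delta>" "\<exists>i\<le>l. d (s (N + wv)) (\<gamma> i) \<le> \<delta>" by (auto simp: tracked_def)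
    obtain i1 i2 where i: "i1 \<le> l" "d (s N) (\<gamma> i1) \<le> \<delta>" "i2 \<le> l" "d (s (N + wv)) (\<gamma> i2) \<le> \<delta>" using y by blast
    have "\<exists>i<l. nr {s (N + \<delta> + 1), s (N + \<delta> + 2)} {\<gamma> i, \<gamma> (Suc i)}"
    proof (rule window[OF y(3) g _ y(4) _ i])
      show "N + 2 * \<delta> + 2 \<le> N + wv" "N + wv \<le> N + wv" by (auto simp: wv_def)
      show "2 * wv + 6 * \<delta> + 2 \<le> L0" by (simp add: wv_def L0_def)
    qed
    then have e: "{s (N + \<delta> + 1), s (N + \<delta> + 2)} \<in> near_ball 1 B" using near_sym unfolding B_def by fastforce
    have k: "N + \<delta> + 2 \<le> d c y" "N + \<delta> + 1 \<le> d c y" using y(4) by (auto simp: wv_def)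
    have dd: "d c (s (N + \<delta> + 2)) = N + \<delta> + 2" "d c (s (N + \<delta> + 1)) = N + \<delta> + 1" using geo_da[OF y(3)] k by auto
    then have "(N + \<delta> + 2, atom c (N + \<delta> + 2) y) \<in> edge_atoms c {s (N + \<delta> + 1), s (N + \<delta> + 2)}"
      unfolding edge_atoms_def using y(2) geo_interval[OF y(3) k(1)]
      by (intro CollectI exI[of _ "s (N + \<delta> + 1)"] exI[of _ "s (N + \<delta> + 2)"] exI[of _ y]) auto
    then have "(N + \<delta> + 2, atom c (N + \<delta> + 2) y) \<in> ?U" using e by blast
    moreover have "?co (N + \<delta> + 2, atom c (N + \<delta> + 2) y) = D"
    proof -
      have "(SOME u. u \<in> atom c (N + \<delta> + 2) y) \<in> atom c (N + \<delta> + 2) y" using atom_self[OF y(2)] by (rule someI)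
      then have "(SOME u. u \<in> atom c (N + \<delta> + 2) y) \<in> atom c N y" using atom_mono[of N "N + \<delta> + 2" c y] by auto
      then show ?thesis using atom_eq[OF y(2)] y(1) by auto
    qed
    ultimately show "D \<in> ?co ` ?U" by (rule rev_image_eqI[OF _ sym])
  qed
  then show ?thesis using U(1) cU card_mono[of "?co ` ?U"] finite_subset by (meson finite_imageI le_trans)
qed

lemma tracked_level: "D \<in> tracked c N \<gamma> l \<Longrightarrow> (N, D) \<in> levels c"
  by (auto simp: tracked_def levels_def)

text \<open>If the geodesic from \<open>c\<close> to \<open>y\<close> leaves \<open>\<gamma>\<close>
  early, then a geodesic from \<open>c'\<close> to \<open>y\<close> passes close to
  \<open>c\<close>, and so runs along \<open>\<gamma>'\<close> beyond its middle.\<close>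

lemma tracked_either:
  assumes c: "c \<in> V" "c' \<in> V" and g: "geo \<gamma> l c c'" and g': "geo \<gamma>' l c' c" and y: "y \<in> V"
    and N: "2 * N + 2 * wv + 2 * \<delta> < l"
  shows "atom c N y \<in> tracked c N \<gamma> l \<or> atom c' N y \<in> tracked c' N \<gamma>' l"
proof (cases "atom c N y \<in> tracked c N \<gamma> l")
  case False
  have l: "l = d c c'" using geo_len[OF g] .
  obtain s where s: "geo s (d c y) c y" using ex_geo c y by blast
  \<comment> \<open>Either \<open>y\<close> itself, if it is close to \<open>c\<close>, or a point
    that thinness provides where \<open>s\<close> is away from \<open>\<gamma>\<close>.\<close>
  obtain q where q: "q \<in> interval c' y" "d c q \<le> N + wv + \<delta>"
  proof (cases "N + wv \<le> d c y")
    case True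
    then have "\<not> ((\<exists>i\<le>l. d (s N) (\<gamma> i) \<le> \<delta>) \<and> (\<exists>i\<le>l. d (s (N + wv)) (\<gamma> i) \<le> \<delta>))"
      using False s y unfolding tracked_def by blast
    then obtain j where j: "j \<le> N + wv" "\<not> (\<exists>i\<le>l. d (s j) (\<gamma> i) \<le> \<delta>)" by (metis le_add1 order_refl)
    then have jk: "j \<le> d c y" using True by linarith
    obtain q where q: "q \<in> interval y c'" "d (s j) q \<le> \<delta>"
      using thin_geo[OF c(1) y g geo_interval[OF s jk]] j(2) by blast
    have qV: "q \<in> V" using q by (auto simp: interval_def)
    have "d c q \<le> N + wv + \<delta>" using d_tri[OF c(1) geo_V[OF s jk] qV] geo_da[OF s jk] j q by linarith
    then show thesis using that q interval_comm[OF y c(2)] by blast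
  next
    case False
    then show thesis using that[of y] y c by (auto simp: interval_def)
  qed
  have qV: "q \<in> V" using q by (auto simp: interval_def)
  have dq: "N + wv < d c' q" using d_tri[OF c(1) qV c(2)] d_sym[OF qV c(2)] q(2) N l by linarith
  obtain t where t: "geo t (d c' y) c' y" "t (d c' q) = q" using ex_geo_through[OF c(2) y q(1)] by blast
  have qy: "d c' q \<le> d c' y" using q by (auto simp: interval_def)
  have cl: "\<exists>i\<le>l. d (t j) (\<gamma>' i) \<le> \<delta>" if j: "j \<le> N + wv" for j
  proof -
    have jk: "j \<le> d c' q" "j \<le> d c' y" using j dq qy by auto
    have tj: "t j \<in> V" "d c' (t j) = j" using geo_V[OF t(1) jk(2)] geo_da[OF t(1) jk(2)] by auto
    have "t j \<in> interval c' q" using geo_d[OF t(1) jk(1) qy] t(2) tj jk by (auto simp: interval_def)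
    from thin_geo[OF c(2) qV g' this] show ?thesis
    proof
      assume "\<exists>u\<in>interval q c. d (t j) u \<le> \<delta>"
      then obtain u where u: "u \<in> interval q c" "d (t j) u \<le> \<delta>" by blast
      have uV: "u \<in> V" using u by (auto simp: interval_def)
      have "d c u \<le> N + wv + \<delta>" using u q d_sym[OF c(1) uV] d_sym[OF c(1) qV] by (auto simp: interval_def)
      then have False using d_tri[OF c(1) uV c(2)] d_tri[OF c(2) tj(1) uV] d_sym[OF c(2) uV] tj u j N l by linarith
      then show ?thesis ..
    qed
  qed
  have "atom c' N y \<in> tracked c' N \<gamma>' l"
    unfolding tracked_def using y t(1) cl[of N] cl[of "N + wv"] dq qy
    by (intro CollectI exI[of _ y] exI[of _ t]) auto
  then show ?thesis ..
qed auto

lemma disjoint_count: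
  assumes c: "c \<in> V" and U: "finite U" "\<And>D. D \<in> U \<Longrightarrow> (N, D) \<in> levels c"
  shows "(\<Sum>D\<in>U. ind D y) = of_bool (atom c N y \<in> U \<and> y \<in> V)"
proof -
  have D: "D = atom c N y \<and> y \<in> V" if yD: "D \<in> U" "y \<in> D" for D
  proof -
    obtain u where "D = atom c N u" "u \<in> V" using U(2)[OF yD(1)] by (auto simp: levels_def)
    then show ?thesis using yD atom_eq atom_sub by blast
  qed
  show ?thesis
  proof (cases "atom c N y \<in> U \<and> y \<in> V")
    case True
    have "(\<Sum>D\<in>U. ind D y) = (\<Sum>D\<in>{atom c N y}. ind D y)"
      using True U(1) D by (intro sum.mono_neutral_right) (auto simp: ind_def)
    then show ?thesis using True atom_self by (simp add: ind_def)
  next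
    case False
    then have "ind D y = 0" if "D \<in> U" for D using D[OF that] that by (auto simp: ind_def)
    then show ?thesis using False by simp
  qed
qed

definition Kb :: real where "Kb = real (Kn * Ka)"

text \<open>The total mass is the mass far from \<open>c\<close> plus the mass far from \<open>c'\<close>, minus the overlap; all three
  are carried by polynomially many atoms of high level.\<close>
lemma small_total:
  assumes c: "c \<in> V" "c' \<in> V" and F: "functional F" and N: "2 * N + 2 * wv + 2 * \<delta> < d c c'"
    and B: "\<And>t. t \<in> levels c \<union> levels c' \<Longrightarrow> sq F t \<le> B"
  shows "cmod (F (ind V)) \<le> sqrt B / (real N + 1) ^ 4 *
     (2 * (Kb * d c c') + (Kb * d c c')\<^sup>2 * (real KJ * (real (d c c') + 1) + 1))"
proof -
  define l where "l = d c c'"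
  define M where "M = sqrt B / (real N + 1) ^ 4"
  have "sq F (0, V) \<le> B" using B level_0[OF c(1)] by blast
  then have B0: "0 \<le> B" using sq_ge0[of F "(0, V)"] by linarith
  then have M0: "0 \<le> M" by (simp add: M_def)
  \<comment> \<open>The weight \<open>(N + 1) ^ 8\<close> on squares becomes
    \<open>(N + 1) ^ 4\<close> on values.\<close>
  have val: "cmod (F (ind (snd t))) \<le> M" if t: "t \<in> levels c \<union> levels c'" "N \<le> fst t" for t
  proof -
    have "(real N + 1) ^ 8 \<le> wt (fst t)" unfolding wt_def using t by (intro power_mono) auto
    then have "(real N + 1) ^ 8 * (cmod (F (ind (snd t))))\<^sup>2 \<le> sq F t" unfolding sq_def by (rule mult_right_mono) simp
    also have "\<dots> \<le> B" using B t by blast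
    finally have "((real N + 1) ^ 4 * cmod (F (ind (snd t))))\<^sup>2 \<le> B" by (simp add: power_mult_distrib)
    then have "(real N + 1) ^ 4 * cmod (F (ind (snd t))) \<le> sqrt B" by (rule real_le_rsqrt)
    then show ?thesis unfolding M_def by (simp add: pos_le_divide_eq mult.commute)
  qed
  obtain g where g: "geo g l c c'" using ex_geo c unfolding l_def by blast
  have g': "geo (\<lambda>i. g (l - i)) l c' c" by (rule geo_rev[OF g])
  define W U where "W = tracked c N g l" and "U = tracked c' N (\<lambda>i. g (l - i)) l"
  have W: "finite W" "card W \<le> l * (Kn * Ka)" "\<And>D. D \<in> W \<Longrightarrow> (N, D) \<in> levels c"
    unfolding W_def using tracked_fin[OF c(1) g] tracked_level by auto
  have U: "finite U" "card U \<le> l * (Kn * Ka)" "\<And>D. D \<in> U \<Longrightarrow> (N, D) \<in> levels c'"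
    unfolding U_def using tracked_fin[OF c(2) g'] tracked_level by auto
  have at: "D \<in> allatoms" if "D \<in> W \<union> U" for D
    using that W(3) U(3) levels_allatoms[OF c(1)] levels_allatoms[OF c(2)] by fastforce
  \<comment> \<open>The intersection of \<open>A\<close> and \<open>D\<close> need not be an atom;
    its indicator is expanded by atoms inside \<open>D\<close>, whose levels are at least
    \<open>N\<close>, so that \<open>val\<close> applies to each term.\<close>
  have prod: "(\<lambda>x. ind A x * ind D x) \<in> atom_span \<and> cmod (F (\<lambda>x. ind A x * ind D x)) \<le> (real KJ * (real l + 1) + 1) * M"
    if A: "A \<in> U" and D: "D \<in> W" for A D
  proof -
    note nA = U(3)[OF A]
    define ms where "ms = N - (d c c' + 2 * wd)"
    define J where "J = {t \<in> jumps c A ms. N < fst t \<and> snd t \<subseteq> D}"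
    note L = level_jumps[OF c nA, folded ms_def]
    obtain u where u: "D = atom c N u" "u \<in> V" "N \<le> d c u" using W(3)[OF D] by (auto simp: levels_def)
    have J: "finite J" "J \<subseteq> levels c" "card J \<le> KJ * (l + 1)"
    proof -
      show "finite J" "J \<subseteq> levels c" using L(1) jumps_sub unfolding J_def by auto
      have "card J \<le> card (jumps c A ms)" unfolding J_def using L(1) by (intro card_mono) auto
      then show "card J \<le> KJ * (l + 1)" using L(2) unfolding l_def by linarith
    qed
    define a where "a = (of_bool (status c A ms N u) :: complex)"
    have eq: "(\<lambda>x. ind A x * ind D x) = (\<lambda>x. (\<Sum>t\<in>J. jump_coeff c A ms t * ind (snd t) x) + a * ind D x)"
    proof
      fix x
      show "ind A x * ind D x = (\<Sum>t\<in>J. jump_coeff c A ms t * ind (snd t) x) + a * ind D x"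
      proof (cases "x \<in> V")
        case True
        have "x \<in> A \<Longrightarrow> ms \<le> d c x" using L(4) by blast
        from jumps_indicator_within[OF c(1) True L(1) this u(2,3)] show ?thesis
          unfolding J_def u(1) a_def ind_def by simp
      next
        case False
        then have "x \<notin> D" using u atom_sub by blast
        then show ?thesis unfolding J_def ind_def by (auto intro!: sum.neutral)
      qed
    qed
    have Jat: "snd t \<in> allatoms" if "t \<in> J" for t using J(2) levels_allatoms[OF c(1)] that by blast
    have DS: "ind D \<in> atom_span" using atom_span_ind at D by blast
    have S1: "(\<lambda>x. \<Sum>t\<in>J. jump_coeff c A ms t * ind (snd t) x) \<in> atom_span"
      by (rule atom_span_sum[OF J(1)]) (rule atom_span_scale[OF atom_span_ind[OF Jat]])
    have "F (\<lambda>x. ind A x * ind D x) = (\<Sum>t\<in>J. jump_coeff c A ms t * F (ind (snd t))) + a * F (ind D)"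
      unfolding eq using functional_add[OF F S1 atom_span_scale[OF DS]] functional_scale[OF F DS] functional_sum_ind[OF F J(1) Jat, where a = "jump_coeff c A ms"] by simp
    also have "cmod \<dots> \<le> (\<Sum>t\<in>J. cmod (jump_coeff c A ms t * F (ind (snd t)))) + cmod (a * F (ind D))"
      by (rule order_trans[OF norm_triangle_ineq add_right_mono[OF norm_sum]])
    also have "\<dots> \<le> (\<Sum>t\<in>J. M) + M"
    proof (intro add_mono sum_mono)
      fix t assume t: "t \<in> J"
      have "cmod (jump_coeff c A ms t * F (ind (snd t))) \<le> 1 * cmod (F (ind (snd t)))"
        unfolding norm_mult by (intro mult_right_mono jump_coeff_norm) auto
      also have "\<dots> \<le> M" using val[of t] t J(2) unfolding J_def by auto
      finally show "cmod (jump_coeff c A ms t * F (ind (snd t))) \<le> M" .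
    next
      have "cmod (a * F (ind D)) \<le> 1 * cmod (F (ind D))" unfolding norm_mult a_def by (intro mult_right_mono) auto
      also have "\<dots> \<le> M" using val[of "(N, D)"] W(3)[OF D] by auto
      finally show "cmod (a * F (ind D)) \<le> M" .
    qed
    also have "\<dots> = real (card J) * M + M" by simp
    also have "\<dots> \<le> real (KJ * (l + 1)) * M + M" using J(3) M0 by (intro add_right_mono mult_right_mono of_nat_mono) auto
    also have "\<dots> = (real KJ * (real l + 1) + 1) * M" by (simp add: algebra_simps)
    finally show ?thesis unfolding eq using atom_span_add[OF S1 atom_span_scale[OF DS]] by blast
  qed
  let ?P = "\<lambda>x. \<Sum>p\<in>U \<times> W. ind (fst p) x * ind (snd p) x"
  have fP: "finite (U \<times> W)" using U(1) W(1) by simp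
  have pS: "(\<lambda>x. ind (fst p) x * ind (snd p) x) \<in> atom_span" if "p \<in> U \<times> W" for p using prod that by auto
  have S: "(\<lambda>x. \<Sum>A\<in>U. ind A x) \<in> atom_span" "(\<lambda>x. \<Sum>D\<in>W. ind D x) \<in> atom_span" "?P \<in> atom_span"
    using atom_span_sum[OF U(1), of ind] atom_span_sum[OF W(1), of ind] atom_span_sum[OF fP pS] atom_span_ind at by auto
  \<comment> \<open>Inclusion and exclusion; the tracked atoms on the two sides cover
    \<open>V\<close> by \<open>tracked_either\<close>.\<close>
  have "ind V = (\<lambda>x. ((\<Sum>A\<in>U. ind A x) + (\<Sum>D\<in>W. ind D x)) + (-1) * ?P x)"
  proof
    fix x
    have u: "(\<Sum>A\<in>U. ind A x) = of_bool (atom c' N x \<in> U \<and> x \<in> V)" by (rule disjoint_count[OF c(2) U(1,3)])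
    have w: "(\<Sum>D\<in>W. ind D x) = of_bool (atom c N x \<in> W \<and> x \<in> V)" by (rule disjoint_count[OF c(1) W(1,3)])
    have "?P x = (\<Sum>A\<in>U. ind A x) * (\<Sum>D\<in>W. ind D x)"
      by (simp add: sum_product sum.cartesian_product case_prod_unfold)
    then have p: "?P x = of_bool (atom c' N x \<in> U \<and> x \<in> V) * of_bool (atom c N x \<in> W \<and> x \<in> V)"
      unfolding u w .
    have "x \<in> V \<Longrightarrow> atom c N x \<in> W \<or> atom c' N x \<in> U"
      unfolding W_def U_def using tracked_either[OF c g g'] N unfolding l_def by blast
    then show "ind V x = ((\<Sum>A\<in>U. ind A x) + (\<Sum>D\<in>W. ind D x)) + (-1) * ?P x"
      unfolding u w p ind_def[of V] by auto
  qed
  then have "F (ind V) = F (\<lambda>x. ((\<Sum>A\<in>U. ind A x) + (\<Sum>D\<in>W. ind D x)) + (-1) * ?P x)" by (rule arg_cong)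
  also have "\<dots> = ((\<Sum>A\<in>U. F (ind A)) + (\<Sum>D\<in>W. F (ind D))) + (-1) * (\<Sum>p\<in>U \<times> W. F (\<lambda>x. ind (fst p) x * ind (snd p) x))"
    using functional_add[OF F atom_span_add[OF S(1,2)] atom_span_scale[OF S(3)], of "-1"] functional_add[OF F S(1,2)] functional_scale[OF F S(3), of "-1"]
      functional_sum[OF F U(1), of ind] functional_sum[OF F W(1), of ind] functional_sum[OF F fP pS] atom_span_ind at by auto
  also have "cmod \<dots> \<le> (\<Sum>A\<in>U. cmod (F (ind A))) + (\<Sum>D\<in>W. cmod (F (ind D))) + (\<Sum>p\<in>U \<times> W. cmod (F (\<lambda>x. ind (fst p) x * ind (snd p) x)))"
    by (intro order_trans[OF norm_triangle_ineq] add_mono norm_sum) (auto intro: norm_sum)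
  also have "\<dots> \<le> (\<Sum>A\<in>U. M) + (\<Sum>D\<in>W. M) + (\<Sum>p\<in>U \<times> W. (real KJ * (real l + 1) + 1) * M)"
  proof (intro add_mono sum_mono)
    fix A assume "A \<in> U" then show "cmod (F (ind A)) \<le> M" using val[of "(N, A)"] U(3) by auto
  next
    fix A assume "A \<in> W" then show "cmod (F (ind A)) \<le> M" using val[of "(N, A)"] W(3) by auto
  qed (use prod in auto)
  also have "\<dots> = (real (card U) + real (card W) + real (card U) * real (card W) * (real KJ * (real l + 1) + 1)) * M"
    by (simp add: algebra_simps card_cartesian_product)
  also have "\<dots> \<le> (Kb * l + Kb * l + (Kb * l) * (Kb * l) * (real KJ * (real l + 1) + 1)) * M"
  proof -
    have "real (card U) \<le> Kb * l" "real (card W) \<le> Kb * l"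
      using of_nat_mono[OF U(2), where ?'a = real] of_nat_mono[OF W(2), where ?'a = real] by (simp_all add: Kb_def mult_ac)
    then show ?thesis using M0 by (intro mult_right_mono add_mono mult_mono) (auto simp: Kb_def)
  qed
  finally show ?thesis unfolding M_def l_def by (simp add: power2_eq_square algebra_simps)
qed

end

section \<open>Bounded fine graphs\<close>

context fine_graph
begin

definition ecc :: "'v \<Rightarrow> nat" where "ecc v = Max (d v ` V)"

definition centre :: "'v set" where "centre = {v \<in> V. \<forall>u\<in>V. ecc v \<le> ecc u}"

text \<open>If infinitely many central vertices existed, their geodesics from a base point would spread out
  at some vertex \<open>c\<close>; by fineness almost all geodesics from them to any given vertex pass through \<open>c\<close>,
  which makes \<open>c\<close> strictly more central.\<close>
lemma finite_centre:
  assumes bd: "\<And>u v. u \<in> V \<Longrightarrow> v \<in> V \<Longrightarrow> d u v \<le> Dm" and ne: "V \<noteq> {}"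
  shows "finite centre" "centre \<noteq> {}"
proof -
  have fin: "finite (d v ` V)" if "v \<in> V" for v
    using finite_subset[of "d v ` V" "{..Dm}"] bd that by auto
  have ecc_le: "d v u \<le> ecc v" if "v \<in> V" "u \<in> V" for u v unfolding ecc_def using fin that by (intro Max_ge) auto
  have ecc_at: "\<exists>u\<in>V. d v u = ecc v" if "v \<in> V" for v
    using Max_in[OF fin[OF that]] ne unfolding ecc_def by auto
  obtain v0 where "v0 \<in> V" "\<And>u. u \<in> V \<Longrightarrow> ecc v0 \<le> ecc u"
    using ex_has_least_nat[of "\<lambda>v. v \<in> V" _ ecc] ne by blast
  then show "centre \<noteq> {}" unfolding centre_def by blast
  show "finite centre"
  proof (rule ccontr)
    assume inf: "infinite centre"
    obtain b where b: "b \<in> V" using ne by blast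
    have CV: "centre \<subseteq> V" by (auto simp: centre_def)
    have "\<forall>y\<in>centre. \<exists>s. geo s (d b y) b y" using ex_geo b CV by blast
    then obtain \<pi> where \<pi>: "\<And>y. y \<in> centre \<Longrightarrow> geo (\<pi> y) (d b y) b y" by metis
    define S where "S = (\<lambda>c k. {y \<in> centre. k \<le> d b y \<and> \<pi> y k = c})"
    define Q where "Q = (\<lambda>k. \<exists>c. infinite (S c k))"
    have "S b 0 = centre" unfolding S_def using geo_0[OF \<pi>] by auto
    then have Q0: "Q 0" unfolding Q_def using inf by (intro exI[of _ b]) simp
    have Qb: "k \<le> Dm" if q: "Q k" for k
    proof -
      obtain c where "infinite (S c k)" using q unfolding Q_def by blast
      then obtain y where "y \<in> S c k" using infinite_imp_nonempty by blast
      then show ?thesis using bd[OF b, of y] CV unfolding S_def by auto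
    qed
    \<comment> \<open>The last level at which infinitely many of the chosen geodesics share a
      vertex. One step later the fibres of \<open>\<nu>\<close> are finite, so infinitely many edges
      leave \<open>c\<close>.\<close>
    define k where "k = (GREATEST k. Q k)"
    have Qk: "Q k" unfolding k_def using GreatestI_nat[of Q 0 Dm] Q0 Qb by blast
    have kmax: "\<not> Q (Suc k)" using Greatest_le_nat[of Q "Suc k" Dm] Qb unfolding k_def by fastforce
    obtain c where c: "infinite (S c k)" using Qk unfolding Q_def by blast
    define Y where "Y = S c k - {c}"
    have infY: "infinite Y" unfolding Y_def using c by simp
    define \<nu> where "\<nu> = (\<lambda>y. \<pi> y (Suc k))"
    have Y: "y \<in> centre" "y \<in> V" "y \<noteq> c" "k < d b y" "{c, \<nu> y} \<in> E" "d c y = Suc (d (\<nu> y) y)" if "y \<in> Y" for y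
    proof -
      show 1: "y \<in> centre" "y \<noteq> c" using that by (auto simp: Y_def S_def)
      then show yV: "y \<in> V" using CV by auto
      have k: "k \<le> d b y" "\<pi> y k = c" using that by (auto simp: Y_def S_def)
      note g = \<pi>[OF 1(1)]
      show lt: "k < d b y" using k 1(2) geo_k[OF g] by (cases "k = d b y") auto
      show "{c, \<nu> y} \<in> E" using geo_E[OF g lt] k by (simp add: \<nu>_def)
      show "d c y = Suc (d (\<nu> y) y)" using geo_db[OF g, of k] geo_db[OF g, of "Suc k"] lt k by (simp add: \<nu>_def)
    qed
    have fib: "finite {y \<in> Y. \<nu> y = u}" for u
    proof -
      have "{y \<in> Y. \<nu> y = u} \<subseteq> S u (Suc k)" using Y unfolding S_def \<nu>_def by fastforce
      moreover have "finite (S u (Suc k))" using kmax unfolding Q_def by blast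
      ultimately show ?thesis using finite_subset by blast
    qed
    have inf\<nu>: "infinite (\<nu> ` Y)"
    proof
      assume "finite (\<nu> ` Y)"
      then have "finite (\<Union>u\<in>\<nu> ` Y. {y \<in> Y. \<nu> y = u})" using fib by blast
      moreover have "Y = (\<Union>u\<in>\<nu> ` Y. {y \<in> Y. \<nu> y = u})" by blast
      ultimately show False using infY by simp
    qed
    obtain y1 where y1: "y1 \<in> Y" using infY infinite_imp_nonempty by blast
    have cV: "c \<in> V" using edge_verts(1)[OF Y(5)[OF y1]] .
    \<comment> \<open>A vertex at maximal distance from \<open>c\<close>. The vertices of
      \<open>Y\<close> are central, so none is farther from \<open>x\<close> than \<open>c\<close>
      is, and no geodesic from them to \<open>x\<close> passes through \<open>c\<close>.\<close>
    obtain x where x: "x \<in> V" "d c x = ecc c" using ecc_at[OF cV] by blast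
    have far: "d y x \<le> d c x" if "y \<in> Y" for y
    proof -
      have "ecc y \<le> ecc c" using Y(1)[OF that] cV by (auto simp: centre_def)
      then show ?thesis using ecc_le[OF Y(2)[OF that] x(1)] x(2) by linarith
    qed
    have dyc: "d y c \<noteq> 0" if "y \<in> Y" for y using d_0[OF Y(2)[OF that] cV] Y(3)[OF that] by simp
    have "x \<noteq> c"
    proof
      assume "x = c"
      then show False using far[OF y1] dyc[OF y1] cV by simp
    qed
    then obtain w where w: "{c, w} \<in> E" "d c x = Suc (d w x)"
      using interval_step[OF cV x(1), of c] cV x by (metis d_refl interval_iff add_0)
    have wV: "w \<in> V" using edge_verts w by blast
    \<comment> \<open>The path from \<open>\<nu> y\<close> over \<open>y\<close> and
      \<open>x\<close> to \<open>w\<close> misses \<open>c\<close>, so infinitely many edges at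
      \<open>c\<close> would be near the single edge towards \<open>w\<close>.\<close>
    have nr: "near (3 * Dm + 2) {c, \<nu> y} {c, w}" if y: "y \<in> Y" for y
    proof -
      have nV: "\<nu> y \<in> V" using edge_verts Y(5)[OF y] by blast
      obtain F1 where F1: "F1 \<subseteq> E" "finite F1" "card F1 \<le> d (\<nu> y) y" "(\<nu> y, y) \<in> crel F1" "\<Union>F1 \<subseteq> interval (\<nu> y) y"
        using connect[OF nV Y(2)[OF y]] by blast
      obtain F2 where F2: "F2 \<subseteq> E" "finite F2" "card F2 \<le> d y x" "(y, x) \<in> crel F2" "\<Union>F2 \<subseteq> interval y x"
        using connect[OF Y(2)[OF y] x(1)] by blast
      obtain F3 where F3: "F3 \<subseteq> E" "finite F3" "card F3 \<le> d x w" "(x, w) \<in> crel F3" "\<Union>F3 \<subseteq> interval x w"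
        using connect[OF x(1) wV] by blast
      have "c \<notin> interval (\<nu> y) y" using Y(6)[OF y] by (auto simp: interval_def)
      moreover have "c \<notin> interval y x" using far[OF y] dyc[OF y] by (auto simp: interval_def)
      moreover have "c \<notin> interval x w" using w(2) d_sym[OF x(1) cV] d_sym[OF x(1) wV] by (auto simp: interval_def)
      ultimately have av: "c \<notin> \<Union>(F1 \<union> F2 \<union> F3)" using F1(5) F2(5) F3(5) by blast
      have cn: "(\<nu> y, w) \<in> crel (F1 \<union> F2 \<union> F3)" using crel_trans2[OF crel_trans2[OF F1(4) F2(4)] F3(4)] .
      have "card (F1 \<union> F2 \<union> F3) \<le> card F1 + card F2 + card F3"
        using card_Un_le[of F1 F2] card_Un_le[of "F1 \<union> F2" F3] by linarith
      then have "card (F1 \<union> F2 \<union> F3) + 2 \<le> 3 * Dm + 2"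
        using F1(3) F2(3) F3(3) bd[OF nV Y(2)[OF y]] bd[OF Y(2)[OF y] x(1)] bd[OF x(1) wV] by linarith
      then show ?thesis using F1 F2 F3 by (intro near_at[OF Y(5)[OF y] w(1) cn _ _ av]) auto
    qed
    obtain K where K: "\<And>e. finite {f. near (3 * Dm + 2) e f}" using near_finite[of "3 * Dm + 2"] by metis
    have "finite (\<Union>{f. near (3 * Dm + 2) {c, w} f})"
      using K edge_card by (intro finite_Union) (auto simp: near_def)
    moreover have "\<nu> ` Y \<subseteq> \<Union>{f. near (3 * Dm + 2) {c, w} f}" using nr near_sym by blast
    ultimately show False using inf\<nu> finite_subset by blast
  qed
qed

end

section \<open>From geodesics as lists to geodesics as functions\<close>

context conn_graph
begin

lemma geodesic_list:
  assumes g: "geo s k a b" shows "geodesic V E (map s [0..<Suc k])"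
    "hd (map s [0..<Suc k]) = a" "last (map s [0..<Suc k]) = b"
proof -
  show h: "hd (map s [0..<Suc k]) = a" using geo_0[OF g] by (simp add: hd_map upt_conv_Cons del: upt_Suc)
  show l: "last (map s [0..<Suc k]) = b" using geo_k[OF g] by simp
  have "walk V E (map s [0..<Suc k])" unfolding walk_def
  proof (intro conjI allI impI)
    show "set (map s [0..<Suc k]) \<subseteq> V"
      unfolding set_map set_upt image_subset_iff using geo_V[OF g] by (simp add: less_Suc_eq_le)
    fix i assume "Suc i < length (map s [0..<Suc k])"
    then have i: "i < k" by simp
    then show "{map s [0..<Suc k] ! i, map s [0..<Suc k] ! Suc i} \<in> E"
      using geo_E[OF g i] by (simp add: nth_append del: upt_Suc)
  qed simp
  then show "geodesic V E (map s [0..<Suc k])" unfolding geodesic_def h l using geo_len[OF g] by simp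
qed

lemma thin_of_delta:
  assumes D: "delta_hyperbolic V E D" and s: "geo s k a b" and t: "geo t l b c" and r: "geo r m a c" and i: "i \<le> k"
  shows "(\<exists>j\<le>l. d (s i) (t j) \<le> nat \<lceil>D\<rceil>) \<or> (\<exists>j\<le>m. d (s i) (r j) \<le> nat \<lceil>D\<rceil>)"
proof -
  \<comment> \<open>In \<open>delta_hyperbolic\<close> the sides run cyclically, so the side from
    \<open>a\<close> to \<open>c\<close> is reversed.\<close>
  let ?p = "map s [0..<Suc k]" and ?q = "map t [0..<Suc l]" and ?r = "map (\<lambda>i. r (m - i)) [0..<Suc m]"
  note P = geodesic_list[OF s] and Q = geodesic_list[OF t] and R = geodesic_list[OF geo_rev[OF r]]
  have "s i \<in> set ?p" unfolding set_map set_upt using i by (intro imageI) auto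
  then obtain y where y: "y \<in> set ?q \<union> set ?r" "real (d (s i) y) \<le> D"
    using D[unfolded delta_hyperbolic_def, rule_format, of ?p ?q ?r "s i"] P Q R by metis
  have le: "d (s i) y \<le> nat \<lceil>D\<rceil>" using y(2) by linarith
  from y(1) show ?thesis
  proof
    assume "y \<in> set ?q"
    then obtain j where "j \<in> {0..<Suc l}" "y = t j" unfolding set_map set_upt by blast
    then show ?thesis using le by (intro disjI1 exI[of _ j]) auto
  next
    assume "y \<in> set ?r"
    then obtain j where "j \<in> {0..<Suc m}" "y = r (m - j)" unfolding set_map set_upt by blast
    then show ?thesis using le by (intro disjI2 exI[of _ "m - j"]) auto
  qed
qed

end

section \<open>A Hilbert space of functions determined by square summable coordinates\<close>

lemma cring_complex_ring: "cring complex_ring"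
proof (rule cringI)
  show "abelian_group complex_ring"
    by (rule abelian_groupI) (auto simp: complex_ring_def intro: exI[of _ "- x" for x])
  show "comm_monoid complex_ring"
    by (rule comm_monoidI) (auto simp: complex_ring_def)
qed (auto simp: complex_ring_def algebra_simps)

text \<open>The vectors are functions, the coordinates their values at the points \<open>e i\<close>; the injection
  \<open>\<iota>\<close> moves the vectors to an arbitrary type.\<close>
locale func_space =
  fixes F :: "('x \<Rightarrow> complex) set" and I :: "'i set" and e :: "'i \<Rightarrow> 'x" and w :: "'i \<Rightarrow> real"
    and \<iota> :: "('x \<Rightarrow> complex) \<Rightarrow> 'h"
  assumes F_zero: "(\<lambda>_. 0) \<in> F"
    and F_add: "f \<in> F \<Longrightarrow> g \<in> F \<Longrightarrow> (\<lambda>x. f x + g x) \<in> F"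
    and F_scale: "f \<in> F \<Longrightarrow> (\<lambda>x. a * f x) \<in> F"
    and F_sum: "f \<in> F \<Longrightarrow> (\<lambda>i. w i * (cmod (f (e i)))\<^sup>2) summable_on I"
    and F_det: "f \<in> F \<Longrightarrow> (\<And>i. i \<in> I \<Longrightarrow> f (e i) = 0) \<Longrightarrow> f = (\<lambda>_. 0)"
    and F_complete: "(\<And>k. fk k \<in> F) \<Longrightarrow> (\<And>i. i \<in> I \<Longrightarrow> (\<lambda>k::nat. fk k (e i)) \<longlonglongrightarrow> y i) \<Longrightarrow>
      (\<lambda>i. w i * (cmod (y i))\<^sup>2) summable_on I \<Longrightarrow> \<exists>g\<in>F. \<forall>i\<in>I. g (e i) = y i"
    and w_pos: "i \<in> I \<Longrightarrow> 0 < w i"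
    and inj: "inj_on \<iota> F"
begin

definition nm :: "('x \<Rightarrow> complex) \<Rightarrow> real" where
  "nm f = sqrt (infsum (\<lambda>i. w i * (cmod (f (e i)))\<^sup>2) I)"

definition ipF :: "('x \<Rightarrow> complex) \<Rightarrow> ('x \<Rightarrow> complex) \<Rightarrow> complex" where
  "ipF f g = infsum (\<lambda>i. of_real (w i) * f (e i) * cnj (g (e i))) I"

definition \<kappa> :: "'h \<Rightarrow> 'x \<Rightarrow> complex" where "\<kappa> = inv_into F \<iota>"

definition H :: "'h ip_space" where
  "H = \<lparr>carrier = \<iota> ` F, mult = (\<lambda>a b. a), one = \<iota> (\<lambda>_. 0), zero = \<iota> (\<lambda>_. 0),
     add = (\<lambda>a b. \<iota> (\<lambda>x. \<kappa> a x + \<kappa> b x)), smult = (\<lambda>c a. \<iota> (\<lambda>x. c * \<kappa> a x)),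
     ip = (\<lambda>a b. ipF (\<kappa> a) (\<kappa> b))\<rparr>"

lemma H_simps [simp]: "carrier H = \<iota> ` F" "zero H = \<iota> (\<lambda>_. 0)"
  "add H a b = \<iota> (\<lambda>x. \<kappa> a x + \<kappa> b x)" "smult H c a = \<iota> (\<lambda>x. c * \<kappa> a x)"
  "ip H a b = ipF (\<kappa> a) (\<kappa> b)"
  by (simp_all add: H_def)

lemma \<kappa> [simp]: "f \<in> F \<Longrightarrow> \<kappa> (\<iota> f) = f"
  using inj by (simp add: \<kappa>_def)

lemma \<kappa>_F: "a \<in> \<iota> ` F \<Longrightarrow> \<kappa> a \<in> F" and \<iota>_\<kappa>: "a \<in> \<iota> ` F \<Longrightarrow> \<iota> (\<kappa> a) = a"
  by auto

lemma F_diff: "f \<in> F \<Longrightarrow> g \<in> F \<Longrightarrow> (\<lambda>x. f x - g x) \<in> F"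
  using F_add[of f "\<lambda>x. (-1) * g x"] F_scale[of g "-1"] by simp

lemma F_lincomb: "finite K \<Longrightarrow> (\<And>k. k \<in> K \<Longrightarrow> f k \<in> F) \<Longrightarrow> (\<lambda>x. \<Sum>k\<in>K. a k * f k x) \<in> F"
proof (induction K rule: finite_induct)
  case (insert k K)
  then have "(\<lambda>x. a k * f k x) \<in> F" "(\<lambda>x. \<Sum>k\<in>K. a k * f k x) \<in> F" using F_scale by auto
  from F_add[OF this] show ?case using insert by simp
qed (simp add: F_zero)

lemma pos: "i \<in> I \<Longrightarrow> 0 \<le> w i * (cmod z)\<^sup>2"
  using w_pos[of i] by simp

lemma nsq_ge0: "0 \<le> infsum (\<lambda>i. w i * (cmod (f (e i)))\<^sup>2) I"
  using pos by (intro infsum_nonneg)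

lemma nm_ge0: "0 \<le> nm f"
  unfolding nm_def using nsq_ge0 by simp

lemma L2_sq: "S \<subseteq> I \<Longrightarrow> (L2_set (\<lambda>i. sqrt (w i) * cmod (y i)) S)\<^sup>2 = (\<Sum>i\<in>S. w i * (cmod (y i))\<^sup>2)"
  unfolding L2_set_def using pos w_pos
  by (subst real_sqrt_pow2) (auto simp: power_mult_distrib less_imp_le subset_iff intro!: sum_nonneg sum.cong)

lemma L2_le: assumes "f \<in> F" "finite S" "S \<subseteq> I" shows "L2_set (\<lambda>i. sqrt (w i) * cmod (f (e i))) S \<le> nm f"
proof -
  have "(\<Sum>i\<in>S. w i * (cmod (f (e i)))\<^sup>2) \<le> infsum (\<lambda>i. w i * (cmod (f (e i)))\<^sup>2) I"
    using F_sum[OF assms(1)] assms pos by (intro finite_sum_le_infsum) auto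
  then show ?thesis unfolding nm_def L2_sq[OF assms(3), of "\<lambda>i. f (e i)", symmetric] by (rule real_le_rsqrt)
qed

lemma sum_le_of_L2:
  assumes "0 \<le> B" "S \<subseteq> I" "L2_set (\<lambda>i. sqrt (w i) * cmod (y i)) S \<le> B"
  shows "(\<Sum>i\<in>S. w i * (cmod (y i))\<^sup>2) \<le> B\<^sup>2"
  unfolding L2_sq[OF assms(2), symmetric] using assms by (intro power_mono) (auto simp: L2_set_nonneg)

lemma nm_leI:
  assumes "f \<in> F" "0 \<le> B" "\<And>S. finite S \<Longrightarrow> S \<subseteq> I \<Longrightarrow> L2_set (\<lambda>i. sqrt (w i) * cmod (f (e i))) S \<le> B"
  shows "nm f \<le> B"
proof -
  have "infsum (\<lambda>i. w i * (cmod (f (e i)))\<^sup>2) I \<le> B\<^sup>2"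
    using sum_le_of_L2[OF assms(2) _ assms(3)] by (intro infsum_le_finite_sums[OF F_sum[OF assms(1)]]) auto
  then have "nm f \<le> sqrt (B\<^sup>2)" unfolding nm_def by (rule real_sqrt_le_mono)
  then show ?thesis using assms(2) by simp
qed

lemma coord_le: "f \<in> F \<Longrightarrow> i \<in> I \<Longrightarrow> sqrt (w i) * cmod (f (e i)) \<le> nm f"
  using L2_le[of f "{i}"] w_pos[of i] by simp

lemma L2_tri:
  assumes "S \<subseteq> I"
  shows "L2_set (\<lambda>i. sqrt (w i) * cmod (y i + z i)) S \<le>
    L2_set (\<lambda>i. sqrt (w i) * cmod (y i)) S + L2_set (\<lambda>i. sqrt (w i) * cmod (z i)) S"
proof -
  have "L2_set (\<lambda>i. sqrt (w i) * cmod (y i + z i)) S \<le> L2_set (\<lambda>i. sqrt (w i) * cmod (y i) + sqrt (w i) * cmod (z i)) S"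
  proof (rule L2_set_mono)
    fix i assume "i \<in> S"
    then have "0 \<le> sqrt (w i)" using assms w_pos by (auto simp: less_imp_le)
    then show "sqrt (w i) * cmod (y i + z i) \<le> sqrt (w i) * cmod (y i) + sqrt (w i) * cmod (z i)"
      "0 \<le> sqrt (w i) * cmod (y i + z i)"
      by (auto simp: distrib_left[symmetric] intro: mult_left_mono norm_triangle_ineq)
  qed
  also note L2_set_triangle_ineq
  finally show ?thesis .
qed

lemma nm_tri: assumes "f \<in> F" "g \<in> F" shows "nm (\<lambda>x. f x + g x) \<le> nm f + nm g"
proof (rule nm_leI[OF F_add[OF assms]])
  fix S assume S: "finite S" "S \<subseteq> I"
  show "L2_set (\<lambda>i. sqrt (w i) * cmod (f (e i) + g (e i))) S \<le> nm f + nm g"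
    using L2_tri[OF S(2), of "\<lambda>i. f (e i)" "\<lambda>i. g (e i)"] L2_le[OF assms(1) S] L2_le[OF assms(2) S] by linarith
qed (use nm_ge0 in \<open>auto intro: add_nonneg_nonneg\<close>)

lemma nm_scale: "nm (\<lambda>x. a * f x) = cmod a * nm f"
proof -
  have "(\<lambda>i. w i * (cmod (a * f (e i)))\<^sup>2) = (\<lambda>i. (cmod a)\<^sup>2 * (w i * (cmod (f (e i)))\<^sup>2))"
    by (simp add: norm_mult power_mult_distrib mult_ac)
  then show ?thesis unfolding nm_def by (simp add: infsum_cmult_right' real_sqrt_mult)
qed

lemma nm_0: assumes "f \<in> F" shows "nm f = 0 \<longleftrightarrow> f = (\<lambda>_. 0)"
proof
  assume 0: "nm f = 0"
  show "f = (\<lambda>_. 0)"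
  proof (rule F_det[OF assms])
    fix i assume i: "i \<in> I"
    then have "sqrt (w i) * cmod (f (e i)) \<le> 0" using coord_le[OF assms i] 0 by simp
    moreover have "0 < sqrt (w i)" using w_pos[OF i] by simp
    ultimately show "f (e i) = 0" by (simp add: mult_le_0_iff)
  qed
qed (simp add: nm_def)

lemma nm_diff_comm: "nm (\<lambda>x. f x - g x) = nm (\<lambda>x. g x - f x)"
  by (simp add: nm_def norm_minus_commute)

lemma ip_summable:
  assumes "f \<in> F" "g \<in> F" shows "(\<lambda>i. of_real (w i) * f (e i) * cnj (g (e i))) summable_on I"
proof (rule abs_summable_summable, rule Infinite_Sum.abs_summable_on_comparison_test'[OF summable_on_add[OF F_sum[OF assms(1)] F_sum[OF assms(2)]]])
  fix i assume i: "i \<in> I"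
  have "cmod (f (e i)) * cmod (g (e i)) \<le> (cmod (f (e i)))\<^sup>2 + (cmod (g (e i)))\<^sup>2"
    using sum_squares_bound[of "cmod (f (e i))" "cmod (g (e i))"]
      mult_nonneg_nonneg[OF norm_ge_zero norm_ge_zero, of "f (e i)" "g (e i)"] by linarith
  then have "w i * (cmod (f (e i)) * cmod (g (e i))) \<le> w i * ((cmod (f (e i)))\<^sup>2 + (cmod (g (e i)))\<^sup>2)"
    using w_pos[OF i] by (intro mult_left_mono) auto
  then show "cmod (of_real (w i) * f (e i) * cnj (g (e i))) \<le> w i * (cmod (f (e i)))\<^sup>2 + w i * (cmod (g (e i)))\<^sup>2"
    using w_pos[OF i] by (simp add: norm_mult algebra_simps)
qed

lemma ipF_add: assumes "f \<in> F" "g \<in> F" "h \<in> F" shows "ipF (\<lambda>x. f x + g x) h = ipF f h + ipF g h"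
  using infsum_add[OF ip_summable[OF assms(1,3)] ip_summable[OF assms(2,3)]]
  by (simp add: ipF_def algebra_simps)

lemma ipF_scale: "ipF (\<lambda>x. a * f x) g = a * ipF f g"
  unfolding ipF_def infsum_cmult_right'[symmetric] by (simp add: mult_ac)

lemma ipF_cnj: "ipF g f = cnj (ipF f g)"
  unfolding ipF_def infsum_cnj[symmetric] by (simp add: mult_ac)

lemma ipF_self: assumes "f \<in> F" shows "Re (ipF f f) = (nm f)\<^sup>2"
proof -
  have "Re (of_real (w i) * f (e i) * cnj (f (e i))) = w i * (cmod (f (e i)))\<^sup>2" for i
    by (simp add: mult.assoc complex_norm_square[symmetric] flip: of_real_mult of_real_power)
  then show ?thesis unfolding ipF_def infsum_Re[OF ip_summable[OF assms assms], symmetric] nm_def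
    using nsq_ge0[of f] by simp
qed

lemma ipF_lincomb:
  "finite K \<Longrightarrow> (\<And>k. k \<in> K \<Longrightarrow> f k \<in> F) \<Longrightarrow> g \<in> F \<Longrightarrow>
   ipF (\<lambda>x. \<Sum>k\<in>K. a k * f k x) g = (\<Sum>k\<in>K. a k * ipF (f k) g)"
proof (induction K rule: finite_induct)
  case empty then show ?case by (simp add: ipF_def)
next
  case (insert k K)
  then show ?case using ipF_add[OF F_scale F_lincomb[of K f], of "f k" g "a k" a] by (simp add: ipF_scale)
qed

lemma vnorm_H: "a \<in> \<iota> ` F \<Longrightarrow> vnorm H a = nm (\<kappa> a)"
  using nm_ge0 by (auto simp: vnorm_def ipF_self)

lemma abelian_H: "abelian_group H"
proof (rule abelian_groupI)
  fix x assume "x \<in> carrier H"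
  then obtain f where f: "x = \<iota> f" "f \<in> F" by auto
  have g: "(\<lambda>x. (-1) * f x) \<in> F" by (rule F_scale[OF f(2)])
  show "\<exists>y\<in>carrier H. y \<oplus>\<^bsub>H\<^esub> x = \<zero>\<^bsub>H\<^esub>"
    using f g \<kappa>[OF g] by (intro bexI[of _ "\<iota> (\<lambda>x. (-1) * f x)"]) auto
qed (auto simp: F_add F_zero algebra_simps)

lemma minus_H: assumes "f \<in> F" "g \<in> F" shows "\<iota> f \<ominus>\<^bsub>H\<^esub> \<iota> g = \<iota> (\<lambda>x. f x - g x)"
proof -
  interpret abelian_group H by (rule abelian_H)
  have m: "(\<lambda>x. (-1) * g x) \<in> F" by (rule F_scale[OF assms(2)])
  have "\<ominus>\<^bsub>H\<^esub> \<iota> g = \<iota> (\<lambda>x. (-1) * g x)"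
    by (rule minus_equality) (use assms m \<kappa>[OF m] in auto)
  then show ?thesis using assms \<kappa>[OF m] by (simp add: a_minus_def)
qed

lemma minus_H': "a \<in> \<iota> ` F \<Longrightarrow> b \<in> \<iota> ` F \<Longrightarrow> a \<ominus>\<^bsub>H\<^esub> b = \<iota> (\<lambda>x. \<kappa> a x - \<kappa> b x)"
  using minus_H by auto

lemma vdist_H: "f \<in> F \<Longrightarrow> g \<in> F \<Longrightarrow> vdist H (\<iota> f) (\<iota> g) = nm (\<lambda>x. f x - g x)"
  using F_diff[of f g] by (simp add: vdist_def minus_H vnorm_H)

lemma metric_H: "Metric_space (carrier H) (vdist H)"
proof
  fix x y z
  show "0 \<le> vdist H x y"
    using vdist_H nm_ge0 by (auto simp: vdist_def[of H x y] minus_H' vnorm_H F_diff \<kappa>_F)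
  show "vdist H x y = vdist H y x"
    using nm_diff_comm[of "\<kappa> x" "\<kappa> y"] by (auto simp: vdist_def minus_H' vnorm_H F_diff \<kappa>_F)
  assume xy: "x \<in> carrier H" "y \<in> carrier H"
  then obtain f g where f: "x = \<iota> f" "f \<in> F" "y = \<iota> g" "g \<in> F" by auto
  have "nm (\<lambda>x. f x - g x) = 0 \<longleftrightarrow> f = g" unfolding nm_0[OF F_diff[OF f(2,4)]] by (auto simp: fun_eq_iff)
  then show "(vdist H x y = 0) = (x = y)" using f inj by (auto simp: vdist_H inj_on_eq_iff)
  assume "z \<in> carrier H"
  then obtain h where h: "z = \<iota> h" "h \<in> F" by auto
  show "vdist H x z \<le> vdist H x y + vdist H y z"
    using nm_tri[OF F_diff[OF f(2,4)] F_diff[OF f(4) h(2)]] f h by (simp add: vdist_H)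
qed

text \<open>The coordinates converge, and all estimates are passed to the limit on finite sets of
  coordinates; \<open>F_complete\<close> then turns the limit coordinates into an element of
  \<open>F\<close>.\<close>

lemma nm_Cauchy_limit:
  fixes f :: "nat \<Rightarrow> 'x \<Rightarrow> complex"
  assumes f: "\<And>k. f k \<in> F" and C: "\<And>\<epsilon>. \<epsilon> > 0 \<Longrightarrow> \<exists>N. \<forall>n\<ge>N. \<forall>m\<ge>N. nm (\<lambda>x. f n x - f m x) < \<epsilon>"
  shows "\<exists>g\<in>F. \<forall>\<epsilon>>0. \<exists>N. \<forall>n\<ge>N. nm (\<lambda>x. f n x - g x) < \<epsilon>"
proof -
  have "\<exists>y. (\<lambda>k. f k (e i)) \<longlonglongrightarrow> y" if i: "i \<in> I" for i
  proof -
    have "Cauchy (\<lambda>k. f k (e i))"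
    proof (rule metric_CauchyI)
      fix \<epsilon> :: real assume "\<epsilon> > 0"
      then have "sqrt (w i) * \<epsilon> > 0" using w_pos[OF i] by simp
      then obtain N where N: "\<forall>n\<ge>N. \<forall>m\<ge>N. nm (\<lambda>x. f n x - f m x) < sqrt (w i) * \<epsilon>" using C by blast
      have "dist (f m (e i)) (f n (e i)) < \<epsilon>" if "m \<ge> N" "n \<ge> N" for m n
      proof -
        have "sqrt (w i) * cmod (f m (e i) - f n (e i)) < sqrt (w i) * \<epsilon>"
          using coord_le[OF F_diff[OF f f] i, of m n] N that by fastforce
        then show ?thesis using w_pos[OF i] by (simp add: dist_norm)
      qed
      then show "\<exists>M. \<forall>m\<ge>M. \<forall>n\<ge>M. dist (f m (e i)) (f n (e i)) < \<epsilon>" by blast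
    qed
    then show ?thesis using Cauchy_convergent_iff convergent_def by blast
  qed
  then obtain y where y: "\<And>i. i \<in> I \<Longrightarrow> (\<lambda>k. f k (e i)) \<longlonglongrightarrow> y i" by metis
  have lim: "L2_set (\<lambda>i. sqrt (w i) * cmod (f n (e i) - y i)) S \<le> \<epsilon>"
    if N: "\<forall>n\<ge>N. \<forall>m\<ge>N. nm (\<lambda>x. f n x - f m x) < \<epsilon>" and n: "n \<ge> N" and S: "finite S" "S \<subseteq> I" for n N \<epsilon> S
  proof (rule LIMSEQ_le_const2)
    show "(\<lambda>m. L2_set (\<lambda>i. sqrt (w i) * cmod (f n (e i) - f m (e i))) S) \<longlonglongrightarrow>
        L2_set (\<lambda>i. sqrt (w i) * cmod (f n (e i) - y i)) S"
      unfolding L2_set_def using y S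
      by (intro tendsto_real_sqrt tendsto_sum tendsto_power tendsto_mult tendsto_norm tendsto_diff tendsto_const) auto
    show "\<exists>N. \<forall>m\<ge>N. L2_set (\<lambda>i. sqrt (w i) * cmod (f n (e i) - f m (e i))) S \<le> \<epsilon>"
      using L2_le[OF F_diff[OF f f] S, of n] N n by (meson less_imp_le order_trans)
  qed
  obtain N1 where N1: "\<forall>n\<ge>N1. \<forall>m\<ge>N1. nm (\<lambda>x. f n x - f m x) < 1" using C[of 1] by auto
  define B where "B = 1 + nm (f N1)"
  have "(\<Sum>i\<in>S. w i * (cmod (y i))\<^sup>2) \<le> B\<^sup>2" if S: "finite S" "S \<subseteq> I" for S
  proof (rule sum_le_of_L2[OF _ S(2)])
    show "0 \<le> B" using nm_ge0[of "f N1"] by (simp add: B_def)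
    have "L2_set (\<lambda>i. sqrt (w i) * cmod (- (f N1 (e i) - y i) + f N1 (e i))) S \<le>
       L2_set (\<lambda>i. sqrt (w i) * cmod (- (f N1 (e i) - y i))) S + L2_set (\<lambda>i. sqrt (w i) * cmod (f N1 (e i))) S"
      by (rule L2_tri[OF S(2)])
    moreover have "L2_set (\<lambda>i. sqrt (w i) * cmod (- (f N1 (e i) - y i))) S \<le> 1"
      unfolding norm_minus_cancel using lim[OF N1 order_refl S] .
    ultimately show "L2_set (\<lambda>i. sqrt (w i) * cmod (y i)) S \<le> B"
      using L2_le[OF f S, of N1] by (simp add: B_def)
  qed
  then have "(\<lambda>i. w i * (cmod (y i))\<^sup>2) summable_on I"
    using pos by (intro nonneg_bdd_above_summable_on bdd_aboveI2[of _ _ "B\<^sup>2"]) auto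
  then obtain g where g: "g \<in> F" "\<forall>i\<in>I. g (e i) = y i" using F_complete[OF f y] by blast
  show ?thesis
  proof (intro bexI[OF _ g(1)] allI impI)
    fix \<epsilon> :: real assume \<epsilon>: "\<epsilon> > 0"
    then obtain N where N: "\<forall>n\<ge>N. \<forall>m\<ge>N. nm (\<lambda>x. f n x - f m x) < \<epsilon> / 2" using C[of "\<epsilon> / 2"] by auto
    have "nm (\<lambda>x. f n x - g x) \<le> \<epsilon> / 2" if n: "n \<ge> N" for n
    proof (rule nm_leI[OF F_diff[OF f g(1)]])
      fix S assume S: "finite S" "S \<subseteq> I"
      have "L2_set (\<lambda>i. sqrt (w i) * cmod (f n (e i) - g (e i))) S = L2_set (\<lambda>i. sqrt (w i) * cmod (f n (e i) - y i)) S"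
        using g(2) S by (intro L2_set_cong) auto
      then show "L2_set (\<lambda>i. sqrt (w i) * cmod (f n (e i) - g (e i))) S \<le> \<epsilon> / 2" using lim[OF N n S] by simp
    qed (use \<epsilon> in simp)
    then show "\<exists>N. \<forall>n\<ge>N. nm (\<lambda>x. f n x - g x) < \<epsilon>" using \<epsilon> by (intro exI[of _ N]) fastforce
  qed
qed

lemma hilbert_H: "hilbert_space H"
  unfolding hilbert_space_def
proof (intro conjI)
  show "Module.module complex_ring H"
    by (rule moduleI[OF cring_complex_ring abelian_H])
      (auto simp: complex_ring_def F_add F_scale algebra_simps)
  interpret Metric_space "carrier H" "vdist H" by (rule metric_H)
  show "Metric_space.mcomplete (carrier H) (vdist H)"
    unfolding mcomplete_def
  proof (intro allI impI)
    fix \<sigma> assume M: "MCauchy \<sigma>"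
    then have "range \<sigma> \<subseteq> carrier H" unfolding MCauchy_def by blast
    then have \<sigma>: "\<sigma> k \<in> \<iota> ` F" for k by auto
    define f where "f = (\<lambda>k. \<kappa> (\<sigma> k))"
    have f: "f k \<in> F" "\<sigma> k = \<iota> (f k)" for k using \<sigma>[of k] by (auto simp: f_def)
    have C: "\<exists>N. \<forall>n\<ge>N. \<forall>m\<ge>N. nm (\<lambda>x. f n x - f m x) < \<epsilon>" if "\<epsilon> > 0" for \<epsilon>
      using M that unfolding MCauchy_def f(2) vdist_H[OF f(1) f(1)] by meson
    obtain g where g: "g \<in> F" "\<forall>\<epsilon>>0. \<exists>N. \<forall>n\<ge>N. nm (\<lambda>x. f n x - g x) < \<epsilon>"
      using nm_Cauchy_limit[OF f(1) C] by blast
    have "limitin mtopology \<sigma> (\<iota> g) sequentially"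
      unfolding limit_metric_sequentially f(2) vdist_H[OF f(1) g(1)] using g f(1) by auto
    then show "\<exists>x. limitin mtopology \<sigma> x sequentially" by blast
  qed
  show "\<forall>x\<in>carrier H. x \<noteq> \<zero>\<^bsub>H\<^esub> \<longrightarrow> 0 < Re (ip H x x)"
  proof (intro ballI impI)
    fix x assume "x \<in> carrier H" and ne: "x \<noteq> \<zero>\<^bsub>H\<^esub>"
    then obtain f where f: "x = \<iota> f" "f \<in> F" by auto
    then have "nm f \<noteq> 0" using nm_0 ne by auto
    then show "0 < Re (ip H x x)" using f by (simp add: ipF_self)
  qed
qed (auto simp: ipF_add ipF_scale F_add F_scale intro: ipF_cnj)

text \<open>The hypothesis with \<open>C\<close> makes the set in the infimum of
  \<open>op_norm\<close> nonempty; \<open>\<bar>C\<bar>\<close> belongs to it, as \<open>C\<close>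
  may be negative when all norms vanish.\<close>

lemma vnorm_le_op_norm:
  assumes C: "\<And>x. x \<in> carrier H \<Longrightarrow> vnorm H (A x) \<le> C * vnorm H x" and x: "x \<in> carrier H"
  shows "vnorm H (A x) \<le> op_norm H A * vnorm H x"
proof (cases "vnorm H x = 0")
  case True
  then show ?thesis using C[OF x] by simp
next
  case False
  then have p: "vnorm H x > 0" using vnorm_H[of x] x nm_ge0[of "\<kappa> x"] by simp
  have "vnorm H (A x) / vnorm H x \<le> op_norm H A"
    unfolding op_norm_def
  proof (rule cInf_greatest)
    have "\<bar>C\<bar> \<in> {C. 0 \<le> C \<and> (\<forall>x\<in>carrier H. vnorm H (A x) \<le> C * vnorm H x)}"
    proof (intro CollectI conjI ballI)
      fix z assume z: "z \<in> carrier H"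
      then have "C * vnorm H z \<le> \<bar>C\<bar> * vnorm H z" using vnorm_H[of z] nm_ge0[of "\<kappa> z"] by (intro mult_right_mono) auto
      then show "vnorm H (A z) \<le> \<bar>C\<bar> * vnorm H z" using C[OF z] by linarith
    qed simp
    then show "{C. 0 \<le> C \<and> (\<forall>x\<in>carrier H. vnorm H (A x) \<le> C * vnorm H x)} \<noteq> {}" by blast
  qed (use p x in \<open>auto simp: divide_le_eq\<close>)
  then show ?thesis using p by (simp add: divide_le_eq)
qed

lemma op_norm_le:
  assumes "0 \<le> C" "\<And>x. x \<in> carrier H \<Longrightarrow> vnorm H (A x) \<le> C * vnorm H x" shows "op_norm H A \<le> C"
  unfolding op_norm_def by (rule cInf_lower) (use assms in \<open>auto intro: bdd_belowI[of _ 0]\<close>)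

end

section \<open>Integrated representations and the limit projection\<close>

lemma integral_finite_support:
  fixes \<phi> :: "'a \<Rightarrow> complex"
  assumes m: "finite_measure m" "space m = X" "sets m = Pow X" and K: "finite K" "K \<subseteq> X" "emeasure m (X - K) = 0"
  shows "integral\<^sup>L m \<phi> = (\<Sum>k\<in>K. of_real (measure m {k}) * \<phi> k)"
proof -
  interpret finite_measure m by (rule m(1))
  have ms: "f \<in> borel_measurable m" for f :: "'a \<Rightarrow> complex"
    by (rule measurableI) (use m in auto)
  have sing: "{k} \<in> sets m" if "k \<in> K" for k using that K m by auto
  have int: "integrable m (\<lambda>x. indicator {k} x *\<^sub>R \<phi> k)" if "k \<in> K" for k
    using sing[OF that] by (intro integrable_scaleR_left integrable_real_indicator) (auto simp: less_top[symmetric])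
  have "AE x in m. \<phi> x = (\<Sum>k\<in>K. indicator {k} x *\<^sub>R \<phi> k)"
  proof (rule AE_I[of _ _ "X - K"])
    have "(\<Sum>k\<in>K. indicator {k} x *\<^sub>R \<phi> k) = \<phi> x" if "x \<in> K" for x
    proof -
      have "(\<Sum>k\<in>K. indicator {k} x *\<^sub>R \<phi> k) = (\<Sum>k\<in>{x}. indicator {k} x *\<^sub>R \<phi> k)"
        using that K(1) by (intro sum.mono_neutral_right) auto
      then show ?thesis by simp
    qed
    then show "{x \<in> space m. \<phi> x \<noteq> (\<Sum>k\<in>K. indicator {k} x *\<^sub>R \<phi> k)} \<subseteq> X - K" using m by auto
  qed (use K m in auto)
  then have "integral\<^sup>L m \<phi> = integral\<^sup>L m (\<lambda>x. \<Sum>k\<in>K. indicator {k} x *\<^sub>R \<phi> k)"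
    by (rule integral_cong_AE[OF ms ms])
  also have "\<dots> = (\<Sum>k\<in>K. integral\<^sup>L m (\<lambda>x. indicator {k} x *\<^sub>R \<phi> k))"
    by (rule Bochner_Integration.integral_sum) (rule int)
  also have "\<dots> = (\<Sum>k\<in>K. of_real (measure m {k}) * \<phi> k)"
  proof (rule sum.cong[OF refl])
    fix k assume k: "k \<in> K"
    have "integral\<^sup>L m (\<lambda>x. indicator {k} x *\<^sub>R \<phi> k) = integral\<^sup>L m (indicator {k} :: 'a \<Rightarrow> real) *\<^sub>R \<phi> k"
      using sing[OF k] by (intro integral_scaleR_left) (auto simp: less_top[symmetric] intro!: integrable_real_indicator)
    also have "integral\<^sup>L m (indicator {k} :: 'a \<Rightarrow> real) = measure m {k}" using sing[OF k] sets.sets_into_space by (auto simp: Int_absorb2)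
    finally show "integral\<^sup>L m (\<lambda>x. indicator {k} x *\<^sub>R \<phi> k) = of_real (measure m {k}) * \<phi> k"
      by (simp add: scaleR_conv_of_real)
  qed
  finally show ?thesis .
qed

context func_space
begin

text \<open>A representation on the functions, with the total mass \<open>f x0\<close> as an invariant functional.\<close>
definition frep :: "('a, 'b) monoid_scheme \<Rightarrow> 'x \<Rightarrow> ('a \<Rightarrow> ('x \<Rightarrow> complex) \<Rightarrow> 'x \<Rightarrow> complex) \<Rightarrow> bool" where
  "frep G x0 R \<longleftrightarrow> (\<forall>g\<in>carrier G. \<forall>f\<in>F. R g f \<in> F \<and> R g f x0 = f x0 \<and> (\<forall>a. R g (\<lambda>x. a * f x) = (\<lambda>x. a * R g f x)) \<and>
      (\<forall>h\<in>F. R g (\<lambda>x. f x + h x) = (\<lambda>x. R g f x + R g h x))) \<and>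
     (\<forall>f\<in>F. R \<one>\<^bsub>G\<^esub> f = f \<and> (\<forall>g\<in>carrier G. \<forall>h\<in>carrier G. R (g \<otimes>\<^bsub>G\<^esub> h) f = R g (R h f)))"

definition lift_rep :: "('a \<Rightarrow> ('x \<Rightarrow> complex) \<Rightarrow> 'x \<Rightarrow> complex) \<Rightarrow> 'a \<Rightarrow> 'h \<Rightarrow> 'h" where
  "lift_rep R g a = \<iota> (R g (\<kappa> a))"

text \<open>In a discrete group compact support is finite, so the weak integral is a finite linear
  combination; the invariant functional has the same value on all its terms. Uniqueness of the
  vector follows by testing the difference against itself.\<close>

lemma rep_measure_mass:
  assumes R: "frep G x0 R" and m: "symmetric_compactly_supported_measure G (discrete_topology (carrier G)) m"
    and a: "a \<in> carrier H"
  shows "rep_measure H (lift_rep R) m a \<in> carrier H \<and>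
    \<kappa> (rep_measure H (lift_rep R) m a) x0 = of_real (measure m (carrier G)) * \<kappa> a x0"
proof -
  let ?X = "carrier G"
  have sp: "space m = ?X" and fm: "finite_measure m" and s: "sets m = sigma_sets ?X {U. openin (discrete_topology ?X) U}"
    using m by (simp_all add: symmetric_compactly_supported_measure_def)
  have "{U. openin (discrete_topology ?X) U} = Pow ?X" by auto
  then have status: "sets m = Pow ?X" using s sigma_algebra.sigma_sets_eq[OF sigma_algebra_Pow[of ?X]] by simp
  obtain K where K: "finite K" "K \<subseteq> ?X" "emeasure m (?X - K) = 0"
    using m by (auto simp: symmetric_compactly_supported_measure_def compactin_discrete_topology)
  define f where "f = \<kappa> a"
  have f: "f \<in> F" using a by (auto simp: f_def)
  have RF: "g \<in> K \<Longrightarrow> R g f \<in> F" and R0: "g \<in> K \<Longrightarrow> R g f x0 = f x0" for g using R f K by (auto simp: frep_def)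
  define v where "v = (\<lambda>x. \<Sum>g\<in>K. of_real (measure m {g}) * R g f x)"
  have vF: "v \<in> F" unfolding v_def by (rule F_lincomb[OF K(1) RF])
  have int: "integral\<^sup>L m \<phi> = (\<Sum>k\<in>K. of_real (measure m {k}) * \<phi> k)" for \<phi> :: "'a \<Rightarrow> complex"
    by (rule integral_finite_support[OF fm sp status K])
  have ipv: "ip H (\<iota> v) y = (\<integral>g. ip H (lift_rep R g a) y \<partial>m)" if y: "y \<in> carrier H" for y
  proof -
    have h: "\<kappa> y \<in> F" using y by auto
    have "ip H (\<iota> v) y = (\<Sum>g\<in>K. of_real (measure m {g}) * ipF (R g f) (\<kappa> y))"
      using vF ipF_lincomb[OF K(1) RF h, where a = "\<lambda>g. of_real (measure m {g})"] by (simp add: v_def)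
    also have "\<dots> = (\<integral>g. ip H (lift_rep R g a) y \<partial>m)"
      unfolding int using RF by (intro sum.cong) (auto simp: lift_rep_def f_def[symmetric])
    finally show ?thesis .
  qed
  have "rep_measure H (lift_rep R) m a = \<iota> v"
    unfolding rep_measure_def
  proof (rule the_equality)
    show "\<iota> v \<in> carrier H \<and> (\<forall>y\<in>carrier H. ip H (\<iota> v) y = (\<integral>g. ip H (lift_rep R g a) y \<partial>m))"
      using vF ipv by auto
    fix u assume u: "u \<in> carrier H \<and> (\<forall>y\<in>carrier H. ip H u y = (\<integral>g. ip H (lift_rep R g a) y \<partial>m))"
    then obtain h where h: "u = \<iota> h" "h \<in> F" by auto
    define k where "k = (\<lambda>x. h x - v x)"
    have kF: "k \<in> F" unfolding k_def by (rule F_diff[OF h(2) vF])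
    have "ip H u (\<iota> k) = ip H (\<iota> v) (\<iota> k)" using u ipv[of "\<iota> k"] kF by auto
    then have "ipF h k = ipF v k" using h vF kF by simp
    moreover have "ipF k k = ipF h k + (-1) * ipF v k"
      using ipF_add[OF h(2) F_scale[OF vF] kF, of "-1"] ipF_scale[of "-1" v k] by (simp add: k_def)
    ultimately have "(nm k)\<^sup>2 = 0" unfolding ipF_self[OF kF, symmetric] by simp
    then have "k = (\<lambda>_. 0)" using nm_0[OF kF] by simp
    then have "h = v" unfolding k_def by (auto simp: fun_eq_iff)
    then show "u = \<iota> v" using h by simp
  qed
  moreover have "v x0 = of_real (measure m ?X) * f x0"
  proof -
    have "of_real (measure m ?X) = (\<Sum>k\<in>K. of_real (measure m {k}) * (1 :: complex))"
      using int[of "\<lambda>_. 1"] sp by (simp add: scaleR_conv_of_real)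
    then show ?thesis unfolding v_def using R0 by (simp add: sum_distrib_right)
  qed
  ultimately show ?thesis using vF by (simp add: f_def)
qed

lemma bounded_lift:
  assumes R: "frep G x0 R" and g: "g \<in> carrier G" and b: "\<And>f. f \<in> F \<Longrightarrow> nm (R g f) \<le> C * nm f"
  shows "lift_rep R g \<in> bounded_ops H"
proof -
  have RF: "f \<in> F \<Longrightarrow> R g f \<in> F" for f using R g by (simp add: frep_def)
  have "\<forall>x\<in>carrier H. vnorm H (lift_rep R g x) \<le> C * vnorm H x"
    using b RF by (auto simp: lift_rep_def vnorm_H)
  then show ?thesis unfolding bounded_ops_def
    using R g RF by (auto simp: lift_rep_def F_add F_scale frep_def)
qed

lemma representation_lift:
  assumes R: "frep G x0 R" and b: "\<And>g. g \<in> carrier G \<Longrightarrow> \<exists>C. \<forall>f\<in>F. nm (R g f) \<le> C * nm f"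
    and G: "group G"
  shows "representation G (discrete_topology (carrier G)) H (lift_rep R)"
  unfolding representation_def
proof (intro conjI ballI)
  interpret group G by (rule G)
  have RF: "g \<in> carrier G \<Longrightarrow> f \<in> F \<Longrightarrow> R g f \<in> F" for f g using R by (simp add: frep_def)
  fix g assume g: "g \<in> carrier G"
  then obtain C where "\<forall>f\<in>F. nm (R g f) \<le> C * nm f" using b by blast
  then show "lift_rep R g \<in> bounded_ops H" using bounded_lift[OF R g] by blast
  fix h x assume "h \<in> carrier G" "x \<in> carrier H"
  then show "lift_rep R (g \<otimes>\<^bsub>G\<^esub> h) x = lift_rep R g (lift_rep R h x)"
    using R g RF by (auto simp: lift_rep_def frep_def)
next
  fix x assume x: "x \<in> carrier H"
  then show "lift_rep R \<one>\<^bsub>G\<^esub> x = x" using R by (auto simp: lift_rep_def frep_def)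
  have "topspace (Metric_space.mtopology (carrier H) (vdist H)) = carrier H"
    using Metric_space.topspace_mtopology[OF metric_H] .
  then show "continuous_map (discrete_topology (carrier G)) (Metric_space.mtopology (carrier H) (vdist H)) (\<lambda>g. lift_rep R g x)"
    using x R by (auto simp: lift_rep_def frep_def)
qed

text \<open>Convergence in operator norm gives convergence at each vector, and the bound
  \<open>tau\<close> makes evaluation at \<open>x0\<close> continuous.\<close>

lemma converges_value:
  assumes c: "converges_to_projection_on H A W" and tau: "\<And>f. f \<in> F \<Longrightarrow> cmod (f x0) \<le> C * nm f"
  obtains P where "P ` carrier H = W" "\<And>x. x \<in> carrier H \<Longrightarrow> P (P x) = P x"
    "\<And>x. x \<in> carrier H \<Longrightarrow> (\<lambda>n. \<kappa> (A n x) x0) \<longlonglongrightarrow> \<kappa> (P x) x0"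
proof -
  obtain P where P: "P \<in> bounded_ops H" "P ` carrier H = W" "\<forall>x\<in>carrier H. P (P x) = P x"
    "(\<lambda>n. op_norm H (\<lambda>x. A n x \<ominus>\<^bsub>H\<^esub> P x)) \<longlonglongrightarrow> 0" and A: "\<And>n. A n \<in> bounded_ops H"
    using c unfolding converges_to_projection_on_def by blast
  have cl: "B x \<in> \<iota> ` F" if "B \<in> bounded_ops H" "x \<in> carrier H" for B x using that by (auto simp: bounded_ops_def)
  have bnd: "vnorm H (A n x \<ominus>\<^bsub>H\<^esub> P x) \<le> op_norm H (\<lambda>x. A n x \<ominus>\<^bsub>H\<^esub> P x) * vnorm H x" if x: "x \<in> carrier H" for n x
  proof -
    obtain C1 C2 where C: "\<forall>x\<in>carrier H. vnorm H (A n x) \<le> C1 * vnorm H x" "\<forall>x\<in>carrier H. vnorm H (P x) \<le> C2 * vnorm H x"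
      using P(1) A[of n] unfolding bounded_ops_def by blast
    have "vnorm H (A n z \<ominus>\<^bsub>H\<^esub> P z) \<le> (C1 + C2) * vnorm H z" if z: "z \<in> carrier H" for z
    proof -
      have F1: "\<kappa> (A n z) \<in> F" "\<kappa> (P z) \<in> F" using cl[OF A z] cl[OF P(1) z] by (simp_all add: \<kappa>_F)
      have "nm (\<lambda>x. \<kappa> (A n z) x + (-1) * \<kappa> (P z) x) \<le> nm (\<kappa> (A n z)) + nm (\<lambda>x. (-1) * \<kappa> (P z) x)"
        by (rule nm_tri[OF F1(1) F_scale[OF F1(2)]])
      then have "nm (\<lambda>x. \<kappa> (A n z) x - \<kappa> (P z) x) \<le> nm (\<kappa> (A n z)) + nm (\<kappa> (P z))"
        unfolding nm_scale by simp
      then show ?thesis using C z cl[OF A z] cl[OF P(1) z] F_diff[OF F1]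
        by (fastforce simp: minus_H' vnorm_H distrib_right)
    qed
    then show ?thesis using vnorm_le_op_norm[of "\<lambda>x. A n x \<ominus>\<^bsub>H\<^esub> P x"] x by blast
  qed
  have "(\<lambda>n. \<kappa> (A n x) x0) \<longlonglongrightarrow> \<kappa> (P x) x0" if x: "x \<in> carrier H" for x
  proof (rule LIM_zero_cancel, rule Lim_null_comparison)
    show "(\<lambda>n. \<bar>C\<bar> * (op_norm H (\<lambda>x. A n x \<ominus>\<^bsub>H\<^esub> P x) * vnorm H x)) \<longlonglongrightarrow> 0"
      using tendsto_mult[OF tendsto_const[of "\<bar>C\<bar>"] tendsto_mult[OF P(4) tendsto_const[of "vnorm H x"]]] by simp
    have "cmod (\<kappa> (A n x) x0 - \<kappa> (P x) x0) \<le> \<bar>C\<bar> * (op_norm H (\<lambda>x. A n x \<ominus>\<^bsub>H\<^esub> P x) * vnorm H x)" for n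
    proof -
      have F1: "\<kappa> (A n x) \<in> F" "\<kappa> (P x) \<in> F" using cl[OF A x] cl[OF P(1) x] by (simp_all add: \<kappa>_F)
      note D = F_diff[OF F1]
      have "cmod (\<kappa> (A n x) x0 - \<kappa> (P x) x0) \<le> C * nm (\<lambda>z. \<kappa> (A n x) z - \<kappa> (P x) z)" using tau[OF D] .
      also have "\<dots> \<le> \<bar>C\<bar> * nm (\<lambda>z. \<kappa> (A n x) z - \<kappa> (P x) z)" using nm_ge0 by (intro mult_right_mono) auto
      also have "nm (\<lambda>z. \<kappa> (A n x) z - \<kappa> (P x) z) = vnorm H (A n x \<ominus>\<^bsub>H\<^esub> P x)"
        using D cl[OF A x] cl[OF P(1) x] by (simp add: minus_H' vnorm_H)
      also have "\<bar>C\<bar> * \<dots> \<le> \<bar>C\<bar> * (op_norm H (\<lambda>x. A n x \<ominus>\<^bsub>H\<^esub> P x) * vnorm H x)"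
        using bnd[OF x] by (intro mult_left_mono) auto
      finally show ?thesis .
    qed
    then show "\<forall>\<^sub>F n in sequentially. norm (\<kappa> (A n x) x0 - \<kappa> (P x) x0) \<le> \<bar>C\<bar> * (op_norm H (\<lambda>x. A n x \<ominus>\<^bsub>H\<^esub> P x) * vnorm H x)"
      by simp
  qed
  then show thesis using that[of P] P by blast
qed

text \<open>Tested on the trivial representation, the masses of the measures converge to 1; for \<open>U\<close> this forces
  the limit projection to preserve the invariant functional, which vanishes on its range.\<close>
lemma not_strong_T:
  assumes G: "group G" and len: "length_function G (discrete_topology (carrier G)) l"
    and U: "frep G x0 U"
    and growth: "\<And>t. t > 0 \<Longrightarrow> \<exists>L\<ge>0. \<forall>g\<in>carrier G. \<forall>f\<in>F. nm (U g f) \<le> L * exp (t * l g) * nm f"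
    and tau: "\<And>f. f \<in> F \<Longrightarrow> cmod (f x0) \<le> C * nm f" and f1: "f1 \<in> F" "f1 x0 \<noteq> 0"
    and inv0: "\<And>f. f \<in> F \<Longrightarrow> (\<And>g. g \<in> carrier G \<Longrightarrow> U g f = f) \<Longrightarrow> f x0 = 0"
  shows "\<not> strong_property_T TYPE('h) G (discrete_topology (carrier G))"
proof
  let ?T = "discrete_topology (carrier G)"
  assume ST: "strong_property_T TYPE('h) G ?T"
  define Q where "Q = (\<lambda>t p q. \<forall>\<pi>. representation G ?T H \<pi> \<longrightarrow>
             (\<exists>L\<ge>0. \<forall>g\<in>carrier G. op_norm H (\<pi> g) \<le> L * exp (t * l g)) \<longrightarrow>
             converges_to_projection_on H
               (\<lambda>n x. rep_measure H \<pi> (p n) x \<ominus>\<^bsub>H\<^esub> rep_measure H \<pi> (q n) x)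
               (invariants G H \<pi>))"
  \<comment> \<open>The measures are chosen before the Hilbert space and \<open>t\<close> after it;
    only the instance \<open>H\<close> is kept.\<close>
  have "\<exists>p q :: nat \<Rightarrow> 'a measure. (\<forall>n. symmetric_compactly_supported_measure G ?T (p n) \<and>
      symmetric_compactly_supported_measure G ?T (q n)) \<and> (\<exists>t>0. Q t p q)"
    unfolding Q_def
    by (rule ex_forward[OF ST[unfolded strong_property_T_def, rule_format, OF len]],
        erule ex_forward, erule conj_forward, assumption, erule allE[of _ H], erule mp[OF _ hilbert_H])
  then obtain p q t where pq: "\<And>n. symmetric_compactly_supported_measure G ?T (p n)"
    "\<And>n. symmetric_compactly_supported_measure G ?T (q n)" and t: "t > 0" and Qt: "Q t p q" by blast
  note cv = Qt[unfolded Q_def, rule_format]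
  define M where "M = (\<lambda>n. of_real (measure (p n) (carrier G)) - of_real (measure (q n) (carrier G)) :: complex)"
  have main: "\<exists>P. P ` carrier H = invariants G H (lift_rep R) \<and> (\<forall>x\<in>carrier H. P (P x) = P x) \<and>
      (\<forall>f\<in>F. (\<lambda>n. M n * f x0) \<longlonglongrightarrow> \<kappa> (P (\<iota> f)) x0)"
    if R: "frep G x0 R" and L: "L \<ge> 0" "\<And>g f. g \<in> carrier G \<Longrightarrow> f \<in> F \<Longrightarrow> nm (R g f) \<le> L * exp (t * l g) * nm f" for R L
  proof -
    have RF: "g \<in> carrier G \<Longrightarrow> f \<in> F \<Longrightarrow> R g f \<in> F" for f g using R by (simp add: frep_def)
    have rep: "representation G ?T H (lift_rep R)"
      using L(2) by (intro representation_lift[OF R _ G]) blast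
    have "op_norm H (lift_rep R g) \<le> L * exp (t * l g)" if g: "g \<in> carrier G" for g
      using L g RF by (intro op_norm_le) (auto simp: lift_rep_def vnorm_H)
    then have con: "converges_to_projection_on H
        (\<lambda>n x. rep_measure H (lift_rep R) (p n) x \<ominus>\<^bsub>H\<^esub> rep_measure H (lift_rep R) (q n) x) (invariants G H (lift_rep R))"
      by (intro cv[OF rep] exI[of _ L] conjI L(1) ballI)
    obtain P where P: "P ` carrier H = invariants G H (lift_rep R)" "\<And>x. x \<in> carrier H \<Longrightarrow> P (P x) = P x"
      "\<And>x. x \<in> carrier H \<Longrightarrow> (\<lambda>n. \<kappa> (rep_measure H (lift_rep R) (p n) x \<ominus>\<^bsub>H\<^esub> rep_measure H (lift_rep R) (q n) x) x0)
         \<longlonglongrightarrow> \<kappa> (P x) x0"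
      using converges_value[OF con tau] by blast
    have "\<kappa> (rep_measure H (lift_rep R) (p n) x \<ominus>\<^bsub>H\<^esub> rep_measure H (lift_rep R) (q n) x) x0 = M n * \<kappa> x x0"
      if x: "x \<in> carrier H" for n x
    proof -
      note a = rep_measure_mass[OF R pq(1)[of n] x] and b = rep_measure_mass[OF R pq(2)[of n] x]
      then show ?thesis using F_diff[of "\<kappa> (rep_measure H (lift_rep R) (p n) x)" "\<kappa> (rep_measure H (lift_rep R) (q n) x)"]
        by (simp add: minus_H' M_def left_diff_distrib \<kappa>_F)
    qed
    then have "(\<lambda>n. M n * f x0) \<longlonglongrightarrow> \<kappa> (P (\<iota> f)) x0" if "f \<in> F" for f
      using P(3)[of "\<iota> f"] that by simp
    then show ?thesis using P(1,2) by blast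
  qed
  \<comment> \<open>The trivial representation on the same space, so that \<open>main\<close> covers
    it together with \<open>U\<close>. All vectors are invariant, hence its limit projection is the
    identity.\<close>
  define R0 :: "'a \<Rightarrow> ('x \<Rightarrow> complex) \<Rightarrow> 'x \<Rightarrow> complex" where "R0 = (\<lambda>g f. f)"
  have R0: "frep G x0 R0" by (simp add: frep_def R0_def)
  have "nm (R0 g f) \<le> 1 * exp (t * l g) * nm f" if "g \<in> carrier G" for g f
  proof -
    have "0 \<le> t * l g" using len that t by (auto simp: length_function_def)
    then have "1 * nm f \<le> exp (t * l g) * nm f" using nm_ge0 by (intro mult_right_mono) auto
    then show ?thesis by (simp add: R0_def)
  qed
  then obtain P0 where P0: "P0 ` carrier H = invariants G H (lift_rep R0)" "\<forall>x\<in>carrier H. P0 (P0 x) = P0 x"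
    "\<forall>f\<in>F. (\<lambda>n. M n * f x0) \<longlonglongrightarrow> \<kappa> (P0 (\<iota> f)) x0" using main[OF R0, of 1] by auto
  have "invariants G H (lift_rep R0) = carrier H" by (auto simp: invariants_def lift_rep_def R0_def)
  then have "\<iota> f1 \<in> P0 ` carrier H" using P0(1) f1 by simp
  then have "P0 (\<iota> f1) = \<iota> f1" using P0(2) by auto
  then have lim1: "(\<lambda>n. M n * f1 x0) \<longlonglongrightarrow> f1 x0" using P0(3) f1 by force
  obtain L where L: "L \<ge> 0" "\<forall>g\<in>carrier G. \<forall>f\<in>F. nm (U g f) \<le> L * exp (t * l g) * nm f" using growth[OF t] by blast
  obtain P where P: "P ` carrier H = invariants G H (lift_rep U)"
    "\<forall>f\<in>F. (\<lambda>n. M n * f x0) \<longlonglongrightarrow> \<kappa> (P (\<iota> f)) x0" using main[OF U L(1)] L(2) by blast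
  have "P (\<iota> f1) \<in> invariants G H (lift_rep U)" using P(1) f1 by auto
  then obtain f where f: "P (\<iota> f1) = \<iota> f" "f \<in> F" "\<And>g. g \<in> carrier G \<Longrightarrow> \<iota> (U g f) = \<iota> f"
    by (auto simp: invariants_def lift_rep_def)
  have "U g f = f" if "g \<in> carrier G" for g
    using f(3)[OF that] f(2) inj U that by (auto simp: frep_def dest: inj_onD)
  then have "f x0 = 0" using inv0[OF f(2)] by blast
  then have "(\<lambda>n. M n * f1 x0) \<longlonglongrightarrow> 0" using P(2) f1 f by force
  from LIMSEQ_unique[OF lim1 this] show False using f1(2) by simp
qed

end

text \<open>A sequence is encoded by the rational cuts of its real and imaginary parts, a subset of
  a countable set.\<close>

lemma complex_seq_lepoll_reals: "(UNIV :: (nat \<Rightarrow> complex) set) \<lesssim> (UNIV :: real set)"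
proof -
  define j where "j = (\<lambda>f :: nat \<Rightarrow> complex. to_nat ` {(n, b, q). if b then real_of_rat q < Re (f n) else real_of_rat q < Im (f n)})"
  have "inj j"
  proof (rule injI)
    fix f g assume "j f = j g"
    then have eq: "{(n, b, q). if b then real_of_rat q < Re (f n) else real_of_rat q < Im (f n)} =
        {(n, b, q). if b then real_of_rat q < Re (g n) else real_of_rat q < Im (g n)}"
      unfolding j_def by (subst (asm) inj_image_eq_iff) auto
    have r: "x = y" if "\<And>q. real_of_rat q < x \<longleftrightarrow> real_of_rat q < y" for x y :: real
    proof (rule ccontr)
      assume "x \<noteq> y"
      then consider "x < y" | "y < x" by linarith
      then show False
      proof cases
        case 1 then obtain q where "x < real_of_rat q" "real_of_rat q < y" using of_rat_dense by blast
        then show False using that[of q] by auto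
      next
        case 2 then obtain q where "y < real_of_rat q" "real_of_rat q < x" using of_rat_dense by blast
        then show False using that[of q] by auto
      qed
    qed
    show "f = g"
    proof
      fix n
      have "Re (f n) = Re (g n)"
      proof (rule r)
        fix q
        have "(n, True, q) \<in> {(n, b, q). if b then real_of_rat q < Re (f n) else real_of_rat q < Im (f n)} \<longleftrightarrow>
          (n, True, q) \<in> {(n, b, q). if b then real_of_rat q < Re (g n) else real_of_rat q < Im (g n)}" unfolding eq ..
        then show "real_of_rat q < Re (f n) \<longleftrightarrow> real_of_rat q < Re (g n)" by simp
      qed
      moreover have "Im (f n) = Im (g n)"
      proof (rule r)
        fix q
        have "(n, False, q) \<in> {(n, b, q). if b then real_of_rat q < Re (f n) else real_of_rat q < Im (f n)} \<longleftrightarrow>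
          (n, False, q) \<in> {(n, b, q). if b then real_of_rat q < Re (g n) else real_of_rat q < Im (g n)}" unfolding eq ..
        then show "real_of_rat q < Im (f n) \<longleftrightarrow> real_of_rat q < Im (g n)" by simp
      qed
      ultimately show "f n = g n" by (rule complex_eqI)
    qed
  qed
  then have "(UNIV :: (nat \<Rightarrow> complex) set) \<lesssim> (UNIV :: nat set set)" unfolding lepoll_def by blast
  then show ?thesis using nat_sets_eqpoll_reals by (rule lepoll_trans2)
qed

text \<open>The exponent 5 is half the exponent 10 of \<open>base_bound\<close>. With
  \<open>s = t / 5\<close> one has
  \<open>x + 1 \<le> a * (1 + s * x) \<le> a * exp (s * x)\<close>.\<close>

lemma poly_le_exp:
  fixes t :: real assumes "t > 0"
  shows "\<exists>L\<ge>0. \<forall>x\<ge>0. (x + 1) ^ 5 \<le> L * exp (t * x)"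
proof -
  define s where "s = t / 5"
  define a where "a = max 1 (1 / s)"
  have s: "s > 0" using assms by (simp add: s_def)
  have a: "a \<ge> 1" "a * s \<ge> 1" using s by (auto simp: a_def field_simps max_def)
  have "(x + 1) ^ 5 \<le> a ^ 5 * exp (t * x)" if x: "x \<ge> 0" for x
  proof -
    have "x * 1 \<le> x * (a * s)" using a x by (intro mult_left_mono) auto
    then have "x + 1 \<le> a * (1 + s * x)" using a by (simp add: algebra_simps)
    also have "\<dots> \<le> a * exp (s * x)" using a exp_ge_add_one_self[of "s * x"] by (intro mult_left_mono) auto
    finally have "(x + 1) ^ 5 \<le> (a * exp (s * x)) ^ 5" using x by (intro power_mono) auto
    also have "\<dots> = a ^ 5 * exp (t * x)"
      by (simp add: power_mult_distrib exp_of_nat_mult[symmetric] s_def)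
    finally show ?thesis .
  qed
  then show ?thesis using a by (intro exI[of _ "a ^ 5"]) auto
qed

section \<open>Groups acting on fine hyperbolic graphs\<close>

lemma (in conn_graph) wlk_map:
  assumes "\<And>u v. {u, v} \<in> E \<Longrightarrow> {f u, f v} \<in> E" "\<And>v. v \<in> V \<Longrightarrow> f v \<in> V"
  shows "wlk n u v \<Longrightarrow> wlk n (f u) (f v)"
  by (induction n arbitrary: u) (use assms in \<open>auto simp: wlk_0 wlk_Suc\<close>)

locale graph_action = fine_hyp V E \<delta> + group G
  for V :: "'v set" and E :: "'v set set" and \<delta> :: nat and G :: "('a, 'b) monoid_scheme" (structure) +
  fixes act :: "'a \<Rightarrow> 'v \<Rightarrow> 'v" and c0 :: 'v
  assumes act_V: "g \<in> carrier G \<Longrightarrow> v \<in> V \<Longrightarrow> act g v \<in> V"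
    and act_E: "g \<in> carrier G \<Longrightarrow> {u, v} \<in> E \<Longrightarrow> {act g u, act g v} \<in> E"
    and act_one: "v \<in> V \<Longrightarrow> act \<one> v = v"
    and act_mult: "g \<in> carrier G \<Longrightarrow> h \<in> carrier G \<Longrightarrow> v \<in> V \<Longrightarrow> act (g \<otimes> h) v = act g (act h v)"
    and c0: "c0 \<in> V"
begin

lemma act_inv: "g \<in> carrier G \<Longrightarrow> v \<in> V \<Longrightarrow> act (inv g) (act g v) = v"
  "g \<in> carrier G \<Longrightarrow> v \<in> V \<Longrightarrow> act g (act (inv g) v) = v"
  using act_mult[of "inv g" g v] act_mult[of g "inv g" v] act_one by auto

lemma d_act: assumes g: "g \<in> carrier G" and V: "u \<in> V" "v \<in> V" shows "d (act g u) (act g v) = d u v"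
proof -
  have le: "d (act h u) (act h v) \<le> d u v" if "h \<in> carrier G" "u \<in> V" "v \<in> V" for h u v
    using that act_V act_E by (intro d_le wlk_map[OF _ _ wlk_d]) auto
  have "d u v \<le> d (act g u) (act g v)"
    using le[of "inv g" "act g u" "act g v"] g V act_V by (simp add: act_inv)
  then show ?thesis using le[OF g V] by simp
qed

lemma atom_act_iff:
  assumes g: "g \<in> carrier G" and V: "c \<in> V" "y \<in> V" "x \<in> V"
  shows "act g x \<in> atom (act g c) m (act g y) \<longleftrightarrow> x \<in> atom c m y"
proof -
  have "(\<forall>p\<in>V. d (act g c) p \<le> m \<longrightarrow> d (act g y) p + d (act g x) (act g c) = d (act g x) p + d (act g y) (act g c)) \<longleftrightarrow>
    (\<forall>p\<in>V. d (act g c) (act g p) \<le> m \<longrightarrow> d (act g y) (act g p) + d (act g x) (act g c) = d (act g x) (act g p) + d (act g y) (act g c))"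
  proof -
    have im: "act g ` V = V"
    proof
      show "act g ` V \<subseteq> V" using act_V g by auto
      show "V \<subseteq> act g ` V" using act_inv(2)[OF g] act_V[of "inv g"] g by (metis inv_closed rev_image_eqI subsetI)
    qed
    have "(\<forall>p\<in>V. Q p) \<longleftrightarrow> (\<forall>p\<in>V. Q (act g p))" for Q
    proof -
      have "(\<forall>p\<in>act g ` V. Q p) \<longleftrightarrow> (\<forall>p\<in>V. Q (act g p))" by blast
      then show ?thesis unfolding im .
    qed
    then show ?thesis .
  qed
  then show ?thesis unfolding atom_def using assms act_V by (simp add: d_act)
qed

definition pull :: "'a \<Rightarrow> ('v \<Rightarrow> complex) \<Rightarrow> 'v \<Rightarrow> complex" where
  "pull g \<phi> = (\<lambda>x. if x \<in> V then \<phi> (act g x) else 0)"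

lemma pull_ind:
  assumes g: "g \<in> carrier G" and V: "c \<in> V" "y \<in> V"
  shows "pull g (ind (atom c m y)) = ind (atom (act (inv g) c) m (act (inv g) y))"
proof
  fix x
  show "pull g (ind (atom c m y)) x = ind (atom (act (inv g) c) m (act (inv g) y)) x"
  proof (cases "x \<in> V")
    case True
    then show ?thesis using atom_act_iff[OF g, of "act (inv g) c" "act (inv g) y" x m] g V act_V
      by (simp add: pull_def ind_def act_inv)
  next
    case False
    then show ?thesis using atom_sub by (auto simp: pull_def ind_def)
  qed
qed

lemma pull_V: "g \<in> carrier G \<Longrightarrow> pull g (ind V) = ind V"
  using act_V by (auto simp: pull_def ind_def)

lemma atom_shift: "g \<in> carrier G \<Longrightarrow> D \<in> allatoms \<Longrightarrow> \<exists>D'\<in>allatoms. pull g (ind D) = ind D'"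
proof -
  assume g: "g \<in> carrier G" and "D \<in> allatoms"
  then obtain c m y where D: "D = atom c m y" "c \<in> V" "y \<in> V" "m \<le> d c y" by (auto simp: allatoms_def)
  let ?D = "atom (act (inv g) c) m (act (inv g) y)"
  have "?D \<in> allatoms" unfolding allatoms_def
    using D g act_V d_act[of "inv g" c y] by (intro CollectI exI[of _ "act (inv g) c"] exI[of _ m] exI[of _ "act (inv g) y"]) auto
  then show ?thesis using pull_ind[OF g D(2,3)] D(1) by blast
qed

lemma pull_span: assumes g: "g \<in> carrier G" shows "\<phi> \<in> atom_span \<Longrightarrow> pull g \<phi> \<in> atom_span"
proof (induction rule: atom_span.induct)
  case atom_span_0 then show ?case using atom_span.atom_span_0 by (simp add: pull_def)
next
  case (atom_span_step \<phi> D a)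
  obtain D' where D': "D' \<in> allatoms" "pull g (ind D) = ind D'" using atom_shift[OF g atom_span_step(2)] by blast
  have "pull g (\<lambda>x. \<phi> x + a * ind D x) = (\<lambda>x. pull g \<phi> x + a * pull g (ind D) x)" by (auto simp: pull_def)
  then show ?case using atom_span.atom_span_step[OF atom_span_step(3) D'(1), of a] D'(2) by simp
qed

lemma atom_span_off: "\<phi> \<in> atom_span \<Longrightarrow> x \<notin> V \<Longrightarrow> \<phi> x = 0"
  by (induction rule: atom_span.induct) (use atom_sub in \<open>auto simp: allatoms_def ind_def\<close>)

lemma pull_one: "\<phi> \<in> atom_span \<Longrightarrow> pull \<one> \<phi> = \<phi>"
  using atom_span_off act_one by (auto simp: pull_def)

lemma pull_mult: "g \<in> carrier G \<Longrightarrow> h \<in> carrier G \<Longrightarrow> pull h (pull g \<phi>) = pull (g \<otimes> h) \<phi>"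
  using act_V act_mult by (auto simp: pull_def)

text \<open>The dual action: the order reversal in \<open>pull_mult\<close> is undone by dualising,
  so this is a left action.\<close>

definition transl :: "'a \<Rightarrow> (('v \<Rightarrow> complex) \<Rightarrow> complex) \<Rightarrow> ('v \<Rightarrow> complex) \<Rightarrow> complex" where
  "transl g F \<phi> = (if \<phi> \<in> atom_span then F (pull g \<phi>) else 0)"

lemma functional_transl: assumes g: "g \<in> carrier G" and F: "functional F" shows "functional (transl g F)"
proof -
  have "pull g (\<lambda>x. \<phi> x + \<psi> x) = (\<lambda>x. pull g \<phi> x + pull g \<psi> x)" "pull g (\<lambda>x. a * \<phi> x) = (\<lambda>x. a * pull g \<phi> x)" for \<phi> \<psi> a
    by (auto simp: pull_def)
  then show ?thesis unfolding functional_def transl_def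
    using functional_add[OF F pull_span[OF g] pull_span[OF g]] functional_scale[OF F pull_span[OF g]] by (simp add: atom_span_add atom_span_scale)
qed

definition shift :: "'a \<Rightarrow> nat \<times> 'v set \<Rightarrow> nat \<times> 'v set" where
  "shift g t = (fst t, act g ` snd t)"

lemma act_atom:
  assumes g: "g \<in> carrier G" and V: "c \<in> V" "y \<in> V" shows "act g ` atom c m y = atom (act g c) m (act g y)"
proof
  show "act g ` atom c m y \<subseteq> atom (act g c) m (act g y)" using atom_act_iff[OF g V] atom_sub by blast
  show "atom (act g c) m (act g y) \<subseteq> act g ` atom c m y"
  proof
    fix x assume x: "x \<in> atom (act g c) m (act g y)"
    then have xV: "x \<in> V" using atom_sub by blast
    then have "act (inv g) x \<in> atom c m y" using atom_act_iff[OF g V, of "act (inv g) x"] x g act_V act_inv by auto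
    then show "x \<in> act g ` atom c m y" using act_inv(2)[OF g xV] by (metis imageI)
  qed
qed

lemma shift_levels:
  assumes g: "g \<in> carrier G" and c: "c \<in> V" and t: "t \<in> levels c"
  shows "shift g t \<in> levels (act g c)" "shift (inv g) (shift g t) = t"
    "transl (inv g) F (ind (snd t)) = F (ind (snd (shift g t)))"
proof -
  obtain m y where y: "t = (m, atom c m y)" "y \<in> V" "m \<le> d c y" using t by (auto simp: levels_def)
  note a = act_atom[OF g c y(2)]
  have "shift g t = (m, atom (act g c) m (act g y))" using a by (simp add: shift_def y(1))
  moreover have "act g y \<in> V" "m \<le> d (act g c) (act g y)" using y act_V[OF g y(2)] d_act[OF g c y(2)] by simp_all
  ultimately show "shift g t \<in> levels (act g c)" unfolding levels_def by blast
  show "shift (inv g) (shift g t) = t" unfolding shift_def y(1)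
    using a act_atom[of "inv g" "act g c" "act g y"] g c y(2) act_V act_inv by simp
  have "ind (atom c m y) \<in> atom_span" using y c by (intro atom_span_ind) (auto simp: allatoms_def)
  then show "transl (inv g) F (ind (snd t)) = F (ind (snd (shift g t)))"
    unfolding shift_def y(1) transl_def using pull_ind[of "inv g" c y m] g c y a by simp
qed

lemma sq_shift:
  assumes g: "g \<in> carrier G" and c: "c \<in> V" and t: "t \<in> levels c"
  shows "sq (transl (inv g) F) t = sq F (shift g t)"
  using shift_levels(3)[OF assms] by (simp add: sq_def shift_def)

lemma shift_bij:
  assumes g: "g \<in> carrier G" and c: "c \<in> V" shows "bij_betw (shift g) (levels c) (levels (act g c))"
proof (rule bij_betw_byWitness[where f' = "shift (inv g)"])
  have gc: "inv g \<in> carrier G" "act g c \<in> V" "act (inv g) (act g c) = c" using g c act_V act_inv by auto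
  show "\<forall>a\<in>levels c. shift (inv g) (shift g a) = a" using shift_levels(2)[OF g c] by blast
  show "shift g ` levels c \<subseteq> levels (act g c)" using shift_levels(1)[OF g c] by blast
  show "\<forall>a\<in>levels (act g c). shift g (shift (inv g) a) = a" using shift_levels(2)[OF gc(1,2)] g by simp
  show "shift (inv g) ` levels (act g c) \<subseteq> levels c" using shift_levels(1)[OF gc(1,2)] gc(3) by auto
qed

definition len :: "'a \<Rightarrow> real" where "len g = real (d c0 (act g c0))"

lemma len_inv: assumes "g \<in> carrier G" shows "d c0 (act (inv g) c0) = d c0 (act g c0)"
  using d_act[of g c0 "act (inv g) c0"] assms c0 act_V act_inv d_sym[of c0 "act g c0"] by simp

lemma length_len: "length_function G (discrete_topology (carrier G)) len"
  unfolding length_function_def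
proof (intro conjI ballI)
  fix g h assume gh: "g \<in> carrier G" "h \<in> carrier G"
  have V: "act g c0 \<in> V" "act h c0 \<in> V" "act g (act h c0) \<in> V" using gh c0 act_V by auto
  have "d c0 (act (g \<otimes> h) c0) \<le> d c0 (act g c0) + d (act g c0) (act g (act h c0))"
    using d_tri[OF c0 V(1) V(3)] act_mult[OF gh c0] by simp
  then show "len (g \<otimes> h) \<le> len g + len h" using d_act[OF gh(1) c0 V(2)] by (simp add: len_def)
qed (use len_inv in \<open>auto simp: len_def\<close>)

definition functionals :: "(('v \<Rightarrow> complex) \<Rightarrow> complex) set" where
  "functionals = {F. functional F \<and> sq F summable_on levels c0}"

text \<open>The coordinates of the translate seen from \<open>c0\<close> are those of
  \<open>F\<close> seen from \<open>act (inv g) c0\<close>, so \<open>base_bound\<close> applies at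
  distance \<open>len g\<close>.\<close>

lemma transl_growth:
  assumes g: "g \<in> carrier G" and F: "F \<in> functionals"
  shows "transl g F \<in> functionals" "infsum (sq (transl g F)) (levels c0) \<le> KB * (len g + 1) ^ 10 * infsum (sq F) (levels c0)"
proof -
  define h where "h = inv g"
  have h: "h \<in> carrier G" "inv h = g" "act h c0 \<in> V" using g c0 act_V by (auto simp: h_def)
  have F': "functional F" "sq F summable_on levels c0" using F by (auto simp: functionals_def)
  note B = base_bound[OF c0 h(3) F']
  have sh: "sq (transl g F) t = sq F (shift h t)" if "t \<in> levels c0" for t
    using sq_shift[OF h(1) c0 that, of F] h(2) by simp
  note bij = shift_bij[OF h(1) c0]
  have "sq (transl g F) summable_on levels c0 \<longleftrightarrow> (\<lambda>t. sq F (shift h t)) summable_on levels c0"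
    by (rule summable_on_cong) (rule sh)
  also have "\<dots> \<longleftrightarrow> sq F summable_on levels (act h c0)" by (rule summable_on_reindex_bij_betw[OF bij])
  finally show "transl g F \<in> functionals" using functional_transl[OF g F'(1)] B by (simp add: functionals_def)
  have "infsum (sq (transl g F)) (levels c0) = infsum (\<lambda>t. sq F (shift h t)) (levels c0)"
    by (rule infsum_cong) (rule sh)
  also have "\<dots> = infsum (sq F) (levels (act h c0))" by (rule infsum_reindex_bij_betw[OF bij])
  finally show "infsum (sq (transl g F)) (levels c0) \<le> KB * (len g + 1) ^ 10 * infsum (sq F) (levels c0)"
    using B len_inv[OF g] by (simp add: len_def h_def)
qed

lemma countable_levels: assumes "countable V" shows "countable (levels c)"
proof -
  have "levels c \<subseteq> (\<lambda>(m, y). (m, atom c m y)) ` (UNIV \<times> V)" by (auto simp: levels_def)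
  moreover have "countable ((\<lambda>(m, y). (m, atom c m y)) ` ((UNIV :: nat set) \<times> V))"
    using assms by (intro countable_image countable_SIGMA) auto
  ultimately show ?thesis by (rule countable_subset)
qed

lemma functionals_lepoll: assumes "countable V" shows "functionals \<lesssim> (UNIV :: real set)"
proof -
  let ?e = "from_nat_into (levels c0)"
  have ne: "levels c0 \<noteq> {}" using level_0[OF c0] by blast
  have r: "range ?e = levels c0" using range_from_nat_into[OF ne countable_levels[OF assms]] .
  have "inj_on (\<lambda>F n. F (ind (snd (?e n)))) functionals"
  proof (rule inj_onI)
    fix F F' assume functionals: "F \<in> functionals" "F' \<in> functionals" and eq: "(\<lambda>n. F (ind (snd (?e n)))) = (\<lambda>n. F' (ind (snd (?e n))))"
    have "F (ind (snd t)) = F' (ind (snd t))" if "t \<in> levels c0" for t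
      using r that fun_cong[OF eq] by (metis imageE)
    then show "F = F'" using functional_eq[OF c0] functionals by (simp add: functionals_def)
  qed
  then have "functionals \<lesssim> (UNIV :: (nat \<Rightarrow> complex) set)" unfolding lepoll_def by blast
  then show ?thesis using complex_seq_lepoll_reals lepoll_trans by blast
qed

lemma invariant_total_zero:
  assumes F: "F \<in> functionals" and inv: "\<And>g. g \<in> carrier G \<Longrightarrow> transl g F = F"
    and unb: "\<And>D. \<exists>g\<in>carrier G. D < d c0 (act g c0)"
  shows "F (ind V) = 0"
proof -
  have F': "functional F" "sq F summable_on levels c0" using F by (auto simp: functionals_def)
  define B where "B = infsum (sq F) (levels c0)"
  have B0: "sq F t \<le> B" if "t \<in> levels c0" for t
    using finite_sum_le_infsum[OF F'(2), of "{t}"] that sq_ge0 unfolding B_def by auto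
  \<comment> \<open>Invariance transports the bound from \<open>c0\<close> to every base vertex of
    the orbit.\<close>
  have B1: "sq F t \<le> B" if g: "g \<in> carrier G" and t: "t \<in> levels (act g c0)" for g t
  proof -
    obtain s where s: "s \<in> levels c0" "t = shift g s" using shift_bij[OF g c0] t unfolding bij_betw_def by blast
    have "sq F t = sq (transl (inv g) F) s" using sq_shift[OF g c0 s(1)] s(2) by simp
    then show ?thesis using inv[of "inv g"] g B0[OF s(1)] by simp
  qed
  have Bn: "0 \<le> B" using B0[OF level_0[OF c0]] sq_ge0[of F "(0, V)"] by linarith
  define c1 where "c1 = 2 * wv + 2 * \<delta> + 1"
  define K where "K = sqrt B * 256 * (2 * Kb + Kb\<^sup>2 * (real KJ + 1))"
  have Kb0: "0 \<le> Kb" by (simp add: Kb_def)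
  have est: "cmod (F (ind V)) \<le> K / (real l + 1)" if g: "g \<in> carrier G" and l: "l = d c0 (act g c0)" "2 * c1 + 4 \<le> l" for g l
  proof -
    \<comment> \<open>About half of \<open>l\<close>, as large as \<open>small_total\<close> allows.
      For \<open>l\<close> at least \<open>2 * c1 + 4\<close> it satisfies
      \<open>l + 1 \<le> 4 * (N + 1)\<close>, whence the factor \<open>256 = 4 ^ 4\<close> in
      \<open>K\<close>.\<close>
    define N where "N = (l - c1) div 2"
    have "2 * N \<le> l - c1" "l - c1 \<le> 2 * N + 1" unfolding N_def by simp_all
    then have N12: "2 * N + c1 \<le> l" "l \<le> 2 * N + 1 + c1" using l(2) by linarith+
    have N: "2 * N + 2 * wv + 2 * \<delta> < l" using N12(1) unfolding c1_def by linarith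
    have "l + 1 \<le> 4 * N + 4" using N12(2) l(2) by linarith
    then have N4: "real l + 1 \<le> 4 * (real N + 1)" by simp
    define x where "x = real l + 1"
    have x: "1 \<le> x" "real l \<le> x" by (auto simp: x_def)
    have "cmod (F (ind V)) \<le> sqrt B / (real N + 1) ^ 4 * (2 * (Kb * l) + (Kb * l)\<^sup>2 * (real KJ * (real l + 1) + 1))"
      unfolding l(1) by (rule small_total[OF c0 act_V[OF g c0] F'(1)]) (use N l(1) B0 B1[OF g] in auto)
    also have "\<dots> \<le> sqrt B * 256 / x ^ 4 * ((2 * Kb + Kb\<^sup>2 * (real KJ + 1)) * x ^ 3)"
    proof (rule mult_mono)
      have "(x / 4) ^ 4 \<le> (real N + 1) ^ 4" using N4 x by (intro power_mono) (auto simp: x_def)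
      then have "x ^ 4 \<le> 256 * (real N + 1) ^ 4" by (simp add: power_divide)
      then have "sqrt B * x ^ 4 \<le> sqrt B * (256 * (real N + 1) ^ 4)" using Bn by (intro mult_left_mono) auto
      then show "sqrt B / (real N + 1) ^ 4 \<le> sqrt B * 256 / x ^ 4" using x by (simp add: field_simps)
      have "2 * (Kb * l) \<le> 2 * Kb * x ^ 3"
      proof -
        have "real l \<le> x ^ 3" using x power_increasing[of 1 3 x] by simp
        then have "2 * Kb * l \<le> 2 * Kb * x ^ 3" using Kb0 by (intro mult_left_mono) auto
        then show ?thesis by simp
      qed
      moreover have "(Kb * l)\<^sup>2 * (real KJ * (real l + 1) + 1) \<le> Kb\<^sup>2 * (real KJ + 1) * x ^ 3"
      proof -
        have "(real l)\<^sup>2 \<le> x\<^sup>2" using x by (intro power_mono) auto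
        moreover have "real KJ * (real l + 1) + 1 \<le> (real KJ + 1) * x" using x by (simp add: x_def algebra_simps)
        ultimately have "(real l)\<^sup>2 * (real KJ * (real l + 1) + 1) \<le> x\<^sup>2 * ((real KJ + 1) * x)" by (intro mult_mono) auto
        then have "Kb\<^sup>2 * ((real l)\<^sup>2 * (real KJ * (real l + 1) + 1)) \<le> Kb\<^sup>2 * (x\<^sup>2 * ((real KJ + 1) * x))"
          by (intro mult_left_mono) auto
        moreover have "x\<^sup>2 * ((real KJ + 1) * x) = (real KJ + 1) * x ^ 3" by (simp add: power2_eq_square power3_eq_cube)
        ultimately show ?thesis by (simp add: power_mult_distrib mult.assoc)
      qed
      ultimately show "2 * (Kb * l) + (Kb * l)\<^sup>2 * (real KJ * (real l + 1) + 1) \<le> (2 * Kb + Kb\<^sup>2 * (real KJ + 1)) * x ^ 3"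
        unfolding distrib_right by linarith
    qed (use Kb0 Bn x in auto)
    also have "\<dots> = K / x" using x unfolding K_def by (simp add: eval_nat_numeral)
    finally show ?thesis by (simp add: x_def)
  qed
  have "cmod (F (ind V)) \<le> \<epsilon>" if e: "\<epsilon> > 0" for \<epsilon>
  proof -
    obtain g where g: "g \<in> carrier G" "max (2 * c1 + 4) (nat \<lceil>K / \<epsilon>\<rceil>) < d c0 (act g c0)" using unb by blast
    define l where "l = d c0 (act g c0)"
    have "K / \<epsilon> \<le> real l + 1" using g(2) unfolding l_def by linarith
    then have "K / (real l + 1) \<le> \<epsilon>" using e by (simp add: field_simps)
    moreover have "cmod (F (ind V)) \<le> K / (real l + 1)" using est[OF g(1) l_def] g(2) by (simp add: l_def)
    ultimately show ?thesis by linarith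
  qed
  then have "cmod (F (ind V)) \<le> 0" by (rule field_le_epsilon[of _ 0, simplified])
  then show ?thesis by simp
qed

lemma functionals_func_space: assumes \<iota>: "inj_on \<iota> functionals" shows "func_space functionals (levels c0) (\<lambda>t. ind (snd t)) (\<lambda>t. wt (fst t)) \<iota>"
proof
  have functional0: "functional (\<lambda>_. 0)" by (simp add: functional_def)
  then show "(\<lambda>_. 0) \<in> functionals" by (simp add: functionals_def sq_def[abs_def])
  show "(\<lambda>x. f x + g x) \<in> functionals" if fg: "f \<in> functionals" "g \<in> functionals" for f g
  proof -
    have "sq (\<lambda>x. f x + g x) summable_on levels c0"
    proof (rule summable_on_comparison_test)
      show "(\<lambda>t. 2 * sq f t + 2 * sq g t) summable_on levels c0"
        using fg by (intro summable_on_add summable_on_cmult_right) (auto simp: functionals_def)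
      fix t :: "nat \<times> 'v set"
      let ?a = "f (ind (snd t))" and ?b = "g (ind (snd t))"
      have "(cmod (?a + ?b))\<^sup>2 \<le> (cmod ?a + cmod ?b)\<^sup>2" by (intro power_mono norm_triangle_ineq) auto
      also have "\<dots> \<le> 2 * (cmod ?a)\<^sup>2 + 2 * (cmod ?b)\<^sup>2"
        using sum_squares_bound[of "cmod ?a" "cmod ?b"] by (simp add: power2_sum)
      finally have "wt (fst t) * (cmod (?a + ?b))\<^sup>2 \<le> wt (fst t) * (2 * (cmod ?a)\<^sup>2 + 2 * (cmod ?b)\<^sup>2)"
        using wt_ge1[of "fst t"] by (intro mult_left_mono) auto
      then show "sq (\<lambda>x. f x + g x) t \<le> 2 * sq f t + 2 * sq g t" by (simp add: sq_def algebra_simps)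
    qed (rule sq_ge0)
    moreover have "functional (\<lambda>x. f x + g x)" using fg by (auto simp: functionals_def functional_def algebra_simps)
    ultimately show ?thesis by (simp add: functionals_def)
  qed
  show "(\<lambda>x. a * f x) \<in> functionals" if f: "f \<in> functionals" for a f
  proof -
    have "sq (\<lambda>x. a * f x) = (\<lambda>t. (cmod a)\<^sup>2 * sq f t)"
      by (auto simp: sq_def norm_mult power_mult_distrib)
    moreover have "functional (\<lambda>x. a * f x)" using f by (auto simp: functionals_def functional_def algebra_simps)
    ultimately show ?thesis using f by (auto simp: functionals_def intro: summable_on_cmult_right)
  qed
  show "(\<lambda>i. wt (fst i) * (cmod (f (ind (snd i))))\<^sup>2) summable_on levels c0" if "f \<in> functionals" for f
    using that by (simp add: functionals_def sq_def[abs_def])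
  show "f = (\<lambda>_. 0)" if "f \<in> functionals" "\<And>i. i \<in> levels c0 \<Longrightarrow> f (ind (snd i)) = 0" for f
    using functional_eq[OF c0 _ functional0, of f] that by (auto simp: functionals_def)
  show "\<exists>g\<in>functionals. \<forall>i\<in>levels c0. g (ind (snd i)) = y i"
    if f: "\<And>k. fk k \<in> functionals" and y: "\<And>i. i \<in> levels c0 \<Longrightarrow> (\<lambda>k. fk k (ind (snd i))) \<longlonglongrightarrow> y i"
      and s: "(\<lambda>i. wt (fst i) * (cmod (y i))\<^sup>2) summable_on levels c0" for fk y
  proof -
    have "functional (fk k)" for k using f by (simp add: functionals_def)
    then have "\<exists>g. functional g \<and> (\<forall>t\<in>levels c0. g (ind (snd t)) = y t)"
      by (rule functional_limit[OF c0, of fk y]) (rule y)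
    then obtain g where g: "functional g" "\<forall>t\<in>levels c0. g (ind (snd t)) = y t" by blast
    have "sq g summable_on levels c0 \<longleftrightarrow> (\<lambda>i. wt (fst i) * (cmod (y i))\<^sup>2) summable_on levels c0"
      using g by (intro summable_on_cong) (auto simp: sq_def)
    then show ?thesis using g s by (auto simp: functionals_def)
  qed
  show "0 < wt (fst i)" for i :: "nat \<times> 'v set" using wt_ge1[of "fst i"] by linarith
qed (rule \<iota>)

theorem not_strong_T_of_action:
  assumes V: "countable V" and unb: "\<And>D. \<exists>g\<in>carrier G. D < d c0 (act g c0)"
    and universe: "(UNIV :: real set) \<lesssim> (UNIV :: 'h set)"
  shows "\<not> strong_property_T TYPE('h) G (discrete_topology (carrier G))"
proof -
  have "functionals \<lesssim> (UNIV :: 'h set)" using functionals_lepoll[OF V] universe lepoll_trans by blast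
  then obtain \<iota> :: "(('v \<Rightarrow> complex) \<Rightarrow> complex) \<Rightarrow> 'h" where \<iota>: "inj_on \<iota> functionals" unfolding lepoll_def by blast
  interpret FS: func_space functionals "levels c0" "\<lambda>t. ind (snd t)" "\<lambda>t. wt (fst t)" \<iota>
    by (rule functionals_func_space[OF \<iota>])
  have nm: "FS.nm F = sqrt (infsum (sq F) (levels c0))" for F
    unfolding FS.nm_def sq_def[abs_def] ..
  have VS: "ind V \<in> atom_span" using atom_span_ind V_atom c0 by blast
  have frep: "FS.frep G (ind V) transl"
    unfolding FS.frep_def
  proof (intro conjI ballI allI)
    fix g F assume g: "g \<in> carrier G" and F: "F \<in> functionals"
    show "transl g F \<in> functionals" by (rule transl_growth(1)[OF g F])
    show "transl g F (ind V) = F (ind V)" using VS pull_V[OF g] by (simp add: transl_def)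
    show "transl g (\<lambda>x. a * F x) = (\<lambda>x. a * transl g F x)" for a by (auto simp: transl_def)
    show "transl g (\<lambda>x. F x + F' x) = (\<lambda>x. transl g F x + transl g F' x)" for F' by (auto simp: transl_def)
  next
    fix F assume F: "F \<in> functionals"
    then have off: "\<phi> \<notin> atom_span \<Longrightarrow> F \<phi> = 0" for \<phi> by (simp add: functionals_def functional_def)
    show "transl \<one> F = F" using off pull_one by (auto simp: transl_def)
    fix g h assume gh: "g \<in> carrier G" "h \<in> carrier G"
    show "transl (g \<otimes> h) F = transl g (transl h F)" using pull_mult[OF gh] pull_span[OF gh(1)] by (auto simp: transl_def)
  qed
  have growth: "\<exists>L\<ge>0. \<forall>g\<in>carrier G. \<forall>f\<in>functionals. FS.nm (transl g f) \<le> L * exp (t * len g) * FS.nm f" if t: "t > 0" for t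
  proof -
    obtain L where L: "L \<ge> 0" "\<forall>x\<ge>0. (x + 1) ^ 5 \<le> L * exp (t * x)" using poly_le_exp[OF t] by blast
    have KB0: "0 \<le> KB" by (simp add: KB_def)
    have "FS.nm (transl g f) \<le> (sqrt KB * L) * exp (t * len g) * FS.nm f" if g: "g \<in> carrier G" and f: "f \<in> functionals" for g f
    proof -
      have l0: "0 \<le> len g" by (simp add: len_def)
      have "FS.nm (transl g f) \<le> sqrt (KB * (len g + 1) ^ 10 * infsum (sq f) (levels c0))"
        unfolding nm using transl_growth(2)[OF g f] by (rule real_sqrt_le_mono)
      also have "\<dots> = sqrt KB * sqrt ((len g + 1) ^ 10) * FS.nm f" unfolding nm by (simp add: real_sqrt_mult)
      also have "sqrt ((len g + 1) ^ 10) = (len g + 1) ^ 5"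
        by (rule real_sqrt_unique) (use l0 in \<open>auto simp flip: power_mult\<close>)
      also have "sqrt KB * (len g + 1) ^ 5 * FS.nm f \<le> sqrt KB * (L * exp (t * len g)) * FS.nm f"
        using L(2) l0 KB0 FS.nm_ge0 by (intro mult_right_mono mult_left_mono) auto
      finally show ?thesis by (simp add: mult.assoc)
    qed
    then show ?thesis using L(1) KB0 by (intro exI[of _ "sqrt KB * L"]) auto
  qed
  obtain f1 where f1: "functional f1" "sq f1 summable_on levels c0" "f1 (ind V) = 1" using ex_functional[OF c0] by blast
  show ?thesis
  proof (rule FS.not_strong_T[OF group_axioms length_len frep growth, where C = 1 and ?f1.0 = f1])
    show "cmod (f (ind V)) \<le> 1 * FS.nm f" if "f \<in> functionals" for f
      using FS.coord_le[OF that level_0[OF c0]] by (simp add: wt_def)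
    show "f1 \<in> functionals" "f1 (ind V) \<noteq> 0" using f1 by (auto simp: functionals_def)
    show "f (ind V) = 0" if "f \<in> functionals" "\<And>g. g \<in> carrier G \<Longrightarrow> transl g f = f" for f
      by (rule invariant_total_zero[OF that unb])
  qed
qed

end

section \<open>The coned-off graph\<close>

text \<open>Lists of generators marked with a sign are evaluated as words, and these exhaust the
  generated subgroup.\<close>

lemma (in group) countable_generate:
  assumes "countable S" "S \<subseteq> carrier G" shows "countable (generate G S)"
proof -
  define val where "val = (\<lambda>p :: 'a \<times> bool. if snd p then fst p else inv (fst p))"
  define ev where "ev = (\<lambda>xs. foldr (\<lambda>p x. val p \<otimes> x) xs \<one>)"
  have val: "val p \<in> carrier G" if "p \<in> S \<times> UNIV" for p using that assms(2) by (auto simp: val_def)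
  have ev: "xs \<in> lists (S \<times> UNIV) \<Longrightarrow> ev xs \<in> carrier G" for xs
    by (induction xs) (auto simp: ev_def intro: val)
  have app: "xs \<in> lists (S \<times> UNIV) \<Longrightarrow> ys \<in> lists (S \<times> UNIV) \<Longrightarrow> ev (xs @ ys) = ev xs \<otimes> ev ys" for xs ys
  proof (induction xs)
    case Nil then show ?case using ev[of ys] by (simp add: ev_def)
  next
    case (Cons p xs)
    then have V: "val p \<in> carrier G" "ev xs \<in> carrier G" "ev ys \<in> carrier G" using val ev by auto
    have "ev ((p # xs) @ ys) = val p \<otimes> ev (xs @ ys)" "ev (p # xs) = val p \<otimes> ev xs" by (simp_all add: ev_def)
    then show ?case using Cons V by (simp add: m_assoc)
  qed
  have one: "ev [p] = val p" if "p \<in> S \<times> UNIV" for p using val[OF that] by (simp add: ev_def)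
  have "generate G S \<subseteq> ev ` lists (S \<times> UNIV)"
  proof
    fix x assume "x \<in> generate G S"
    then show "x \<in> ev ` lists (S \<times> UNIV)"
    proof induction
      case one
      have "ev [] = \<one>" by (simp add: ev_def)
      then show ?case by (intro image_eqI[of _ _ "[]"]) auto
    next
      case (incl h)
      then have "ev [(h, True)] = h" using one[of "(h, True)"] by (simp add: val_def)
      then show ?case using incl by (intro image_eqI[of _ _ "[(h, True)]"]) auto
    next
      case (inv h)
      then have "ev [(h, False)] = inv h" using one[of "(h, False)"] by (simp add: val_def)
      then show ?case using inv by (intro image_eqI[of _ _ "[(h, False)]"]) auto
    next
      case (eng h1 h2)
      then obtain xs ys where "xs \<in> lists (S \<times> UNIV)" "h1 = ev xs" "ys \<in> lists (S \<times> UNIV)" "h2 = ev ys" by blast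
      then show ?case using app by (intro image_eqI[of _ _ "xs @ ys"]) auto
    qed
  qed
  moreover have "countable (ev ` lists (S \<times> (UNIV :: bool set)))" using assms by (intro countable_image countable_lists) auto
  ultimately show ?thesis by (rule countable_subset)
qed

definition coset_act :: "('a, 'b) monoid_scheme \<Rightarrow> 'a \<Rightarrow> 'a cone_vertex \<Rightarrow> 'a cone_vertex" where
  "coset_act G g v = (case v of Elt x \<Rightarrow> Elt (g \<otimes>\<^bsub>G\<^esub> x) | Cone i C \<Rightarrow> Cone i (g <#\<^bsub>G\<^esub> C))"

lemma coset_act_simps [simp]:
  "coset_act G g (Elt x) = Elt (g \<otimes>\<^bsub>G\<^esub> x)" "coset_act G g (Cone i C) = Cone i (g <#\<^bsub>G\<^esub> C)"
  by (simp_all add: coset_act_def)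

context
  fixes G :: "('a, 'b) monoid_scheme" (structure) and k :: nat and P :: "nat \<Rightarrow> 'a set" and S :: "'a set"
  assumes G: "group G" and P: "\<And>i. i \<in> {1..k} \<Longrightarrow> subgroup (P i) G" and S: "S \<subseteq> carrier G"
begin

interpretation group G by (rule G)

abbreviation "VV \<equiv> coned_off_vertices G k P"
abbreviation "EE \<equiv> coned_off_edges G S k P"

lemma PG: "i \<in> {1..k} \<Longrightarrow> P i \<subseteq> carrier G" "i \<in> {1..k} \<Longrightarrow> \<one> \<in> P i"
  using P subgroup.subset subgroup.one_closed by blast+

lemma VV_cases:
  assumes "v \<in> VV"
  obtains x where "v = Elt x" "x \<in> carrier G" | i a where "v = Cone i (a <# P i)" "i \<in> {1..k}" "a \<in> carrier G"
  using assms by (auto simp: coned_off_vertices_def LCOSETS_def)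

lemma Elt_V: "x \<in> carrier G \<Longrightarrow> Elt x \<in> VV"
  by (simp add: coned_off_vertices_def)

lemma Cone_V: "i \<in> {1..k} \<Longrightarrow> a \<in> carrier G \<Longrightarrow> Cone i (a <# P i) \<in> VV"
  by (auto simp: coned_off_vertices_def LCOSETS_def)

lemma EE_cases:
  assumes "e \<in> EE"
  obtains x s where "e = {Elt x, Elt (x \<otimes> s)}" "x \<in> carrier G" "s \<in> S" "s \<noteq> \<one>"
  | i a h where "e = {Cone i (a <# P i), Elt (a \<otimes> h)}" "i \<in> {1..k}" "a \<in> carrier G" "h \<in> P i"
  using assms by (fastforce simp: coned_off_edges_def cayley_edges_def)

lemma EE_Elt: "x \<in> carrier G \<Longrightarrow> s \<in> S \<Longrightarrow> s \<noteq> \<one> \<Longrightarrow> {Elt x, Elt (x \<otimes> s)} \<in> EE"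
  unfolding coned_off_edges_def cayley_edges_def by (rule UnI1, rule image_eqI[of _ _ "{x, x \<otimes> s}"]) auto

lemma EE_Cone: "i \<in> {1..k} \<Longrightarrow> a \<in> carrier G \<Longrightarrow> h \<in> P i \<Longrightarrow> {Cone i (a <# P i), Elt (a \<otimes> h)} \<in> EE"
  unfolding coned_off_edges_def by blast

lemma EE_ends: assumes "e \<in> EE" shows "\<exists>u v. e = {u, v} \<and> u \<noteq> v \<and> u \<in> VV \<and> v \<in> VV"
  using assms
proof (cases rule: EE_cases)
  case (1 x s)
  then have s: "s \<in> carrier G" using S by blast
  then have "x \<otimes> s \<noteq> x" using 1 by simp
  then show ?thesis using 1 s Elt_V by (intro exI[of _ "Elt x"] exI[of _ "Elt (x \<otimes> s)"]) auto
next
  case (2 i a h)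
  then have "h \<in> carrier G" using PG by blast
  then show ?thesis using 2 Elt_V Cone_V by (intro exI[of _ "Cone i (a <# P i)"] exI[of _ "Elt (a \<otimes> h)"]) auto
qed

lemma act_in_V: assumes "g \<in> carrier G" "v \<in> VV" shows "coset_act G g v \<in> VV"
  using assms(2)
proof (cases rule: VV_cases)
  case (2 i a)
  then show ?thesis using assms Cone_V[of i "g \<otimes> a"] lcos_m_assoc[OF PG(1) assms(1)] by simp
qed (use assms Elt_V in simp)

lemma act_in_E: assumes g: "g \<in> carrier G" and e: "e \<in> EE" shows "coset_act G g ` e \<in> EE"
  using e
proof (cases rule: EE_cases)
  case (1 x s)
  then have "coset_act G g ` e = {Elt (g \<otimes> x), Elt ((g \<otimes> x) \<otimes> s)}" using g S by (auto simp: m_assoc)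
  then show ?thesis using EE_Elt[of "g \<otimes> x" s] 1 g by simp
next
  case (2 i a h)
  then have "h \<in> carrier G" using PG by blast
  then have "coset_act G g ` e = {Cone i ((g \<otimes> a) <# P i), Elt ((g \<otimes> a) \<otimes> h)}"
    using 2 g lcos_m_assoc[OF PG(1) g] by (simp add: m_assoc)
  then show ?thesis using EE_Cone[of i "g \<otimes> a" h] 2 g by simp
qed

lemma act_one_mult:
  assumes v: "v \<in> VV" shows "coset_act G \<one> v = v"
    "g \<in> carrier G \<Longrightarrow> h \<in> carrier G \<Longrightarrow> coset_act G (g \<otimes> h) v = coset_act G g (coset_act G h v)"
proof -
  show "coset_act G \<one> v = v"
    using v
  proof (cases rule: VV_cases)
    case (2 i a)
    then show ?thesis using lcos_m_assoc[OF PG(1) one_closed] by simp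
  qed simp
  assume gh: "g \<in> carrier G" "h \<in> carrier G"
  show "coset_act G (g \<otimes> h) v = coset_act G g (coset_act G h v)"
    using v
  proof (cases rule: VV_cases)
    case (2 i a)
    have p: "P i \<subseteq> carrier G" using PG 2 by blast
    show ?thesis using 2 gh lcos_m_assoc[OF p] by (simp add: m_assoc)
  qed (use gh m_assoc in simp)
qed

lemma countable_VV: assumes "countable (carrier G)" shows "countable VV"
proof -
  have "VV \<subseteq> Elt ` carrier G \<union> (\<lambda>(i, a). Cone i (a <# P i)) ` ({1..k} \<times> carrier G)"
    by (auto elim!: VV_cases)
  moreover have "countable (Elt ` carrier G \<union> (\<lambda>(i, a). Cone i (a <# P i)) ` ({1..k} \<times> carrier G))"
    using assms by (intro countable_Un countable_image countable_SIGMA) auto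
  ultimately show ?thesis by (rule countable_subset)
qed

lemma unbounded_orbit:
  assumes fg: "fine_graph VV EE" and k: "1 \<le> k"
    and inf: "\<And>i. i \<in> {1..k} \<Longrightarrow> infinite (lcosets\<^bsub>G\<^esub> (P i))"
  shows "\<exists>g\<in>carrier G. D < graph_dist VV EE (Elt \<one>) (coset_act G g (Elt \<one>))"
proof (rule ccontr)
  assume no: "\<not> ?thesis"
  interpret fine_graph VV EE by (rule fg)
  have lc: "lcosets\<^bsub>G\<^esub> (P i) = (\<lambda>a. a <# P i) ` carrier G" for i by (auto simp: LCOSETS_def)
  have infG: "infinite (carrier G)" using inf[of 1] k unfolding lc by auto
  have c: "Elt \<one> \<in> VV" by (rule Elt_V) simp
  \<comment> \<open>The bounded orbit consists of all group elements, and each cone vertex is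
    adjacent to one of them; so the whole graph is bounded and \<open>finite_centre\<close>
    applies.\<close>
  have near1: "d (Elt \<one>) v \<le> D + 1" if v: "v \<in> VV" for v
  proof -
    have E: "d (Elt \<one>) (Elt x) \<le> D" if "x \<in> carrier G" for x
    proof -
      have "\<not> D < d (Elt \<one>) (coset_act G x (Elt \<one>))" using no that by blast
      then show ?thesis using that by simp
    qed
    show ?thesis using v
    proof (cases rule: VV_cases)
      case (1 x) then show ?thesis using E[of x] by simp
    next
      case (2 i a)
      have "{Cone i (a <# P i), Elt (a \<otimes> \<one>)} \<in> EE" using EE_Cone PG 2 by blast
      then have e: "{Elt a, v} \<in> EE" using 2 by (simp add: insert_commute)
      show ?thesis using d_tri[OF c Elt_V v, of a] E[of a] d_edge[OF e] 2 by simp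
    qed
  qed
  have bd: "d u v \<le> 2 * D + 2" if "u \<in> VV" "v \<in> VV" for u v
    using d_tri[OF that(1) c that(2)] near1[OF that(1)] near1[OF that(2)] d_sym[OF that(1) c] by linarith
  have fin: "finite centre" "centre \<noteq> {}" using finite_centre[OF bd] c by auto
  obtain v where v: "v \<in> centre" using fin by blast
  then have vV: "v \<in> VV" by (simp add: centre_def)
  have act_d: "d (coset_act G g u) (coset_act G g w) \<le> d u w" if "g \<in> carrier G" "u \<in> VV" "w \<in> VV" for g u w
  proof (rule d_le, rule wlk_map[OF _ _ wlk_d])
    fix x y assume "{x, y} \<in> EE"
    then show "{coset_act G g x, coset_act G g y} \<in> EE" using act_in_E[OF that(1), of "{x, y}"] by simp
  qed (use that act_in_V in auto)
  have finV: "finite (d u ` VV)" if "u \<in> VV" for u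
    using finite_subset[of "d u ` VV" "{..2 * D + 2}"] bd that by auto
  have ecc_le: "ecc (coset_act G g u) \<le> ecc u" if g: "g \<in> carrier G" and u: "u \<in> VV" for g u
    unfolding ecc_def
  proof (rule Max.boundedI)
    show "finite (d (coset_act G g u) ` VV)" using finV act_in_V g u by blast
    show "d (coset_act G g u) ` VV \<noteq> {}" using c by blast
    fix n assume "n \<in> d (coset_act G g u) ` VV"
    then obtain w where w: "w \<in> VV" "n = d (coset_act G g u) w" by blast
    have w': "coset_act G (inv g) w \<in> VV" using act_in_V w g by simp
    have "coset_act G g (coset_act G (inv g) w) = w" using act_one_mult(2)[OF w(1), of g "inv g"] act_one_mult(1)[OF w(1)] g by simp
    then have "n \<le> d u (coset_act G (inv g) w)" using act_d[OF g u w'] w(2) by simp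
    also have "\<dots> \<le> Max (d u ` VV)" using finV[OF u] w' by (intro Max_ge) auto
    finally show "n \<le> Max (d u ` VV)" .
  qed
  have "coset_act G g v \<in> centre" if "g \<in> carrier G" for g
    unfolding centre_def using act_in_V[OF that vV] ecc_le[OF that vV] v le_trans by (auto simp: centre_def)
  then have sub: "(\<lambda>g. coset_act G g v) ` carrier G \<subseteq> centre" by blast
  then have finO: "finite ((\<lambda>g. coset_act G g v) ` carrier G)" using fin finite_subset by blast
  \<comment> \<open>The orbit of a central vertex is finite. For a group element the action is free
    and \<open>G\<close> would be finite; for a cone vertex the orbit contains all cosets of
    \<open>P i\<close>.\<close>
  show False using vV
  proof (cases rule: VV_cases)
    case (1 x)
    have "inj_on (\<lambda>g. coset_act G g v) (carrier G)" using 1 by (auto simp: inj_on_def)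
    then show False using finO infG finite_imageD by blast
  next
    case (2 i a)
    have p: "P i \<subseteq> carrier G" using PG 2 by blast
    have "Cone i ` (lcosets\<^bsub>G\<^esub> (P i)) \<subseteq> (\<lambda>g. coset_act G g v) ` carrier G"
    proof
      fix u assume "u \<in> Cone i ` (lcosets\<^bsub>G\<^esub> (P i))"
      then obtain b where b: "u = Cone i (b <# P i)" "b \<in> carrier G" unfolding lc by blast
      have "coset_act G (b \<otimes> inv a) v = Cone i ((b \<otimes> inv a \<otimes> a) <# P i)" using 2 b lcos_m_assoc[OF p] by simp
      also have "b \<otimes> inv a \<otimes> a = b" using 2 b by (simp add: m_assoc)
      finally show "u \<in> (\<lambda>g. coset_act G g v) ` carrier G"
        using 2 b by (intro image_eqI[of _ _ "b \<otimes> inv a"]) auto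
    qed
    then have "finite (Cone i ` (lcosets\<^bsub>G\<^esub> (P i)))" using finO finite_subset by blast
    then have "finite (lcosets\<^bsub>G\<^esub> (P i))" by (rule finite_imageD) (simp add: inj_on_def)
    then show False using inf 2 by blast
  qed
qed

end

text \<open>The hypothesis \<open>universe\<close> makes room in \<open>'h\<close> for the Hilbert
  space, whose vectors are determined by countably many complex coordinates, so that there are at
  most continuum many of them.\<close>

theorem corollary1p4:
  fixes G :: "('a, 'b) monoid_scheme" and k :: nat and P :: "nat \<Rightarrow> 'a set"
  assumes "group G"
    and "finitely_generated G"
    and "1 \<le> k"
    and "\<And>i. i \<in> {1..k} \<Longrightarrow> subgroup (P i) G"
    and "\<And>i. i \<in> {1..k} \<Longrightarrow> infinite (lcosets\<^bsub>G\<^esub> (P i))"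
    and "relatively_hyperbolic G k P"
    and universe: "(UNIV :: real set) \<lesssim> (UNIV :: 'h set)"
  shows "\<not> strong_property_T TYPE('h) G (discrete_topology (carrier G))"
proof -
  interpret group G by (rule assms(1))
  obtain S where S: "finite S" "S \<subseteq> carrier G" "generate G S = carrier G"
    and hyp: "hyperbolic_graph (coned_off_vertices G k P) (coned_off_edges G S k P)"
    and fine: "uniformly_fine (coned_off_vertices G k P) (coned_off_edges G S k P)"
    using assms(6) unfolding relatively_hyperbolic_def finite_generating_set_def by blast
  let ?V = "coned_off_vertices G k P" and ?E = "coned_off_edges G S k P"
  obtain D where D: "delta_hyperbolic ?V ?E D" using hyp unfolding hyperbolic_graph_def by blast
  interpret fine_graph ?V ?E
    using EE_ends[OF assms(1,4) S(2)] hyp fine unfolding hyperbolic_graph_def by unfold_locales auto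
  interpret graph_action ?V ?E "nat \<lceil>D\<rceil>" G "coset_act G" "Elt \<one>\<^bsub>G\<^esub>"
  proof unfold_locales
    show "(\<exists>j\<le>l. d (s i) (t j) \<le> nat \<lceil>D\<rceil>) \<or> (\<exists>j\<le>m. d (s i) (r j) \<le> nat \<lceil>D\<rceil>)"
      if "geo s k a b" "geo t l b c" "geo r m a c" "i \<le> k" for s k a b t l c r m i
      by (rule thin_of_delta[OF D that])
    show "{coset_act G g u, coset_act G g v} \<in> ?E" if "g \<in> carrier G" "{u, v} \<in> ?E" for g u v
      using act_in_E[OF assms(1,4) S(2) that] by simp
  qed (use act_in_V[OF assms(1,4) S(2)] act_one_mult[OF assms(1,4) S(2)] Elt_V[OF assms(1,4) S(2)] in auto)
  show ?thesis
  proof (rule not_strong_T_of_action[OF _ _ universe])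
    have "countable (carrier G)" using countable_generate[OF countable_finite[OF S(1)] S(2)] S(3) by simp
    then show "countable ?V" by (intro countable_VV[where k = k and P = P, OF assms(1,4) S(2)])
    show "\<exists>g\<in>carrier G. N < d (Elt \<one>\<^bsub>G\<^esub>) (coset_act G g (Elt \<one>\<^bsub>G\<^esub>))" for N
      by (rule unbounded_orbit[where k = k and P = P, OF assms(1,4) S(2) fine_graph_axioms assms(3,5)])
  qed
qed

end
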